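(* Let $0<\delta<1$, $\hat\phi_k\sim k^{-2\gamma}$ with $\gamma>d/2$, and let $\phi,\psi,\varphi$ satisfy $\hat\psi_k=\hat\phi_k^\beta$, $\hat\varphi_k=\hat\phi_k^\alpha$ with $0\le\beta\le1$, $\alpha\ge\beta$. Let $D=\{(x_i,y_i)\}_{i=1}^{|\Lambda|}$ with $y_i=f^*(x_i)+\varepsilon_i$, where $f^*\in\mathcal N_\varphi$ and $\{\varepsilon_i\}_{i=1}^{|\Lambda|}$ is a set of mean-zero sub-Gaussian random variables with sub-Gaussian norm $M>0$. Let $\lambda>0$ and $W=\mathrm{diag}(w_1,\dots,w_{|\Lambda|})$ with $w_i>0$. Then with confidence $1-\delta$ (i.e. with probability at least $1-\delta$), $$\mathcal P_{D,\lambda,W,\beta}\le C_6\lambda^{-d/(4\gamma)}\left(\sum_{i=1}^{|\Lambda|}w_i^2+w_{\max}^2\right)^{1/2}\log\frac6\delta,$$ where $w_{\max}=\max_{i=1,\dots,|\Lambda|}w_i$ and $C_6$ is a constant depending only on $d,\gamma,M$.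
   Context: $\mathbb S^d\subset\mathbb R^{d+1}$ is the unit sphere, $d\omega$ the Lebesgue measure on it scaled so that $\int_{\mathbb S^d}d\omega=1$, $L^2=L^2(\mathbb S^d)$. $\{Y_{k,\ell}\}_{\ell=1}^{Z(d,k)}$ is an $L^2$-orthonormal basis of the spherical harmonics of degree $k$ (a space of dimension $Z(d,k)$), $\hat f_{k,\ell}=\int fY_{k,\ell}d\omega$. A spherical basis function $\phi$ on $[-1,1]$ is given by $\phi(x\cdot x')=\sum_{k\ge0}\hat\phi_k\sum_\ell Y_{k,\ell}(x)Y_{k,\ell}(x')$, with $\hat\phi_k>0$ and $\sum_k\hat\phi_kZ(d,k)<\infty$; $\phi_x(x')=\phi(x\cdot x')$. The native space $\mathcal N_\phi$ is the Hilbert space of $f=\sum\hat f_{k,\ell}Y_{k,\ell}$ with $\|f\|_\phi^2=\sum_k\hat\phi_k^{-1}\sum_\ell\hat f_{k,\ell}^2<\infty$; $\mathcal N_\psi,\mathcal N_\varphi$ are defined in the same way from $\hat\psi_k,\hat\varphi_k$. $\hat\phi_k\sim k^{-2\gamma}$ means two-sided bounds (for $k\ge1$) with constants depending only on $d$. $\Lambda=\{x_i\}_{i=1}^{|\Lambda|}\subset\mathbb S^d$ is a finite set and $f^*:\mathbb S^d\to\mathbb R$ a function. $L_\phi f(x)=\int f(x')\phi(x\cdot x')d\omega(x')$ on $\mathcal N_\phi$. With $S_{\Lambda,W}^T\mathbf y_{\Lambda,W}=\sum_iw_iy_i\phi_{x_i}$ and $\mathcal L_{\phi,\psi,\Lambda,W}f=\sum_iw_if(x_i)\phi_{x_i}$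 (regarded as an operator from $\mathcal N_\psi$ to $\mathcal N_\phi$), $$\mathcal P_{D,\lambda,W,\beta}=\|(L_\phi+\lambda I)^{-1/2}(S_{\Lambda,W}^T\mathbf y_{\Lambda,W}-\mathcal L_{\phi,\psi,\Lambda,W}f^* )\|_\phi.$$ A mean-zero random variable $\varepsilon$ is sub-Gaussian if there is $K\ge0$ with $E\exp(u\varepsilon)\le\exp(Ku^2)$ for all $u\in\mathbb R$; its sub-Gaussian norm is $\inf\{t>0:E\exp(\varepsilon^2/t^2)\le2\}$.
   Formalization: The random variables ε_i are additionally assumed independent, and C_6 may also depend on an upper bound for \hat\phi_0 (and on the implied constants of ∼, fixed with d); without either change the claim is false. *)

theory Defs
  imports "HOL-Probability.Probability"
begin

text \<open>Functions on the unit sphere are functions on the ambient Euclidean space of which only the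
  values on \<^term>\<open>sphere 0 1\<close> matter.\<close>

text \<open>The normalised surface measure, defined as usual through cones: the measure of a Borel subset
  \<open>E\<close> of the sphere is the proportion of the unit ball that projects radially into \<open>E\<close>.
  The space of this measure is the sphere.\<close>

definition sphere_measure :: "'a::euclidean_space measure" where
  "sphere_measure =
     restrict_space (distr (uniform_measure lborel (ball 0 1)) borel sgn) (sphere 0 1)"

definition laplacian :: "('a::euclidean_space \<Rightarrow> real) \<Rightarrow> 'a \<Rightarrow> real" where
  "laplacian p x = (\<Sum>b\<in>Basis. (deriv ^^ 2) (\<lambda>t. p (x + t *\<^sub>R b)) 0)"

definition spherical_harmonics :: "nat \<Rightarrow> ('a::euclidean_space \<Rightarrow> real) set" where
  "spherical_harmonics k = {f. \<exists>p. real_polynomial_function p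
      \<and> (\<forall>t x. p (t *\<^sub>R x) = t ^ k * p x)
      \<and> (\<forall>x. laplacian p x = 0)
      \<and> (\<forall>x\<in>sphere 0 1. f x = p x)}"

text \<open>For every degree \<open>k\<close>, the functions \<open>Y k 1, \<dots>, Y k (Z k)\<close> are an orthonormal basis of the
  spherical harmonics of degree \<open>k\<close>; in particular \<open>Z k\<close> is the dimension of that space.\<close>

definition harmonic_onb :: "(nat \<Rightarrow> nat) \<Rightarrow> (nat \<Rightarrow> nat \<Rightarrow> 'a::euclidean_space \<Rightarrow> real) \<Rightarrow> bool" where
  "harmonic_onb Z Y \<longleftrightarrow> (\<forall>k.
      (\<forall>l\<in>{1..Z k}. Y k l \<in> spherical_harmonics k)
    \<and> (\<forall>l\<in>{1..Z k}. \<forall>l'\<in>{1..Z k}.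
         (LINT x|sphere_measure. Y k l x * Y k l' x) = (if l = l' then 1 else 0))
    \<and> (\<forall>f\<in>spherical_harmonics k. \<exists>a. \<forall>x\<in>sphere 0 1. f x = (\<Sum>l=1..Z k. a l * Y k l x)))"

definition fourier_coeff ::
  "(nat \<Rightarrow> nat \<Rightarrow> 'a::euclidean_space \<Rightarrow> real) \<Rightarrow> ('a \<Rightarrow> real) \<Rightarrow> nat \<Rightarrow> nat \<Rightarrow> real" where
  "fourier_coeff Y f k l = (LINT x|sphere_measure. f x * Y k l x)"

definition spherical_basis_function ::
  "(nat \<Rightarrow> nat) \<Rightarrow> (nat \<Rightarrow> nat \<Rightarrow> 'a::euclidean_space \<Rightarrow> real) \<Rightarrow> (nat \<Rightarrow> real) \<Rightarrow> (real \<Rightarrow> real) \<Rightarrow> bool"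
where
  "spherical_basis_function Z Y c \<phi> \<longleftrightarrow>
      (\<forall>k. 0 < c k) \<and> summable (\<lambda>k. c k * real (Z k))
    \<and> (\<forall>x\<in>sphere 0 1. \<forall>x'\<in>sphere 0 1.
         (\<lambda>k. c k * (\<Sum>l=1..Z k. Y k l x * Y k l x')) sums \<phi> (x \<bullet> x'))"

text \<open>The native space with coefficients \<open>c\<close> consists of the square integrable functions that are
  the sum of their Fourier series (in mean square, which is the sense available for every \<open>c\<close>) and
  have finite native norm.  As an \<open>L\<^sup>2\<close> space it has almost everywhere equality as its equality.\<close>

definition native_space ::
  "(nat \<Rightarrow> nat) \<Rightarrow> (nat \<Rightarrow> nat \<Rightarrow> 'a::euclidean_space \<Rightarrow> real) \<Rightarrow> (nat \<Rightarrow> real) \<Rightarrow> ('a \<Rightarrow> real) set" where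
  "native_space Z Y c = {f. f \<in> borel_measurable sphere_measure
      \<and> integrable sphere_measure (\<lambda>x. (f x)\<^sup>2)
      \<and> (\<lambda>n. LINT x|sphere_measure.
            (f x - (\<Sum>k<n. \<Sum>l=1..Z k. fourier_coeff Y f k l * Y k l x))\<^sup>2) \<longlonglongrightarrow> 0
      \<and> summable (\<lambda>k. inverse (c k) * (\<Sum>l=1..Z k. (fourier_coeff Y f k l)\<^sup>2))}"

definition native_inner ::
  "(nat \<Rightarrow> nat) \<Rightarrow> (nat \<Rightarrow> nat \<Rightarrow> 'a::euclidean_space \<Rightarrow> real) \<Rightarrow> (nat \<Rightarrow> real) \<Rightarrow>
    ('a \<Rightarrow> real) \<Rightarrow> ('a \<Rightarrow> real) \<Rightarrow> real" where
  "native_inner Z Y c f g =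
     (\<Sum>k. inverse (c k) * (\<Sum>l=1..Z k. fourier_coeff Y f k l * fourier_coeff Y g k l))"

definition native_norm ::
  "(nat \<Rightarrow> nat) \<Rightarrow> (nat \<Rightarrow> nat \<Rightarrow> 'a::euclidean_space \<Rightarrow> real) \<Rightarrow> (nat \<Rightarrow> real) \<Rightarrow> ('a \<Rightarrow> real) \<Rightarrow> real" where
  "native_norm Z Y c f =
     sqrt (\<Sum>k. inverse (c k) * (\<Sum>l=1..Z k. (fourier_coeff Y f k l)\<^sup>2))"

definition kernel_op :: "(real \<Rightarrow> real) \<Rightarrow> ('a::euclidean_space \<Rightarrow> real) \<Rightarrow> 'a \<Rightarrow> real" where
  "kernel_op \<phi> f x = (LINT x'|sphere_measure. f x' * \<phi> (x \<bullet> x'))"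

text \<open>\<open>T\<close> is a positive self-adjoint operator on the native space and \<open>T \<circ> T\<close> is the inverse of \<open>A\<close>.
  Boundedness of \<open>T\<close> is automatic (Hellinger-Toeplitz).\<close>

definition is_inverse_sqrt ::
  "(nat \<Rightarrow> nat) \<Rightarrow> (nat \<Rightarrow> nat \<Rightarrow> 'a::euclidean_space \<Rightarrow> real) \<Rightarrow> (nat \<Rightarrow> real) \<Rightarrow>
    (('a \<Rightarrow> real) \<Rightarrow> 'a \<Rightarrow> real) \<Rightarrow> (('a \<Rightarrow> real) \<Rightarrow> 'a \<Rightarrow> real) \<Rightarrow> bool" where
  "is_inverse_sqrt Z Y c A T \<longleftrightarrow> (let H = native_space Z Y c in
      (\<forall>f\<in>H. T f \<in> H)
    \<and> (\<forall>f\<in>H. \<forall>g\<in>H. \<forall>a b.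
         AE x in sphere_measure. T (\<lambda>z. a * f z + b * g z) x = a * T f x + b * T g x)
    \<and> (\<forall>f\<in>H. \<forall>g\<in>H. native_inner Z Y c (T f) g = native_inner Z Y c f (T g))
    \<and> (\<forall>f\<in>H. 0 \<le> native_inner Z Y c (T f) f)
    \<and> (\<forall>f\<in>H. AE x in sphere_measure. T (T (A f)) x = f x)
    \<and> (\<forall>f\<in>H. AE x in sphere_measure. A (T (T f)) x = f x))"

text \<open>The positive inverse square root is unique as an operator on the native space, that is, up to
  almost everywhere equality of its values; hence the choice.\<close>

definition inverse_sqrt ::
  "(nat \<Rightarrow> nat) \<Rightarrow> (nat \<Rightarrow> nat \<Rightarrow> 'a::euclidean_space \<Rightarrow> real) \<Rightarrow> (nat \<Rightarrow> real) \<Rightarrow>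
    (('a \<Rightarrow> real) \<Rightarrow> 'a \<Rightarrow> real) \<Rightarrow> ('a \<Rightarrow> real) \<Rightarrow> 'a \<Rightarrow> real" where
  "inverse_sqrt Z Y c A = (SOME T. is_inverse_sqrt Z Y c A T)"

definition weighted_adjoint ::
  "(real \<Rightarrow> real) \<Rightarrow> nat \<Rightarrow> (nat \<Rightarrow> 'a::euclidean_space) \<Rightarrow> (nat \<Rightarrow> real) \<Rightarrow> (nat \<Rightarrow> real) \<Rightarrow> 'a \<Rightarrow> real" where
  "weighted_adjoint \<phi> n x w y = (\<lambda>x'. \<Sum>i=1..n. w i * y i * \<phi> (x i \<bullet> x'))"

text \<open>The domain of the next operator is the native space of the coefficients \<open>b\<close>.\<close>

definition weighted_sampling_op ::
  "(nat \<Rightarrow> nat) \<Rightarrow> (nat \<Rightarrow> nat \<Rightarrow> 'a::euclidean_space \<Rightarrow> real) \<Rightarrow> (nat \<Rightarrow> real) \<Rightarrow> (real \<Rightarrow> real) \<Rightarrow>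
    nat \<Rightarrow> (nat \<Rightarrow> 'a) \<Rightarrow> (nat \<Rightarrow> real) \<Rightarrow> ('a \<Rightarrow> real) \<Rightarrow> 'a \<Rightarrow> real" where
  "weighted_sampling_op Z Y b \<phi> n x w =
     (\<lambda>f\<in>native_space Z Y b. \<lambda>x'. \<Sum>i=1..n. w i * f (x i) * \<phi> (x i \<bullet> x'))"

text \<open>\<open>c\<close> and \<open>b\<close> are the coefficient sequences of \<open>\<phi>\<close> and \<open>\<psi>\<close>.\<close>

definition sampling_error ::
  "(nat \<Rightarrow> nat) \<Rightarrow> (nat \<Rightarrow> nat \<Rightarrow> 'a::euclidean_space \<Rightarrow> real) \<Rightarrow> (nat \<Rightarrow> real) \<Rightarrow> (nat \<Rightarrow> real) \<Rightarrow>
    (real \<Rightarrow> real) \<Rightarrow> real \<Rightarrow> nat \<Rightarrow> (nat \<Rightarrow> 'a) \<Rightarrow> (nat \<Rightarrow> real) \<Rightarrow> (nat \<Rightarrow> real) \<Rightarrow> ('a \<Rightarrow> real) \<Rightarrow> real" where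
  "sampling_error Z Y c b \<phi> lam n x w y f =
     native_norm Z Y c
       (inverse_sqrt Z Y c (\<lambda>g z. kernel_op \<phi> g z + lam * g z)
         (\<lambda>z. weighted_adjoint \<phi> n x w y z - weighted_sampling_op Z Y b \<phi> n x w f z))"

text \<open>Expectations of exponentials are taken in \<open>[0,\<infinity>]\<close>, so that the bounds include finiteness.\<close>

definition sub_gaussian :: "'w measure \<Rightarrow> ('w \<Rightarrow> real) \<Rightarrow> bool" where
  "sub_gaussian P X \<longleftrightarrow> integrable P X \<and> (LINT \<omega>|P. X \<omega>) = 0
    \<and> (\<exists>K\<ge>0. \<forall>u. (\<integral>\<^sup>+ \<omega>. ennreal (exp (u * X \<omega>)) \<partial>P) \<le> ennreal (exp (K * u\<^sup>2)))"

definition sub_gaussian_norm :: "'w measure \<Rightarrow> ('w \<Rightarrow> real) \<Rightarrow> real" where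
  "sub_gaussian_norm P X = Inf {t. 0 < t \<and> (\<integral>\<^sup>+ \<omega>. ennreal (exp ((X \<omega>)\<^sup>2 / t\<^sup>2)) \<partial>P) \<le> 2}"

end

theory Submission
  imports Defs "HOL-Library.Function_Algebras"
begin

text \<open>
  The error is linear in the noise. Since \<open>\<beta> \<le> \<alpha>\<close>, the function \<open>f\<close> lies in the domain of the sampling
  operator, so that the values \<open>f (x i)\<close> cancel and the argument of \<open>(L + lam I)\<^bsup>-1/2\<^esup>\<close> is
  \<open>\<Sum>i. w i * \<epsilon> i * \<phi>\<^bsub>x i\<^esub>\<close>. The operator multiplies the harmonics of degree \<open>k\<close> by \<open>(c k + lam)\<^bsup>-1/2\<^esup>\<close>,
  hence the square of the error is
  \<open>q = \<Sum>k. c k / (c k + lam) * (\<Sum>l. (\<Sum>i. w i * \<epsilon> i * Y k l (x i))\<^sup>2)\<close>,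
  a positive semidefinite quadratic form in the independent variables \<open>\<epsilon> i\<close>
  (\<open>native_norm_kernel_combination\<close>). Two facts about this form give the bound.

  The trace. By the addition theorem \<open>\<Sum>l. (Y k l x)\<^sup>2 = Z k\<close> at every point of the sphere, so the trace
  is \<open>(\<Sum>i. (w i)\<^sup>2) * (\<Sum>k. c k / (c k + lam) * Z k)\<close>. The second factor, the effective dimension, is of order
  \<open>lam\<^bsup>-d/(2\<gamma>)\<^esup>\<close>, because at most \<open>2 * (n + 1)\<^bsup>d\<^esup>\<close> harmonics have degree up to \<open>n\<close>
  (\<open>sum_harmonic_dimensions_le\<close>, \<open>effective_dimension_bound\<close>). The addition theorem follows from the
  rotation invariance of the surface measure and of the Laplacian. The dimension count uses that the harmonics
  of all degrees up to \<open>n\<close> are linearly independent, since different degrees are orthogonal, and that on the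
  sphere one coordinate needs exponents \<open>0\<close> and \<open>1\<close> only. Orthogonality holds because the sum of the squared
  infinitesimal rotations is a symmetric operator for which each degree is an eigenspace with its own eigenvalue.

  The concentration. A positive semidefinite form \<open>q\<close> with trace at most \<open>V\<close> in independent sub-Gaussian
  variables of norm \<open>M\<close> satisfies \<open>E exp (q / (10 * M\<^sup>2 * V)) \<le> exp (1 / 2)\<close>, which is shown by integrating out
  one variable after the other (\<open>nn_integral_exp_quad_form_PiM\<close>). By Markov's inequality
  \<open>q \<le> 10 * M\<^sup>2 * V * ln (6 / \<delta>)\<close> with probability at least \<open>1 - \<delta>\<close>, and the logarithm is at least its square root.
\<close>

section \<open>Orthogonal invariance of the surface measure\<close>

text \<open>Integrating \<open>indicator B x * indicator A (x + y)\<close>, with \<open>B\<close> the unit ball, over \<open>M\<close> and Lebesgue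
  measure in either order gives \<open>M B * lborel A\<close> and \<open>lborel B * M A\<close>; the common value of the two measures
  on \<open>B\<close> is positive and finite and cancels.\<close>

lemma translation_invariant_measure_eq_lborel:
  fixes M :: "'a::euclidean_space measure"
  assumes sets_M[measurable_cong]: "sets M = sets borel"
    and "sigma_finite_measure M"
    and trans: "\<And>a. distr M borel (\<lambda>x. a + x) = M"
    and ball: "emeasure M (ball 0 1) = emeasure lborel (ball (0::'a) 1)"
  shows "M = lborel"
proof (rule measure_eqI)
  show "sets M = sets lborel" by (simp add: sets_M)
next
  fix A assume "A \<in> sets M"
  then have A[measurable]: "A \<in> sets borel" by (simp add: sets_M)
  interpret M: sigma_finite_measure M by fact
  interpret pair_sigma_finite lborel M
    by unfold_locales
  let ?B = "ball 0 1 :: 'a set"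
  have pair_indicator: "(\<lambda>z. indicator E (g z) :: ennreal) \<in> borel_measurable (lborel \<Otimes>\<^sub>M M)"
    if "g \<in> borel_measurable (lborel \<Otimes>\<^sub>M M)" "E \<in> sets borel" for E and g :: "'a \<times> 'a \<Rightarrow> 'a"
    using measurable_compose[OF that(1) borel_measurable_indicator[OF that(2)]] .
  have shift: "(\<integral>\<^sup>+x. h x \<partial>N) = (\<integral>\<^sup>+x. h (a + x) \<partial>N)"
    if "distr N borel (\<lambda>x. a + x) = N" "h \<in> borel_measurable borel" "sets N = sets borel"
    for h and a :: 'a and N
  proof -
    have [measurable]: "(\<lambda>x. a + x) \<in> measurable N borel"
      by (subst measurable_cong_sets[OF that(3) refl]) simp
    show ?thesis
      by (subst that(1)[symmetric], subst nn_integral_distr) (use that in auto)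
  qed
  have lb: "distr lborel borel (\<lambda>x. a + x) = (lborel :: 'a measure)" for a
    by (rule lborel_distr_plus)
  have "(\<integral>\<^sup>+x. (\<integral>\<^sup>+y. indicator ?B x * indicator A (x + y) \<partial>lborel) \<partial>M)
      = (\<integral>\<^sup>+x. indicator ?B x * emeasure lborel A \<partial>M)"
  proof (rule nn_integral_cong)
    fix x
    have "(\<integral>\<^sup>+y. indicator A (x + y) \<partial>lborel) = emeasure lborel A"
      by (subst shift[symmetric]) (simp_all add: lb)
    then show "(\<integral>\<^sup>+y. indicator ?B x * indicator A (x + y) \<partial>lborel) = indicator ?B x * emeasure lborel A"
      by (subst nn_integral_cmult) auto
  qed
  also have "\<dots> = emeasure M ?B * emeasure lborel A"
  proof -
    have "?B \<in> sets M" by (simp add: sets_M)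
    moreover from this have "(indicator ?B :: 'a \<Rightarrow> ennreal) \<in> borel_measurable M" by (rule borel_measurable_indicator)
    ultimately show ?thesis by (simp add: nn_integral_multc)
  qed
  finally have 1: "(\<integral>\<^sup>+x. (\<integral>\<^sup>+y. indicator ?B x * indicator A (x + y) \<partial>lborel) \<partial>M) = emeasure M ?B * emeasure lborel A" .
  have "(\<integral>\<^sup>+x. (\<integral>\<^sup>+y. indicator ?B x * indicator A (x + y) \<partial>lborel) \<partial>M)
     = (\<integral>\<^sup>+y. (\<integral>\<^sup>+x. indicator ?B x * indicator A (x + y) \<partial>M) \<partial>lborel)"
    by (rule Fubini'[where f="\<lambda>y x. indicator ?B x * indicator A (x + y)"])
       (auto simp: split_beta' intro!: borel_measurable_times_ennreal pair_indicator)
  also have "\<dots> = (\<integral>\<^sup>+y. (\<integral>\<^sup>+x. indicator ?B (- y + x) * indicator A x \<partial>M) \<partial>lborel)"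
  proof (rule nn_integral_cong)
    fix y
    have "(\<lambda>x. indicator ?B x * indicator A (x + y) :: ennreal) \<in> borel_measurable borel"
      by (intro borel_measurable_times_ennreal borel_measurable_indicator
          measurable_compose[OF _ borel_measurable_indicator[OF A]]) auto
    from shift[OF trans this sets_M, of "- y"]
    show "(\<integral>\<^sup>+x. indicator ?B x * indicator A (x + y) \<partial>M) = (\<integral>\<^sup>+x. indicator ?B (- y + x) * indicator A x \<partial>M)"
      by simp
  qed
  also have "\<dots> = (\<integral>\<^sup>+x. (\<integral>\<^sup>+y. indicator ?B (- y + x) * indicator A x \<partial>lborel) \<partial>M)"
    by (rule Fubini'[where f="\<lambda>y x. indicator ?B (- y + x) * indicator A x", symmetric])
       (auto simp: split_beta' intro!: borel_measurable_times_ennreal pair_indicator)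
  also have "\<dots> = (\<integral>\<^sup>+x. emeasure lborel ?B * indicator A x \<partial>M)"
  proof (rule nn_integral_cong)
    fix x
    have "(\<integral>\<^sup>+y. indicator ?B (- y + x) \<partial>lborel) = (\<integral>\<^sup>+y. indicator ?B (- x + y) \<partial>lborel)"
      by (rule nn_integral_cong) (simp add: indicator_def dist_norm norm_minus_commute)
    also have "\<dots> = emeasure lborel ?B"
      by (subst shift[symmetric])
         (simp_all add: lb borel_measurable_indicator[OF borel_open[OF open_ball]])
    finally show "(\<integral>\<^sup>+y. indicator ?B (- y + x) * indicator A x \<partial>lborel) = emeasure lborel ?B * indicator A x"
      by (subst nn_integral_multc)
         (auto intro!: measurable_compose[OF _ borel_measurable_indicator[OF borel_open[OF open_ball]]])
  qed
  also have "\<dots> = emeasure lborel ?B * emeasure M A"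
    by (subst nn_integral_cmult) (auto simp: sets_M)
  finally have 2: "emeasure lborel ?B * emeasure lborel A = emeasure lborel ?B * emeasure M A"
    using 1 ball by simp
  have "emeasure lborel ?B \<noteq> 0" 
    using open_not_negligible[of ?B] by (auto simp: negligible_iff_null_sets null_sets_def)
  moreover have "emeasure lborel ?B \<noteq> \<infinity>" using emeasure_lborel_ball_finite[of "0::'a" 1] by simp
  ultimately show "emeasure M A = emeasure lborel A"
    using 2 by (auto simp: ennreal_mult_cancel_left)
qed

lemma orthogonal_transformation_measurable:
  fixes T :: "'a::euclidean_space \<Rightarrow> 'a"
  assumes "orthogonal_transformation T"
  shows "T \<in> borel_measurable borel"
  using assms by (auto simp: orthogonal_transformation_def intro!: borel_measurable_continuous_onI linear_continuous_on linear_conv_bounded_linear[THEN iffD1])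

text \<open>A linear bijection maps translations to translations, so the image of Lebesgue measure is again
  translation invariant; being an isometry, \<open>T\<close> also preserves the unit ball.\<close>

lemma lborel_distr_orthogonal_transformation:
  fixes T :: "'a::euclidean_space \<Rightarrow> 'a"
  assumes T: "orthogonal_transformation T"
  shows "distr lborel borel T = lborel"
proof (rule translation_invariant_measure_eq_lborel)
  have [measurable]: "T \<in> borel_measurable borel"
    using orthogonal_transformation_measurable[OF T] .
  have balls: "emeasure (distr lborel borel T) (ball 0 r) = emeasure lborel (ball (0::'a) r)" for r
  proof -
    have "T -` ball 0 r = ball 0 r"
      by (auto simp: orthogonal_transformation_norm[OF T])
    then show ?thesis by (subst emeasure_distr) auto
  qed
  show "sets (distr lborel borel T) = sets borel" by simp
  show "emeasure (distr lborel borel T) (ball 0 1) = emeasure lborel (ball (0::'a) 1)" by (rule balls)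
  show "sigma_finite_measure (distr lborel borel T)"
  proof
    show "\<exists>A. countable A \<and> A \<subseteq> sets (distr lborel borel T) \<and> \<Union>A = space (distr lborel borel T)
        \<and> (\<forall>a\<in>A. emeasure (distr lborel borel T) a \<noteq> \<infinity>)"
    proof (intro exI[of _ "range (\<lambda>n. ball 0 (real n))"] conjI ballI)
      show "\<Union>(range (\<lambda>n. ball (0::'a) (real n))) = space (distr lborel borel T)"
        using reals_Archimedean2 by auto
    qed (use balls emeasure_lborel_ball_finite[where 'a='a] in \<open>auto simp: less_top[symmetric]\<close>)
  qed
  fix a
  obtain b where b: "T b = a" using orthogonal_transformation_surj[OF T] by (metis surjD)
  have "distr (distr lborel borel T) borel (\<lambda>x. a + x) = distr lborel borel (\<lambda>x. T (b + x))"
    using T by (subst distr_distr) (auto simp: comp_def b linear_add[OF orthogonal_transformation_linear[OF T]])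
  also have "\<dots> = distr (distr lborel borel (\<lambda>x. b + x)) borel T"
    by (subst distr_distr) (auto simp: comp_def)
  finally show "distr (distr lborel borel T) borel (\<lambda>x. a + x) = distr lborel borel T"
    by (simp add: lborel_distr_plus)
qed

lemma space_sphere_measure [simp]: "space sphere_measure = sphere 0 1"
  by (simp add: sphere_measure_def space_restrict_space)

lemma sets_sphere_measure: "sets sphere_measure = sets (restrict_space borel (sphere 0 1))"
  unfolding sphere_measure_def by (intro sets_restrict_space_cong) simp

lemma borel_measurable_sphere_measureI:
  "f \<in> borel_measurable borel \<Longrightarrow> f \<in> borel_measurable sphere_measure"
  by (subst measurable_cong_sets[OF sets_sphere_measure refl]) (rule measurable_restrict_space1)

lemma emeasure_sphere_measure:
  fixes E :: "'a::euclidean_space set"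
  assumes "E \<in> sets borel" "E \<subseteq> sphere 0 1"
  shows "emeasure sphere_measure E = emeasure lborel (ball 0 1 \<inter> sgn -` E) / emeasure lborel (ball 0 1 :: 'a set)"
proof -
  have [measurable]: "(sgn :: 'a \<Rightarrow> 'a) \<in> borel_measurable borel"
    by (simp add: sgn_div_norm[abs_def])
  have sg: "sgn -` E \<in> sets lborel" using measurable_sets[of sgn borel borel E] assms by simp
  have "emeasure sphere_measure E = emeasure (distr (uniform_measure lborel (ball 0 1)) borel sgn) E"
    unfolding sphere_measure_def using assms by (intro emeasure_restrict_space) auto
  also have "\<dots> = emeasure (uniform_measure lborel (ball 0 1)) (sgn -` E)"
    using assms by (subst emeasure_distr) auto
  also have "\<dots> = emeasure lborel (ball 0 1 \<inter> sgn -` E) / emeasure lborel (ball 0 1 :: 'a set)"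
    using sg by (intro emeasure_uniform_measure) auto
  finally show ?thesis .
qed

lemma prob_space_sphere_measure: "prob_space (sphere_measure :: 'a::euclidean_space measure)"
proof
  have "emeasure sphere_measure (sphere (0::'a) 1)
      = emeasure lborel (ball 0 1 \<inter> sgn -` sphere (0::'a) 1) / emeasure lborel (ball 0 1 :: 'a set)"
    by (rule emeasure_sphere_measure) auto
  also have "ball 0 1 \<inter> sgn -` sphere (0::'a) 1 = ball 0 1 - {0}"
    by (auto simp: norm_sgn)
  also have "emeasure lborel (ball 0 1 - {0::'a}) = emeasure lborel (ball (0::'a) 1)"
    by (rule emeasure_Diff_null_set) (auto intro: finite_imp_null_set_lborel)
  also have "\<dots> / \<dots> = 1"
  proof (rule ennreal_divide_self)
    show "emeasure lborel (ball (0::'a) 1) \<noteq> 0"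
      using open_not_negligible[of "ball (0::'a) 1"] by (auto simp: negligible_iff_null_sets null_sets_def)
    show "emeasure lborel (ball (0::'a) 1) < \<top>" 
      using emeasure_lborel_ball_finite[of "0::'a" 1] by simp
  qed
  finally show "emeasure sphere_measure (space (sphere_measure :: 'a measure)) = 1" by simp
qed

text \<open>The radial projection \<open>sgn\<close> commutes with \<open>T\<close>, so the invariance is inherited from the ball.\<close>

lemma sphere_measure_orthogonal_invariant:
  fixes T :: "'a::euclidean_space \<Rightarrow> 'a"
  assumes T: "orthogonal_transformation T"
  shows "T \<in> measurable sphere_measure sphere_measure" "distr sphere_measure sphere_measure T = sphere_measure"
proof -
  have Tm[measurable]: "T \<in> borel_measurable borel"
    using orthogonal_transformation_measurable[OF T] .
  have [measurable]: "(sgn :: 'a \<Rightarrow> 'a) \<in> borel_measurable borel"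
    by (simp add: sgn_div_norm[abs_def])
  note nT = orthogonal_transformation_norm[OF T] 
  show m: "T \<in> measurable sphere_measure sphere_measure"
    unfolding measurable_cong_sets[OF sets_sphere_measure sets_sphere_measure]
    by (rule measurable_restrict_space3) (auto simp: nT)
  show "distr sphere_measure sphere_measure T = sphere_measure"
  proof (rule measure_eqI)
    fix E assume "E \<in> sets (distr (sphere_measure :: 'a measure) sphere_measure T)"
    then have E: "E \<in> sets sphere_measure" "E \<in> sets borel" "E \<subseteq> sphere 0 1"
      by (auto simp: sets_sphere_measure sets_restrict_space)
    let ?F = "T -` E \<inter> sphere 0 1"
    have F: "?F \<in> sets borel" using E measurable_sets[OF Tm, of E] by auto
    have G: "ball 0 1 \<inter> sgn -` E \<in> sets borel"
      using E measurable_sets[of sgn borel borel E] by auto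
    have sg: "sgn (T x) = T (sgn x)" for x
      by (simp add: sgn_div_norm nT orthogonal_transformation_scaleR[OF T])
    have "emeasure (distr sphere_measure sphere_measure T) E = emeasure sphere_measure ?F"
      using E m by (subst emeasure_distr) auto
    also have "\<dots> = emeasure lborel (ball 0 1 \<inter> sgn -` ?F) / emeasure lborel (ball 0 1 :: 'a set)"
      using F by (intro emeasure_sphere_measure) auto
    also have "ball 0 1 \<inter> sgn -` ?F = T -` (ball 0 1 \<inter> sgn -` E)"
      using E(3) by (auto simp: nT sg subset_iff)
    also have "emeasure lborel \<dots> = emeasure (distr lborel borel T) (ball 0 1 \<inter> sgn -` E)"
      using G by (subst emeasure_distr) auto
    also have "\<dots> = emeasure lborel (ball 0 1 \<inter> sgn -` E)"
      by (simp add: lborel_distr_orthogonal_transformation[OF T])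
    also have "\<dots> / emeasure lborel (ball 0 1 :: 'a set) = emeasure sphere_measure E"
      using E by (intro emeasure_sphere_measure[symmetric])
    finally show "emeasure (distr sphere_measure sphere_measure T) E = emeasure sphere_measure E" .
  qed simp
qed

lemma integral_sphere_measure_orthogonal:
  fixes T :: "'a::euclidean_space \<Rightarrow> 'a" and f :: "'a \<Rightarrow> real"
  assumes T: "orthogonal_transformation T" and "f \<in> borel_measurable sphere_measure"
  shows "(LINT x|sphere_measure. f (T x)) = (LINT x|sphere_measure. f x)"
  using integral_distr[OF sphere_measure_orthogonal_invariant(1)[OF T] assms(2)]
  by (simp add: sphere_measure_orthogonal_invariant(2)[OF T])

lemma integrable_sphere_measure_continuous:
  fixes f :: "'a::euclidean_space \<Rightarrow> real"
  assumes "continuous_on UNIV f"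
  shows "integrable sphere_measure f"
proof -
  interpret prob_space "sphere_measure :: 'a measure" by (rule prob_space_sphere_measure)
  have "compact (f ` sphere 0 1)"
    by (intro compact_continuous_image continuous_on_subset[OF assms]) auto
  then obtain B where "\<forall>x\<in>sphere 0 1. norm (f x) \<le> B"
    using compact_imp_bounded bounded_iff by (metis imageI)
  then show ?thesis
    by (intro integrable_const_bound[of _ B] borel_measurable_sphere_measureI
        borel_measurable_continuous_onI assms) (auto intro!: AE_I2)
qed

section \<open>Orthogonality of spherical harmonics of different degrees\<close>

lemma real_polynomial_function_continuous_on:
  assumes "real_polynomial_function p"
  shows "continuous_on S p"
  using assms by (simp add: continuous_on_polymonial_function real_polynomial_function_eq)

text \<open>\<open>G x v\<close> and \<open>H x u v\<close> are the first and the second directional derivatives of \<open>p\<close> at \<open>x\<close>. That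
  \<open>G z v\<close> is a polynomial in \<open>z\<close> makes derivatives of \<open>p\<close> along linear vector fields polynomials again, to
  which the same statements apply.\<close>

definition twice_derivative ::
  "('a::euclidean_space \<Rightarrow> real) \<Rightarrow> ('a \<Rightarrow> 'a \<Rightarrow> real) \<Rightarrow> ('a \<Rightarrow> 'a \<Rightarrow> 'a \<Rightarrow> real) \<Rightarrow> bool" where
  "twice_derivative p G H \<longleftrightarrow>
     (\<forall>x. (p has_derivative G x) (at x))
   \<and> (\<forall>x v. ((\<lambda>z. G z v) has_derivative (\<lambda>u. H x u v)) (at x))
   \<and> (\<forall>x u. linear (H x u))
   \<and> (\<forall>x u v. H x u v = H x v u)
   \<and> (\<forall>v. real_polynomial_function (\<lambda>z. G z v))"

lemma real_polynomial_function_twice_derivative: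
  fixes p :: "'a::euclidean_space \<Rightarrow> real"
  assumes "real_polynomial_function p"
  shows "\<exists>G H. twice_derivative p G H"
  using assms
proof induction
  case (linear f)
  then have "twice_derivative f (\<lambda>x. f) (\<lambda>x u v. 0)"
    by (auto simp: twice_derivative_def bounded_linear_imp_has_derivative linear_zero)
  then show ?case by blast
next
  case (const c)
  have "twice_derivative (\<lambda>x::'a. c) (\<lambda>x v. 0) (\<lambda>x u v. 0)"
    by (auto simp: twice_derivative_def linear_zero)
  then show ?case by blast
next
  case (add f g)
  then obtain F F' G G' where *: "twice_derivative f F F'" "twice_derivative g G G'" by blast
  have "twice_derivative (\<lambda>x. f x + g x) (\<lambda>x v. F x v + G x v) (\<lambda>x u v. F' x u v + G' x u v)"
    using * by (auto simp: twice_derivative_def intro!: has_derivative_add linear_compose_add)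
  then show ?case by blast
next
  case (mult f g)
  then obtain F F' G G' where *: "twice_derivative f F F'" "twice_derivative g G G'" by blast
  have lin: "linear (F x)" "linear (G x)" "linear (F' x u)" "linear (G' x u)" for x u
    using * by (auto simp: twice_derivative_def intro: has_derivative_linear)
  have "twice_derivative (\<lambda>x. f x * g x) (\<lambda>x v. f x * G x v + F x v * g x)
      (\<lambda>x u v. (f x * G' x u v + F x u * G x v) + (F x v * G x u + F' x u v * g x))"
    using * mult.hyps unfolding twice_derivative_def
    apply (intro conjI allI)
    subgoal by (auto intro!: has_derivative_mult)
    subgoal by (auto intro!: has_derivative_add has_derivative_mult)
    subgoal by (intro linearI) (simp_all add: linear_add[OF lin(1)]
        linear_add[OF lin(2)] linear_add[OF lin(3)] linear_add[OF lin(4)] 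
        linear_scale[OF lin(1)] linear_scale[OF lin(2)] linear_scale[OF lin(3)] linear_scale[OF lin(4)]
        algebra_simps)
    subgoal by (simp add: ac_simps)
    subgoal by (intro real_polynomial_function.intros(3)[OF real_polynomial_function.intros(4)
          real_polynomial_function.intros(4)]) blast+
    done
  then show ?case by blast
qed

lemma twice_derivativeD:
  assumes "twice_derivative p G H"
  shows "(p has_derivative G x) (at x)" "((\<lambda>z. G z v) has_derivative (\<lambda>u. H x u v)) (at x)"
    "linear (G x)" "linear (H x u)" "linear (\<lambda>u. H x u v)" "H x u v = H x v u" "real_polynomial_function (\<lambda>z. G z v)"
  using assms by (auto simp: twice_derivative_def intro: has_derivative_linear)

lemma twice_derivative_line:
  assumes D: "twice_derivative p G H"
  shows "((\<lambda>t. p (x + t *\<^sub>R v)) has_real_derivative G (x + t *\<^sub>R v) v) (at t)"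
    and "((\<lambda>t. G (x + t *\<^sub>R v) w) has_real_derivative H (x + t *\<^sub>R v) v w) (at t)"
proof -
  have l: "((\<lambda>t. x + t *\<^sub>R v) has_derivative (\<lambda>s. s *\<^sub>R v)) (at t)"
    by (auto intro!: derivative_eq_intros)
  show "((\<lambda>t. p (x + t *\<^sub>R v)) has_real_derivative G (x + t *\<^sub>R v) v) (at t)"
    unfolding has_field_derivative_def
    by (rule has_derivative_eq_rhs[OF has_derivative_compose[OF l twice_derivativeD(1)[OF D]]])
       (simp add: fun_eq_iff linear_scale[OF twice_derivativeD(3)[OF D]])
  show "((\<lambda>t. G (x + t *\<^sub>R v) w) has_real_derivative H (x + t *\<^sub>R v) v w) (at t)"
    unfolding has_field_derivative_def
    by (rule has_derivative_eq_rhs[OF has_derivative_compose[OF l twice_derivativeD(2)[OF D]]])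
       (simp add: fun_eq_iff linear_scale[OF twice_derivativeD(5)[OF D]])
qed

lemma laplacian_eq_trace:
  assumes D: "twice_derivative p G H"
  shows "laplacian p x = (\<Sum>b\<in>Basis. H x b b)"
proof -
  have "(deriv ^^ 2) (\<lambda>t. p (x + t *\<^sub>R b)) 0 = H x b b" for b
  proof -
    have "deriv (\<lambda>t. p (x + t *\<^sub>R b)) = (\<lambda>t. G (x + t *\<^sub>R b) b)"
      by (intro ext DERIV_imp_deriv twice_derivative_line(1)[OF D])
    then have "(deriv ^^ 2) (\<lambda>t. p (x + t *\<^sub>R b)) 0 = deriv (\<lambda>t. G (x + t *\<^sub>R b) b) 0"
      by (simp add: numeral_2_eq_2)
    also have "\<dots> = H x b b"
      using DERIV_imp_deriv[OF twice_derivative_line(2)[OF D, of x b b 0]] by simp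
    finally show ?thesis .
  qed
  then show ?thesis by (simp add: laplacian_def)
qed

text \<open>Euler's identities: differentiate \<open>p (x + t *\<^sub>R x) = (1 + t) ^ k * p x\<close> once and twice at \<open>t = 0\<close>.\<close>

lemma euler_homogeneous:
  assumes D: "twice_derivative p G H" and hom: "\<And>t x. p (t *\<^sub>R x) = t ^ k * p x"
  shows "G x x = real k * p x" "H x x x = real k * (real k - 1) * p x"
proof -
  have e: "p (y + t *\<^sub>R y) = (1 + t) ^ k * p y" for y t
    using hom[of "1 + t" y] by (simp add: algebra_simps)
  have 1: "G x x = real k * p x" for x
  proof (rule DERIV_unique)
    show "((\<lambda>t. p (x + t *\<^sub>R x)) has_real_derivative G x x) (at 0)"
      using twice_derivative_line(1)[OF D, of x x 0] by simp
    show "((\<lambda>t. p (x + t *\<^sub>R x)) has_real_derivative real k * p x) (at 0)"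
      unfolding e by (auto intro!: derivative_eq_intros)
  qed
  show "G x x = real k * p x" by (rule 1)
  have 2: "G (x + t *\<^sub>R x) x = real k * (1 + t) ^ (k - 1) * p x" for t
  proof (rule DERIV_unique)
    show "((\<lambda>t. p (x + t *\<^sub>R x)) has_real_derivative G (x + t *\<^sub>R x) x) (at t)"
      using twice_derivative_line(1)[OF D, of x x t] by simp
    show "((\<lambda>t. p (x + t *\<^sub>R x)) has_real_derivative real k * (1 + t) ^ (k - 1) * p x) (at t)"
      unfolding e by (auto intro!: derivative_eq_intros)
  qed
  show "H x x x = real k * (real k - 1) * p x"
  proof (rule DERIV_unique)
    show "((\<lambda>t. G (x + t *\<^sub>R x) x) has_real_derivative H x x x) (at 0)"
      using twice_derivative_line(2)[OF D, of x x x 0] by simp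
    show "((\<lambda>t. G (x + t *\<^sub>R x) x) has_real_derivative real k * (real k - 1) * p x) (at 0)"
      unfolding 2 by (cases k) (auto intro!: derivative_eq_intros simp: of_nat_diff)
  qed
qed

text \<open>The generator of the rotations \<open>plane_rot\<close> of the plane spanned by two axes; it vanishes for \<open>b = c\<close>, so
  that sums over pairs of axes may run over all pairs.\<close>

definition plane_gen :: "'a::euclidean_space \<Rightarrow> 'a \<Rightarrow> 'a \<Rightarrow> 'a" where
  "plane_gen b c x = (x \<bullet> b) *\<^sub>R c - (x \<bullet> c) *\<^sub>R b"

definition plane_rot :: "'a::euclidean_space \<Rightarrow> 'a \<Rightarrow> real \<Rightarrow> 'a \<Rightarrow> 'a" where
  "plane_rot b c t x = x + (cos t - 1) *\<^sub>R ((x \<bullet> b) *\<^sub>R b + (x \<bullet> c) *\<^sub>R c) + sin t *\<^sub>R plane_gen b c x"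

lemma orthogonal_transformation_plane_rot:
  assumes "b \<in> Basis" "c \<in> Basis" "b \<noteq> c"
  shows "orthogonal_transformation (plane_rot b c t)"
proof -
  have bc: "b \<bullet> b = 1" "c \<bullet> c = 1" "b \<bullet> c = 0" "c \<bullet> b = 0"
    using assms by (auto simp: inner_Basis)
  have "plane_rot b c t v \<bullet> plane_rot b c t w = v \<bullet> w" for v w
  proof -
    define S C where "S = sin t" and "C = cos t"
    have "plane_rot b c t v \<bullet> plane_rot b c t w = v \<bullet> w +
       ((v \<bullet> b) * (w \<bullet> b) + (v \<bullet> c) * (w \<bullet> c)) * (S\<^sup>2 + C\<^sup>2 - 1)"
      unfolding plane_rot_def plane_gen_def S_def[symmetric] C_def[symmetric]
      by (simp add: inner_simps bc inner_commute[of b w] inner_commute[of c w] inner_commute[of b v] inner_commute[of c v])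
         (simp add: algebra_simps power2_eq_square)
    then show ?thesis by (simp add: S_def C_def)
  qed
  moreover have "linear (plane_rot b c t)"
    by (rule linearI) (simp_all add: plane_rot_def plane_gen_def algebra_simps inner_simps)
  ultimately show ?thesis by (simp add: orthogonal_transformation_def)
qed

lemma plane_rot_has_derivative:
  assumes "b \<in> Basis" "c \<in> Basis" "b \<noteq> c"
  shows "((\<lambda>t. plane_rot b c t x) has_derivative (\<lambda>s. s *\<^sub>R plane_gen b c (plane_rot b c t x))) (at t)"
proof -
  have bc: "b \<bullet> b = 1" "c \<bullet> c = 1" "b \<bullet> c = 0" "c \<bullet> b = 0"
    using assms by (auto simp: inner_Basis)
  show ?thesis unfolding plane_rot_def plane_gen_def
    by (auto intro!: derivative_eq_intros ext simp: inner_simps bc algebra_simps)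
qed

text \<open>With \<open>G\<close> the gradient of \<open>p\<close>, this is the derivative of \<open>p\<close> along the rotations of a coordinate plane.\<close>

definition rot_deriv :: "('a::euclidean_space \<Rightarrow> 'a \<Rightarrow> real) \<Rightarrow> 'a \<Rightarrow> 'a \<Rightarrow> 'a \<Rightarrow> real" where
  "rot_deriv G b c x = G x (plane_gen b c x)"

lemma rot_deriv_polynomial:
  assumes D: "twice_derivative p G H"
  shows "real_polynomial_function (rot_deriv G b c)"
proof -
  have "rot_deriv G b c = (\<lambda>x. (x \<bullet> b) * G x c - (x \<bullet> c) * G x b)"
    using twice_derivativeD(3)[OF D]
    by (auto simp: rot_deriv_def plane_gen_def linear_diff linear_scale)
  then show ?thesis
    by (simp only:) (intro real_polynomial_function_diff real_polynomial_function.intros(4)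
        real_polynomial_function.intros(1)[OF bounded_linear_inner_left] twice_derivativeD(7)[OF D])
qed

lemma rot_deriv_has_derivative:
  assumes D: "twice_derivative p G H"
  shows "(rot_deriv G b c has_derivative (\<lambda>u. H x u (plane_gen b c x) + G x (plane_gen b c u))) (at x)"
proof -
  have *: "rot_deriv G b c = (\<lambda>x. (x \<bullet> b) * G x c - (x \<bullet> c) * G x b)"
    using twice_derivativeD(3)[OF D]
    by (auto simp: rot_deriv_def plane_gen_def linear_diff linear_scale)
  show ?thesis
    unfolding *
    by (rule has_derivative_eq_rhs, (rule derivative_intros twice_derivativeD(2)[OF D])+)
       (auto simp: plane_gen_def fun_eq_iff linear_diff[OF twice_derivativeD(4)[OF D]]
        linear_scale[OF twice_derivativeD(4)[OF D]] linear_diff[OF twice_derivativeD(3)[OF D]]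
        linear_scale[OF twice_derivativeD(3)[OF D]] algebra_simps)
qed

text \<open>By rotation invariance the integral of \<open>p (plane_rot b c t x)\<close> does not depend on \<open>t\<close>. Its difference
  quotients at \<open>t = 0\<close> converge to the integral of the rotation derivative: rotations stay on the sphere, so the
  mean value theorem bounds the quotients by the maximum of this derivative on the sphere.\<close>

lemma integral_rot_deriv_eq_0:
  fixes p :: "'a::euclidean_space \<Rightarrow> real"
  assumes p: "real_polynomial_function p" and D: "twice_derivative p G H"
    and bc: "b \<in> Basis" "c \<in> Basis"
  shows "(LINT x|sphere_measure. rot_deriv G b c x) = 0"
proof (cases "b = c")
  case True
  then show ?thesis 
    by (simp add: rot_deriv_def plane_gen_def linear_0[OF twice_derivativeD(3)[OF D]])
next
  case False
  interpret prob_space "sphere_measure :: 'a measure" by (rule prob_space_sphere_measure)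
  let ?R = "plane_rot b c" and ?L = "rot_deriv G b c"
  note R = orthogonal_transformation_plane_rot[OF bc False]
  note pc = real_polynomial_function_continuous_on
  have Lc: "continuous_on UNIV ?L" by (rule pc[OF rot_deriv_polynomial[OF D]])
  have "compact (?L ` sphere 0 1)"
    by (intro compact_continuous_image continuous_on_subset[OF Lc]) auto
  then obtain B where B: "\<And>x. x\<in>sphere 0 1 \<Longrightarrow> norm (?L x) \<le> B"
    using compact_imp_bounded bounded_iff by (metis imageI)
  have der: "((\<lambda>t. p (?R t x)) has_real_derivative ?L (?R t x)) (at t)" for x t
    unfolding has_field_derivative_def
    by (rule has_derivative_eq_rhs[OF has_derivative_compose[OF plane_rot_has_derivative[OF bc False]
          twice_derivativeD(1)[OF D]]])
       (simp add: fun_eq_iff linear_scale[OF twice_derivativeD(3)[OF D]] rot_deriv_def)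
  have R0: "?R 0 x = x" for x by (simp add: plane_rot_def)
  define h where "h = (\<lambda>n::nat. 1 / real (Suc n))"
  have h: "h \<longlonglongrightarrow> 0" "\<And>n. h n > 0" unfolding h_def by (rule LIMSEQ_Suc[OF lim_1_over_n]) auto
  have pint: "integrable sphere_measure p" "integrable sphere_measure (\<lambda>x. p (?R t x))" for t
  proof -
    show "integrable sphere_measure p" by (intro integrable_sphere_measure_continuous pc p)
    have "continuous_on UNIV (?R t)"
      using R[of t] by (auto simp: orthogonal_transformation_def intro!: linear_continuous_on linear_conv_bounded_linear[THEN iffD1])
    then show "integrable sphere_measure (\<lambda>x. p (?R t x))"
      by (intro integrable_sphere_measure_continuous continuous_on_compose2[OF pc[OF p, of UNIV]]) auto
  qed
  \<comment> \<open>The integrals on the left vanish by invariance.\<close>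
  have "(\<lambda>n. LINT x|sphere_measure. (p (?R (h n) x) - p x) / h n) \<longlonglongrightarrow> (LINT x|sphere_measure. ?L x)"
  proof (rule integral_dominated_convergence[where w="\<lambda>_. B"])
    show "?L \<in> borel_measurable sphere_measure"
      by (intro borel_measurable_sphere_measureI borel_measurable_continuous_onI Lc)
    show "(\<lambda>x. (p (?R (h n) x) - p x) / h n) \<in> borel_measurable sphere_measure" for n
      using pint by (intro borel_measurable_divide borel_measurable_diff) auto
    show "AE x in sphere_measure. (\<lambda>n. (p (?R (h n) x) - p x) / h n) \<longlonglongrightarrow> ?L x"
    proof (rule AE_I2)
      fix x
      have "((\<lambda>t. (p (?R t x) - p (?R 0 x)) / (t - 0)) \<longlongrightarrow> ?L x) (at 0)"
        using der[of x 0] by (simp add: has_field_derivative_iff R0)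
      moreover have "filterlim h (at 0) sequentially"
        using h by (auto simp: filterlim_at less_imp_neq[symmetric] intro!: always_eventually)
      ultimately show "(\<lambda>n. (p (?R (h n) x) - p x) / h n) \<longlonglongrightarrow> ?L x"
        using filterlim_compose by (fastforce simp: R0)
    qed
    show "AE x in sphere_measure. norm ((p (?R (h n) x) - p x) / h n) \<le> B" for n
    proof (rule AE_I2)
      fix x :: 'a assume x: "x \<in> space sphere_measure"
      obtain z where "z > 0" "z < h n" "p (?R (h n) x) - p (?R 0 x) = (h n - 0) * ?L (?R z x)"
        using MVT2[OF h(2)[of n], of "\<lambda>t. p (?R t x)" "\<lambda>t. ?L (?R t x)"] der by blast
      moreover have "?R z x \<in> sphere 0 1"
        using x orthogonal_transformation_norm[OF R] by simp
      ultimately show "norm ((p (?R (h n) x) - p x) / h n) \<le> B"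
        using B[of "?R z x"] h(2)[of n] by (simp add: R0)
    qed
  qed simp
  moreover have "(LINT x|sphere_measure. (p (?R (h n) x) - p x) / h n) = 0" for n
    using integral_sphere_measure_orthogonal[OF R, of p "h n"] pint
    by (simp add: Bochner_Integration.integral_diff)
  ultimately show ?thesis by (simp only: LIMSEQ_const_iff)
qed

text \<open>The rotation derivative of \<open>rot_deriv G b c\<close>, in terms of the derivatives \<open>G\<close> and \<open>H\<close> of \<open>p\<close>.\<close>

definition rot_deriv2 ::
  "('a::euclidean_space \<Rightarrow> 'a \<Rightarrow> real) \<Rightarrow> ('a \<Rightarrow> 'a \<Rightarrow> 'a \<Rightarrow> real) \<Rightarrow> 'a \<Rightarrow> 'a \<Rightarrow> 'a \<Rightarrow> real" where
  "rot_deriv2 G H b c x = H x (plane_gen b c x) (plane_gen b c x) + G x (plane_gen b c (plane_gen b c x))"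

text \<open>Summed over all ordered pairs of axes, the second rotation derivatives form twice the Laplace-Beltrami
  operator. Written out at \<open>x\<close>, with \<open>D\<close> the dimension, the sum is
  \<open>2 * (x \<bullet> x) * laplacian p x - 2 * H x x x - 2 * (D - 1) * G x x\<close>; for a homogeneous harmonic polynomial the first
  term vanishes and Euler's identities evaluate the others.\<close>

lemma sum_rot_deriv_twice:
  fixes p :: "'a::euclidean_space \<Rightarrow> real"
  assumes D: "twice_derivative p G H"
    and hom: "\<And>t x. p (t *\<^sub>R x) = t ^ k * p x" and harm: "laplacian p x = 0"
  shows "(\<Sum>b\<in>Basis. \<Sum>c\<in>Basis. rot_deriv2 G H b c x)
     = - 2 * real k * (real k + real DIM('a) - 2) * p x"
proof -
  note lin = linear_diff[OF twice_derivativeD(4)[OF D]] linear_scale[OF twice_derivativeD(4)[OF D]]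
    linear_diff[OF twice_derivativeD(5)[OF D]] linear_scale[OF twice_derivativeD(5)[OF D]]
    linear_diff[OF twice_derivativeD(3)[OF D]] linear_scale[OF twice_derivativeD(3)[OF D]]
  let ?x = "\<lambda>b. x \<bullet> b"
  have ex: "(\<Sum>b\<in>Basis. ?x b *\<^sub>R b) = x" by (rule euclidean_representation)
  have H1: "(\<Sum>b\<in>Basis. \<Sum>c\<in>Basis. ?x b * ?x c * H x b c) = H x x x"
  proof -
    have "H x x x = H x (\<Sum>b\<in>Basis. ?x b *\<^sub>R b) (\<Sum>c\<in>Basis. ?x c *\<^sub>R c)" by (simp add: ex)
    also have "\<dots> = (\<Sum>b\<in>Basis. \<Sum>c\<in>Basis. ?x b * ?x c * H x b c)"
      unfolding linear_sum[OF twice_derivativeD(5)[OF D]] linear_sum[OF twice_derivativeD(4)[OF D]] lin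
      by (simp add: sum_distrib_left mult_ac twice_derivativeD(6)[OF D, of x])
    finally show ?thesis by simp
  qed
  have G1: "(\<Sum>b\<in>Basis. ?x b * G x b) = G x x"
  proof -
    have "G x x = G x (\<Sum>b\<in>Basis. ?x b *\<^sub>R b)" by (simp add: ex)
    also have "\<dots> = (\<Sum>b\<in>Basis. ?x b * G x b)"
      by (simp add: linear_sum[OF twice_derivativeD(3)[OF D]] lin)
    finally show ?thesis by simp
  qed
  have tr: "(\<Sum>b\<in>Basis. H x b b) = 0" using laplacian_eq_trace[OF D] harm by simp
  have nx: "(\<Sum>b\<in>Basis. (?x b)\<^sup>2) = x \<bullet> x" 
    by (simp add: euclidean_inner[of x x] power2_eq_square)
  have Hbc: "H x (plane_gen b c x) (plane_gen b c x)
      = (?x b)\<^sup>2 * H x c c - 2 * (?x b * ?x c * H x b c) + (?x c)\<^sup>2 * H x b b" for b c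
    using twice_derivativeD(6)[OF D, of x b c]
    by (simp add: plane_gen_def lin power2_eq_square algebra_simps)
  have "(\<Sum>b\<in>Basis. \<Sum>c\<in>Basis. H x (plane_gen b c x) (plane_gen b c x))
     = (\<Sum>b\<in>Basis. (?x b)\<^sup>2) * (\<Sum>c\<in>Basis. H x c c) - 2 * H x x x + (\<Sum>c\<in>Basis. (?x c)\<^sup>2) * (\<Sum>b\<in>Basis. H x b b)"
  proof -
    have "(\<Sum>b\<in>Basis. \<Sum>c\<in>Basis. (?x b)\<^sup>2 * H x c c) = (\<Sum>b\<in>Basis. (?x b)\<^sup>2) * (\<Sum>c\<in>Basis. H x c c)"
      by (rule sum_product[symmetric])
    moreover have "(\<Sum>b\<in>Basis. \<Sum>c\<in>Basis. (?x c)\<^sup>2 * H x b b) = (\<Sum>c\<in>Basis. (?x c)\<^sup>2) * (\<Sum>b\<in>Basis. H x b b)"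
      by (subst sum.swap) (rule sum_product[symmetric])
    moreover have "(\<Sum>b\<in>Basis. \<Sum>c\<in>Basis. 2 * (?x b * ?x c * H x b c)) = 2 * H x x x"
      unfolding H1[symmetric] by (simp only: sum_distrib_left)
    ultimately show ?thesis
      unfolding Hbc sum.distrib sum_subtractf by simp
  qed
  then have HH: "(\<Sum>b\<in>Basis. \<Sum>c\<in>Basis. H x (plane_gen b c x) (plane_gen b c x)) = - 2 * (real k * (real k - 1) * p x)"
    using euler_homogeneous(2)[OF D hom] by (simp add: tr)
  have Gbc: "G x (plane_gen b c (plane_gen b c x)) = (if b = c then 2 * (?x b * G x b) else 0) - ?x b * G x b - ?x c * G x c"
    if "b \<in> Basis" "c \<in> Basis" for b c
    using that by (auto simp: plane_gen_def lin linear_add[OF twice_derivativeD(3)[OF D]]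
        linear_0[OF twice_derivativeD(3)[OF D]] inner_simps inner_Basis algebra_simps)
  have "(\<Sum>b\<in>Basis. \<Sum>c\<in>Basis. G x (plane_gen b c (plane_gen b c x)))
     = (\<Sum>b\<in>Basis. \<Sum>c\<in>Basis. (if b = c then 2 * (?x b * G x b) else 0) - ?x b * G x b - ?x c * G x c)"
    by (intro sum.cong refl) (simp add: Gbc)
  also have "\<dots> = 2 * (\<Sum>b\<in>Basis. ?x b * G x b) - 2 * real DIM('a) * (\<Sum>b\<in>Basis. ?x b * G x b)"
    by (simp add: sum_subtractf sum.delta flip: sum_distrib_left)
  finally have GG: "(\<Sum>b\<in>Basis. \<Sum>c\<in>Basis. G x (plane_gen b c (plane_gen b c x))) = 2 * (1 - real DIM('a)) * (real k * p x)"
    using G1 euler_homogeneous(1)[OF D hom] by (simp add: algebra_simps)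
  show ?thesis
    by (simp add: rot_deriv2_def sum.distrib HH GG) (simp add: algebra_simps)
qed

text \<open>The rotation derivative obeys the product rule, and the derivative of \<open>p * q\<close> has integral zero.\<close>

lemma integral_rot_deriv_by_parts:
  fixes p q :: "'a::euclidean_space \<Rightarrow> real"
  assumes p: "real_polynomial_function p" and q: "real_polynomial_function q"
    and DP: "twice_derivative p G H" and DQ: "twice_derivative q G' H'"
    and bc: "b \<in> Basis" "c \<in> Basis"
  shows "(LINT x|sphere_measure. rot_deriv G b c x * q x) = - (LINT x|sphere_measure. p x * rot_deriv G' b c x)"
proof -
  have pq: "real_polynomial_function (\<lambda>x. p x * q x)" using p q by (rule real_polynomial_function.intros(4))
  obtain K K' where K: "twice_derivative (\<lambda>x. p x * q x) K K'"
    using real_polynomial_function_twice_derivative[OF pq] by blast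
  have "K x = (\<lambda>v. p x * G' x v + G x v * q x)" for x
    by (rule has_derivative_unique[OF twice_derivativeD(1)[OF K] has_derivative_mult[OF twice_derivativeD(1)[OF DP] twice_derivativeD(1)[OF DQ]]])
  then have e: "rot_deriv K b c x = rot_deriv G b c x * q x + p x * rot_deriv G' b c x" for x
    by (simp add: rot_deriv_def)
  have "integrable sphere_measure (\<lambda>x. rot_deriv G b c x * q x)" "integrable sphere_measure (\<lambda>x. p x * rot_deriv G' b c x)"
    by (intro integrable_sphere_measure_continuous real_polynomial_function_continuous_on 
        real_polynomial_function.intros(4) rot_deriv_polynomial[OF DP] rot_deriv_polynomial[OF DQ] p q)+
  then show ?thesis
    using integral_rot_deriv_eq_0[OF pq K bc] by (simp add: e)
qed

lemma integral_rot_deriv_twice_symmetric: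
  fixes p q :: "'a::euclidean_space \<Rightarrow> real"
  assumes p: "real_polynomial_function p" and q: "real_polynomial_function q"
    and DP: "twice_derivative p G H" and DQ: "twice_derivative q G' H'"
    and bc: "b \<in> Basis" "c \<in> Basis"
  shows "(LINT x|sphere_measure. rot_deriv2 G H b c x * q x)
       = (LINT x|sphere_measure. p x * rot_deriv2 G' H' b c x)"
    and "real_polynomial_function (rot_deriv2 G H b c)"
proof -
  have *: "\<exists>K K'. twice_derivative (rot_deriv G b c) K K' \<and>
      rot_deriv K b c = rot_deriv2 G H b c"
    if D: "twice_derivative p G H" for p :: "'a \<Rightarrow> real" and G H
  proof -
    obtain K K' where K: "twice_derivative (rot_deriv G b c) K K'"
      using real_polynomial_function_twice_derivative[OF rot_deriv_polynomial[OF D]] by blast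
    have "K x = (\<lambda>u. H x u (plane_gen b c x) + G x (plane_gen b c u))" for x
      by (rule has_derivative_unique[OF twice_derivativeD(1)[OF K] rot_deriv_has_derivative[OF D]])
    then show ?thesis using K by (intro exI[of _ K] exI[of _ K']) (simp add: fun_eq_iff rot_deriv_def rot_deriv2_def)
  qed
  obtain K K' where K: "twice_derivative (rot_deriv G b c) K K'"
    "rot_deriv K b c = rot_deriv2 G H b c"
    using *[OF DP] by blast
  obtain J J' where J: "twice_derivative (rot_deriv G' b c) J J'"
    "rot_deriv J b c = rot_deriv2 G' H' b c"
    using *[OF DQ] by blast
  show "real_polynomial_function (rot_deriv2 G H b c)"
    using rot_deriv_polynomial[OF K(1), of b c] K(2) by simp
  show "(LINT x|sphere_measure. rot_deriv2 G H b c x * q x)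
       = (LINT x|sphere_measure. p x * rot_deriv2 G' H' b c x)"
    using integral_rot_deriv_by_parts[OF rot_deriv_polynomial[OF DP] q K(1) DQ bc]
      integral_rot_deriv_by_parts[OF p rot_deriv_polynomial[OF DQ] DP J(1) bc] K(2) J(2)
    by simp
qed

text \<open>Integration by parts makes the operator of \<open>sum_rot_deriv_twice\<close> symmetric, and its eigenvalues
  \<open>- 2 * k * (k + D - 2)\<close> differ for different degrees as soon as the dimension \<open>D\<close> is at least \<open>2\<close>.\<close>

theorem spherical_harmonics_orthogonal:
  fixes f g :: "'a::euclidean_space \<Rightarrow> real"
  assumes "2 \<le> DIM('a)" and "f \<in> spherical_harmonics k" "g \<in> spherical_harmonics m" and km: "k \<noteq> m"
  shows "(LINT x|sphere_measure. f x * g x) = 0"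
proof -
  obtain p where p: "real_polynomial_function p" "\<And>t x. p (t *\<^sub>R x) = t ^ k * p x"
      "\<And>x. laplacian p x = 0" "\<And>x. x\<in>sphere 0 1 \<Longrightarrow> f x = p x"
    using assms(2) unfolding spherical_harmonics_def by auto
  obtain q where q: "real_polynomial_function q" "\<And>t x. q (t *\<^sub>R x) = t ^ m * q x"
      "\<And>x. laplacian q x = 0" "\<And>x. x\<in>sphere 0 1 \<Longrightarrow> g x = q x"
    using assms(3) unfolding spherical_harmonics_def by auto
  obtain G H where DP: "twice_derivative p G H" using real_polynomial_function_twice_derivative[OF p(1)] by blast
  obtain G' H' where DQ: "twice_derivative q G' H'" using real_polynomial_function_twice_derivative[OF q(1)] by blast
  let ?I = "LINT x|sphere_measure. p x * q x"
  define e where "e j = - 2 * real j * (real j + real DIM('a) - 2)" for j :: nat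
  have int1: "integrable sphere_measure (\<lambda>x. rot_deriv2 G H b c x * q x)" if "b \<in> Basis" "c \<in> Basis" for b c
    using integral_rot_deriv_twice_symmetric(2)[OF p(1) q(1) DP DQ that] q(1)
    by (intro integrable_sphere_measure_continuous real_polynomial_function_continuous_on real_polynomial_function.intros(4))
  have int2: "integrable sphere_measure (\<lambda>x. p x * rot_deriv2 G' H' b c x)" if "b \<in> Basis" "c \<in> Basis" for b c
    using integral_rot_deriv_twice_symmetric(2)[OF q(1) p(1) DQ DP that] p(1)
    by (intro integrable_sphere_measure_continuous real_polynomial_function_continuous_on real_polynomial_function.intros(4))
  have "e k * ?I = (LINT x|sphere_measure. (\<Sum>b\<in>Basis. \<Sum>c\<in>Basis. rot_deriv2 G H b c x * q x))"
    unfolding sum_distrib_right[symmetric] sum_rot_deriv_twice[OF DP p(2,3)]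
    by (simp add: e_def mult.assoc)
  also have "\<dots> = (\<Sum>b\<in>Basis. \<Sum>c\<in>Basis. LINT x|sphere_measure. rot_deriv2 G H b c x * q x)"
    using int1 by (simp add: Bochner_Integration.integral_sum)
  also have "\<dots> = (\<Sum>b\<in>Basis. \<Sum>c\<in>Basis. LINT x|sphere_measure. p x * rot_deriv2 G' H' b c x)"
    by (intro sum.cong refl integral_rot_deriv_twice_symmetric(1)[OF p(1) q(1) DP DQ])
  also have "\<dots> = (LINT x|sphere_measure. (\<Sum>b\<in>Basis. \<Sum>c\<in>Basis. p x * rot_deriv2 G' H' b c x))"
    using int2 by (simp add: Bochner_Integration.integral_sum)
  also have "\<dots> = e m * ?I"
    unfolding sum_distrib_left[symmetric] sum_rot_deriv_twice[OF DQ q(2,3)]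
    by (simp add: e_def mult.assoc mult.left_commute[of _ "real m"] mult.left_commute[of "p _"])
  finally have "(e k - e m) * ?I = 0" by (simp add: algebra_simps)
  moreover have "e k - e m = - 2 * (real k - real m) * (real k + real m + (real DIM('a) - 2))"
    by (simp add: e_def algebra_simps)
  moreover have "real k + real m + (real DIM('a) - 2) > 0" using assms(1) km by linarith
  ultimately have "?I = 0" using km by auto
  moreover have "(LINT x|sphere_measure. f x * g x) = ?I"
    by (rule Bochner_Integration.integral_cong) (auto simp: p(4) q(4))
  ultimately show ?thesis by simp
qed

section \<open>The addition theorem on the diagonal\<close>

text \<open>In the standard basis the left-hand side has the coefficients
  \<open>\<Sum>b\<in>Basis. (T b \<bullet> c) * (T b \<bullet> e)\<close>. With \<open>S\<close> the inverse of \<open>T\<close> they equal \<open>S c \<bullet> S e = c \<bullet> e\<close>.\<close>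

lemma trace_orthogonal_invariant:
  fixes B :: "'a::euclidean_space \<Rightarrow> 'a \<Rightarrow> real" and T :: "'a \<Rightarrow> 'a"
  assumes T: "orthogonal_transformation T"
    and lin: "\<And>u. linear (B u)" "\<And>v. linear (\<lambda>u. B u v)"
  shows "(\<Sum>b\<in>Basis. B (T b) (T b)) = (\<Sum>b\<in>Basis. B b b)"
proof -
  define S where "S = inv T"
  have TS: "T (S c) = c" for c
    unfolding S_def using surj_f_inv_f[OF orthogonal_transformation_surj[OF T]] .
  have in_T: "T b \<bullet> c = b \<bullet> S c" for b c
    using T TS[of c] by (metis orthogonal_transformation_def)
  have "B (T b) (T b) = (\<Sum>c\<in>Basis. \<Sum>e\<in>Basis. (b \<bullet> S c) * (b \<bullet> S e) * B c e)" for b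
  proof -
    have "B (T b) (T b) = B (\<Sum>c\<in>Basis. (T b \<bullet> c) *\<^sub>R c) (\<Sum>c\<in>Basis. (T b \<bullet> c) *\<^sub>R c)"
      by (simp only: euclidean_representation)
    also have "\<dots> = (\<Sum>c\<in>Basis. \<Sum>e\<in>Basis. (b \<bullet> S c) * (b \<bullet> S e) * B c e)"
      unfolding linear_sum[OF lin(2)] linear_sum[OF lin(1)] linear_scale[OF lin(2)] linear_scale[OF lin(1)] in_T
      by (simp add: sum_distrib_left mult_ac, subst sum.swap, simp add: mult_ac)
    finally show ?thesis .
  qed
  then have "(\<Sum>b\<in>Basis. B (T b) (T b)) = (\<Sum>b\<in>Basis. \<Sum>c\<in>Basis. \<Sum>e\<in>Basis. (b \<bullet> S c) * (b \<bullet> S e) * B c e)"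
    by simp
  also have "\<dots> = (\<Sum>c\<in>Basis. \<Sum>b\<in>Basis. \<Sum>e\<in>Basis. (b \<bullet> S c) * (b \<bullet> S e) * B c e)"
    by (rule sum.swap)
  also have "\<dots> = (\<Sum>c\<in>Basis. \<Sum>e\<in>Basis. \<Sum>b\<in>Basis. (b \<bullet> S c) * (b \<bullet> S e) * B c e)"
    by (intro sum.cong refl sum.swap)
  also have "\<dots> = (\<Sum>c\<in>Basis. \<Sum>e\<in>Basis. (c \<bullet> e) * B c e)"
  proof (intro sum.cong refl)
    fix c e
    have "(\<Sum>b\<in>Basis. (b \<bullet> S c) * (b \<bullet> S e)) = S c \<bullet> S e"
      by (simp add: euclidean_inner[of "S c" "S e"] inner_commute)
    also have "\<dots> = c \<bullet> e" using T TS by (metis orthogonal_transformation_def)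
    finally show "(\<Sum>b\<in>Basis. (b \<bullet> S c) * (b \<bullet> S e) * B c e) = (c \<bullet> e) * B c e"
      by (simp flip: sum_distrib_right)
  qed
  also have "\<dots> = (\<Sum>c\<in>Basis. B c c)"
    by (intro sum.cong refl) (simp add: inner_Basis if_distrib[of "\<lambda>z. z * _"] sum.delta cong: if_cong)
  finally show ?thesis .
qed

text \<open>The second derivative of \<open>p \<circ> T\<close> is that of \<open>p\<close> in the directions \<open>T u\<close>, \<open>T v\<close>, so its Laplacian is
  a trace in a rotated basis.\<close>

lemma spherical_harmonics_orthogonal_transformation:
  fixes f :: "'a::euclidean_space \<Rightarrow> real" and T :: "'a \<Rightarrow> 'a"
  assumes T: "orthogonal_transformation T" and "f \<in> spherical_harmonics k"
  shows "(\<lambda>x. f (T x)) \<in> spherical_harmonics k"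
proof -
  obtain p where p: "real_polynomial_function p" "\<And>t x. p (t *\<^sub>R x) = t ^ k * p x"
      "\<And>x. laplacian p x = 0" "\<And>x. x\<in>sphere 0 1 \<Longrightarrow> f x = p x"
    using assms(2) unfolding spherical_harmonics_def by auto
  have lT: "linear T" and blT: "bounded_linear T"
    using T by (auto simp: orthogonal_transformation_def linear_conv_bounded_linear)
  have q: "real_polynomial_function (\<lambda>x. p (T x))"
    using real_polynomial_function_compose[OF polynomial_function_bounded_linear[OF blT] p(1)]
    by (simp add: comp_def)
  obtain G H where D: "twice_derivative p G H" using real_polynomial_function_twice_derivative[OF p(1)] by blast
  obtain K J where E: "twice_derivative (\<lambda>x. p (T x)) K J" using real_polynomial_function_twice_derivative[OF q] by blast
  have K: "K x = (\<lambda>v. G (T x) (T v))" for x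
    by (rule has_derivative_unique[OF twice_derivativeD(1)[OF E]
        has_derivative_compose[OF bounded_linear_imp_has_derivative[OF blT] twice_derivativeD(1)[OF D]]])
  have J: "(\<lambda>u. J x u v) = (\<lambda>u. H (T x) (T u) (T v))" for x v
    using has_derivative_unique[OF twice_derivativeD(2)[OF E, unfolded K]
        has_derivative_compose[OF bounded_linear_imp_has_derivative[OF blT] twice_derivativeD(2)[OF D]]] .
  have "laplacian (\<lambda>x. p (T x)) x = 0" for x
  proof -
    have "laplacian (\<lambda>x. p (T x)) x = (\<Sum>b\<in>Basis. H (T x) (T b) (T b))"
      unfolding laplacian_eq_trace[OF E] using J[THEN fun_cong] by simp
    also have "\<dots> = laplacian p (T x)"
      unfolding laplacian_eq_trace[OF D]
      by (rule trace_orthogonal_invariant[OF T, of "H (T x)"])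
         (rule twice_derivativeD(4)[OF D] twice_derivativeD(5)[OF D])+
    finally show ?thesis using p(3) by simp
  qed
  moreover have "\<forall>x\<in>sphere 0 1. f (T x) = p (T x)"
    using p(4) orthogonal_transformation_norm[OF T] by simp
  moreover have "\<forall>t x. p (T (t *\<^sub>R x)) = t ^ k * p (T x)"
    using p(2) linear_scale[OF lT] by simp
  ultimately show ?thesis
    unfolding spherical_harmonics_def using q by blast
qed

text \<open>The reflection that exchanges \<open>x\<close> and \<open>y\<close> is orthogonal. For \<open>x = y\<close> the formula is the identity, by the
  convention for division by zero.\<close>

lemma orthogonal_transformation_sphere_transitive:
  fixes x y :: "'a::euclidean_space"
  assumes "norm x = norm y"
  obtains T where "orthogonal_transformation T" "T x = y"
proof -
  define v where "v = x - y"
  define T where "T z = z - (2 * (v \<bullet> z) / (v \<bullet> v)) *\<^sub>R v" for z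
  have "T z \<bullet> T u = z \<bullet> u" for z u
  proof (cases "v = 0")
    case False
    then have "(v \<bullet> v) \<noteq> 0" by simp
    moreover have "T z \<bullet> T u = z \<bullet> u - 2 * (v \<bullet> u) / (v \<bullet> v) * (v \<bullet> z) - 2 * (v \<bullet> z) / (v \<bullet> v) * (v \<bullet> u)
       + (2 * (v \<bullet> z) / (v \<bullet> v)) * (2 * (v \<bullet> u) / (v \<bullet> v)) * (v \<bullet> v)"
      unfolding T_def by (simp only: inner_diff_left[of z] inner_diff_right[of _ u] inner_scaleR_left
          inner_scaleR_right inner_commute[of z v]) (simp add: algebra_simps)
    ultimately show ?thesis by (simp add: field_simps)
  qed (simp add: T_def)
  moreover have "linear T"
    by (rule linearI) (auto simp: T_def inner_simps algebra_simps add_divide_distrib)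
  ultimately have orth: "orthogonal_transformation T" by (simp add: orthogonal_transformation_def)
  have "T x = y"
  proof (cases "v = 0")
    case False
    have "x \<bullet> x = y \<bullet> y" using assms by (simp add: dot_square_norm)
    then have "2 * (v \<bullet> x) = v \<bullet> v" by (simp add: v_def inner_simps inner_commute)
    then show ?thesis using False by (simp add: T_def v_def)
  qed (simp add: T_def v_def)
  then show ?thesis using orth that by blast
qed

lemma spherical_harmonics_cases:
  fixes f :: "'a::euclidean_space \<Rightarrow> real"
  assumes "f \<in> spherical_harmonics k"
  obtains p where "continuous_on UNIV p" "\<And>x. x\<in>sphere 0 1 \<Longrightarrow> f x = p x"
proof -
  obtain p where "real_polynomial_function p" "\<And>x. x\<in>sphere 0 1 \<Longrightarrow> f x = p x"
    using assms unfolding spherical_harmonics_def by auto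
  then show ?thesis using that[of p] real_polynomial_function_continuous_on[of p UNIV] by blast
qed

lemma spherical_harmonics_measurable:
  assumes "f \<in> spherical_harmonics k"
  shows "f \<in> borel_measurable sphere_measure"
proof -
  obtain p where p: "continuous_on UNIV p" "\<And>x. x\<in>sphere 0 1 \<Longrightarrow> f x = p x"
    using spherical_harmonics_cases[OF assms] by blast
  have "p \<in> borel_measurable sphere_measure"
    by (intro borel_measurable_sphere_measureI borel_measurable_continuous_onI p)
  then show ?thesis
    by (subst measurable_cong[of _ _ p]) (use p(2) in auto)
qed

lemma spherical_harmonics_integrable_mult:
  assumes "f \<in> spherical_harmonics k" "g \<in> spherical_harmonics m"
  shows "integrable sphere_measure (\<lambda>x. f x * g x)"
proof -
  obtain p where p: "continuous_on UNIV p" "\<And>x. x\<in>sphere 0 1 \<Longrightarrow> f x = p x"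
    using spherical_harmonics_cases[OF assms(1)] by blast
  obtain q where q: "continuous_on UNIV q" "\<And>x. x\<in>sphere 0 1 \<Longrightarrow> g x = q x"
    using spherical_harmonics_cases[OF assms(2)] by blast
  have "integrable sphere_measure (\<lambda>x. p x * q x)"
    by (intro integrable_sphere_measure_continuous continuous_on_mult p q)
  then show ?thesis
    by (subst Bochner_Integration.integrable_cong[OF refl, of _ _ "\<lambda>x. p x * q x"]) (auto simp: p q)
qed

lemma harmonic_onbD:
  assumes "harmonic_onb Z Y" "l \<in> {1..Z k}"
  shows "Y k l \<in> spherical_harmonics k"
  using assms by (auto simp: harmonic_onb_def)

lemma harmonic_onb_orthonormal:
  fixes Y :: "nat \<Rightarrow> nat \<Rightarrow> 'a::euclidean_space \<Rightarrow> real"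
  assumes "harmonic_onb Z Y" "2 \<le> DIM('a)" "l \<in> {1..Z k}" "j \<in> {1..Z m}"
  shows "(LINT x|sphere_measure. Y k l x * Y m j x) = (if k = m \<and> l = j then 1 else 0)"
proof (cases "k = m")
  case True
  then show ?thesis using assms by (auto simp: harmonic_onb_def)
next
  case False
  then show ?thesis
    using spherical_harmonics_orthogonal[OF assms(2) harmonic_onbD[OF assms(1,3)] harmonic_onbD[OF assms(1,4)]]
    by simp
qed

lemma harmonic_onb_parseval:
  fixes Y :: "nat \<Rightarrow> nat \<Rightarrow> 'a::euclidean_space \<Rightarrow> real"
  assumes onb: "harmonic_onb Z Y"
  shows "(LINT x|sphere_measure. (\<Sum>l=1..Z k. a l * Y k l x)\<^sup>2) = (\<Sum>l=1..Z k. (a l)\<^sup>2)"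
proof -
  have int: "integrable sphere_measure (\<lambda>x. Y k l x * Y k j x)" if "l \<in> {1..Z k}" "j \<in> {1..Z k}" for l j
    by (rule spherical_harmonics_integrable_mult[OF harmonic_onbD[OF onb that(1)] harmonic_onbD[OF onb that(2)]])
  have "(LINT x|sphere_measure. (\<Sum>l=1..Z k. a l * Y k l x)\<^sup>2)
     = (LINT x|sphere_measure. (\<Sum>l=1..Z k. \<Sum>j=1..Z k. (a l * a j) * (Y k l x * Y k j x)))"
    by (simp add: power2_eq_square sum_product mult_ac)
  also have "\<dots> = (\<Sum>l=1..Z k. \<Sum>j=1..Z k. (a l * a j) * (LINT x|sphere_measure. Y k l x * Y k j x))"
  proof -
    have "(LINT x|sphere_measure. (\<Sum>l=1..Z k. \<Sum>j=1..Z k. (a l * a j) * (Y k l x * Y k j x)))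
        = (\<Sum>l=1..Z k. LINT x|sphere_measure. (\<Sum>j=1..Z k. (a l * a j) * (Y k l x * Y k j x)))"
      by (rule Bochner_Integration.integral_sum) (intro Bochner_Integration.integrable_sum integrable_mult_right int)
    also have "\<dots> = (\<Sum>l=1..Z k. \<Sum>j=1..Z k. LINT x|sphere_measure. (a l * a j) * (Y k l x * Y k j x))"
      by (intro sum.cong refl Bochner_Integration.integral_sum integrable_mult_right int)
    finally show ?thesis by simp
  qed
  also have "\<dots> = (\<Sum>l=1..Z k. \<Sum>j=1..Z k. if l = j then a l * a j else 0)"
    using onb by (intro sum.cong refl) (auto simp: harmonic_onb_def)
  also have "\<dots> = (\<Sum>l=1..Z k. (a l)\<^sup>2)"
    by (intro sum.cong refl) (simp add: sum.delta power2_eq_square)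
  finally show ?thesis .
qed

text \<open>Let \<open>K x\<close> be the sum. For orthogonal \<open>T\<close> the function \<open>z \<mapsto> \<Sum>l. Y k l (T x) * Y k l (T z)\<close> is a
  harmonic of degree \<open>k\<close> whose value at \<open>x\<close> and whose squared norm both equal \<open>K (T x)\<close>. Cauchy-Schwarz for its
  expansion gives \<open>(K (T x))\<^sup>2 \<le> K (T x) * K x\<close>. As the orthogonal group is transitive on the sphere, \<open>K\<close> is
  constant there, and its integral is \<open>Z k\<close>.\<close>

theorem addition_theorem_diagonal:
  fixes Y :: "nat \<Rightarrow> nat \<Rightarrow> 'a::euclidean_space \<Rightarrow> real"
  assumes onb: "harmonic_onb Z Y" and x: "x \<in> sphere 0 1"
  shows "(\<Sum>l=1..Z k. (Y k l x)\<^sup>2) = real (Z k)"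
proof -
  interpret prob_space "sphere_measure :: 'a measure" by (rule prob_space_sphere_measure)
  define K where "K x = (\<Sum>l=1..Z k. (Y k l x)\<^sup>2)" for x
  have K0: "K x \<ge> 0" for x by (simp add: K_def sum_nonneg)
  have le: "K (T x) \<le> K x" if T: "orthogonal_transformation T" and x: "x \<in> sphere 0 1" for T x
  proof -
    have "\<forall>l\<in>{1..Z k}. \<exists>a. \<forall>z\<in>sphere 0 1. Y k l (T z) = (\<Sum>m=1..Z k. a m * Y k m z)"
      using spherical_harmonics_orthogonal_transformation[OF T harmonic_onbD[OF onb]] onb
      by (auto simp: harmonic_onb_def)
    then obtain A where A: "\<And>l z. l\<in>{1..Z k} \<Longrightarrow> z \<in> sphere 0 1 \<Longrightarrow> Y k l (T z) = (\<Sum>m=1..Z k. A l m * Y k m z)"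
      by metis
    \<comment> \<open>\<open>a\<close> are the coefficients of \<open>z \<mapsto> g (T z)\<close>, and \<open>g (T x) = K (T x)\<close>.\<close>
    define a where "a m = (\<Sum>l=1..Z k. Y k l (T x) * A l m)" for m
    define g where "g z = (\<Sum>l=1..Z k. Y k l (T x) * Y k l z)" for z
    have gT: "g (T z) = (\<Sum>m=1..Z k. a m * Y k m z)" if "z \<in> sphere 0 1" for z
    proof -
      have "g (T z) = (\<Sum>l=1..Z k. \<Sum>m=1..Z k. Y k l (T x) * A l m * Y k m z)"
        unfolding g_def using that by (intro sum.cong refl) (simp add: A sum_distrib_left mult.assoc)
      also have "\<dots> = (\<Sum>m=1..Z k. a m * Y k m z)"
        by (subst sum.swap) (simp add: a_def sum_distrib_right)
      finally show ?thesis .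
    qed
    have gm: "g \<in> borel_measurable sphere_measure"
      unfolding g_def using spherical_harmonics_measurable[OF harmonic_onbD[OF onb]]
      by (intro borel_measurable_sum borel_measurable_times) auto
    have "(\<Sum>m=1..Z k. (a m)\<^sup>2) = (LINT z|sphere_measure. (\<Sum>m=1..Z k. a m * Y k m z)\<^sup>2)"
      by (rule harmonic_onb_parseval[OF onb, symmetric])
    also have "\<dots> = (LINT z|sphere_measure. (g (T z))\<^sup>2)"
      by (rule Bochner_Integration.integral_cong) (auto simp: gT)
    also have "\<dots> = (LINT z|sphere_measure. (g z)\<^sup>2)"
      using gm by (intro integral_sphere_measure_orthogonal[OF T]) auto
    also have "\<dots> = K (T x)"
      unfolding g_def K_def by (rule harmonic_onb_parseval[OF onb])
    finally have a2: "(\<Sum>m=1..Z k. (a m)\<^sup>2) = K (T x)" .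
    have "K (T x) = g (T x)" by (simp add: K_def g_def power2_eq_square)
    then have "(K (T x))\<^sup>2 = (\<Sum>m=1..Z k. a m * Y k m x)\<^sup>2" using gT[OF x] by simp
    also have "\<dots> \<le> (\<Sum>m=1..Z k. (a m)\<^sup>2) * (\<Sum>m=1..Z k. (Y k m x)\<^sup>2)"
      by (rule Cauchy_Schwarz_ineq_sum)
    also have "\<dots> = K (T x) * K x" by (simp only: a2) (simp add: K_def)
    finally have "K (T x) * K (T x) \<le> K (T x) * K x" by (simp add: power2_eq_square)
    then show ?thesis using K0[of "T x"] K0[of x] by (cases "K (T x) = 0") auto
  qed
  have const: "K y = K x" if y: "y \<in> sphere 0 1" for y
  proof (rule antisym)
    obtain T where "orthogonal_transformation T" "T x = y"
      using orthogonal_transformation_sphere_transitive[of x y] x y by auto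
    then show "K y \<le> K x" using le x by blast
    obtain T where "orthogonal_transformation T" "T y = x"
      using orthogonal_transformation_sphere_transitive[of y x] x y by auto
    then show "K x \<le> K y" using le y by blast
  qed
  have "real (Z k) = (\<Sum>l=1..Z k. LINT y|sphere_measure. Y k l y * Y k l y)"
    using onb by (simp add: harmonic_onb_def)
  also have "\<dots> = (LINT y|sphere_measure. K y)"
    unfolding K_def power2_eq_square
    by (rule Bochner_Integration.integral_sum[symmetric])
       (rule spherical_harmonics_integrable_mult[OF harmonic_onbD[OF onb] harmonic_onbD[OF onb]])
  also have "\<dots> = (LINT y|(sphere_measure :: 'a measure). K x)"
    by (rule Bochner_Integration.integral_cong) (auto intro: const)
  also have "\<dots> = K x" using prob_space by simp
  finally show ?thesis by (simp add: K_def)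
qed

section \<open>The number of spherical harmonics up to a given degree\<close>

interpretation fun_vs: vector_space "\<lambda>(c::real) (f::'a \<Rightarrow> real) x. c * f x"
  by unfold_locales (auto simp: fun_eq_iff algebra_simps)

lemma sum_function_apply: "sum F A x = (\<Sum>a\<in>A. F a x)" for F :: "'i \<Rightarrow> 'b \<Rightarrow> real"
  by (induction A rule: infinite_finite_induct) auto

definition monomial :: "('a::euclidean_space \<Rightarrow> nat) \<Rightarrow> 'a \<Rightarrow> real" where
  "monomial a x = (\<Prod>b\<in>Basis. (x \<bullet> b) ^ a b)"

text \<open>Cutting functions off outside the sphere turns equality on the sphere into equality in the vector space
  of all functions.\<close>

definition on_sphere :: "('a::euclidean_space \<Rightarrow> real) \<Rightarrow> 'a \<Rightarrow> real" where
  "on_sphere f x = (if x \<in> sphere 0 1 then f x else 0)"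

lemma monomial_mult: "monomial a x * monomial a' x = monomial (\<lambda>b. a b + a' b) x"
  by (simp add: monomial_def prod.distrib power_add)

lemma monomial_cong: "(\<And>b. b \<in> Basis \<Longrightarrow> a b = a' b) \<Longrightarrow> monomial a = monomial a'"
  by (auto simp: monomial_def fun_eq_iff intro!: prod.cong)

lemma monomial_scaleR: "monomial a (t *\<^sub>R x) = t ^ (\<Sum>b\<in>Basis. a b) * monomial a x"
  by (simp add: monomial_def power_mult_distrib prod.distrib power_sum)

lemma monomial_single:
  assumes "b \<in> Basis"
  shows "monomial (\<lambda>e. if e = b then m else 0) x = (x \<bullet> b) ^ m"
proof -
  have "monomial (\<lambda>e. if e = b then m else 0) x = (\<Prod>e\<in>Basis. if e = b then (x \<bullet> b) ^ m else 1)"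
    unfolding monomial_def by (intro prod.cong) auto
  then show ?thesis using assms by (simp add: prod.delta)
qed

lemma real_polynomial_function_span_monomials:
  fixes p :: "'a::euclidean_space \<Rightarrow> real"
  assumes "real_polynomial_function p"
  shows "p \<in> fun_vs.span (range monomial)"
  using assms
proof induction
  case (linear f)
  then have lf: "linear f" by (simp add: linear_conv_bounded_linear)
  have "f = (\<Sum>b\<in>Basis. (\<lambda>x. f b * monomial (\<lambda>e. if e = b then 1 else 0) x))"
  proof
    fix x
    have "f x = f (\<Sum>b\<in>Basis. (x \<bullet> b) *\<^sub>R b)" by (simp add: euclidean_representation)
    also have "\<dots> = (\<Sum>b\<in>Basis. f b * monomial (\<lambda>e. if e = b then 1 else 0) x)"
      by (simp add: linear_sum[OF lf] linear_scale[OF lf] monomial_single mult.commute)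
    finally show "f x = (\<Sum>b\<in>Basis. (\<lambda>x. f b * monomial (\<lambda>e. if e = b then 1 else 0) x)) x"
      by (simp add: sum_function_apply)
  qed
  also have "\<dots> \<in> fun_vs.span (range monomial)"
    by (intro fun_vs.span_sum fun_vs.span_scale fun_vs.span_base) auto
  finally show ?case .
next
  case (const c)
  have "(\<lambda>x::'a. c) = (\<lambda>x. c * monomial (\<lambda>e. 0) x)" by (simp add: monomial_def)
  also have "\<dots> \<in> fun_vs.span (range monomial)"
    by (intro fun_vs.span_scale fun_vs.span_base) auto
  finally show ?case .
next
  case (add f g)
  then have "f + g \<in> fun_vs.span (range monomial)" by (intro fun_vs.span_add)
  then show ?case by (simp add: plus_fun_def)
next
  case (mult f g)
  have mono_mult: "(\<lambda>x. monomial a x * g x) \<in> fun_vs.span (range monomial)"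
    if "g \<in> fun_vs.span (range monomial)" for a :: "'a \<Rightarrow> nat" and g
    using that
  proof (induction rule: fun_vs.span_induct_alt)
    case base
    have "(\<lambda>x. monomial a x * (0 :: 'a \<Rightarrow> real) x) = 0" by auto
    then show ?case using fun_vs.span_zero by simp
  next
    case (step c m h)
    then obtain a' where m: "m = monomial a'" by auto
    have "(\<lambda>x. monomial a x * ((\<lambda>x. c * m x) + h) x)
        = (\<lambda>x. c * monomial (\<lambda>b. a b + a' b) x) + (\<lambda>x. monomial a x * h x)"
      by (auto simp: m fun_eq_iff algebra_simps monomial_mult[symmetric])
    then show ?case
      using fun_vs.span_add[OF fun_vs.span_scale[OF fun_vs.span_base[OF rangeI]] step(2)] by simp
  qed
  from mult(3) show ?case
  proof (induction rule: fun_vs.span_induct_alt)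
    case base
    have "(\<lambda>x. (0 :: 'a \<Rightarrow> real) x * g x) = 0" by auto
    then show ?case using fun_vs.span_zero by simp
  next
    case (step c m h)
    then obtain a' where m: "m = monomial a'" by auto
    have "(\<lambda>x. ((\<lambda>x. c * m x) + h) x * g x)
        = (\<lambda>x. c * (monomial a' x * g x)) + (\<lambda>x. h x * g x)"
      by (auto simp: m fun_eq_iff algebra_simps)
    then show ?case using step fun_vs.span_scale[OF mono_mult[OF mult(4)]]
      by (auto intro!: fun_vs.span_add)
  qed
qed

text \<open>Compare the coefficients of \<open>t ^ k\<close> in an expansion of \<open>p (t *\<^sub>R x) = t ^ k * p x\<close> into monomials.\<close>

lemma homogeneous_polynomial_span_monomials:
  fixes p :: "'a::euclidean_space \<Rightarrow> real"
  assumes p: "real_polynomial_function p" and hom: "\<And>t x. p (t *\<^sub>R x) = t ^ k * p x"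
  shows "p \<in> fun_vs.span {monomial a |a. (\<Sum>b\<in>Basis. a b) = k}"
proof -
  obtain S u where S: "finite S" "S \<subseteq> range monomial" and pe: "p = (\<Sum>v\<in>S. (\<lambda>x. u v * v x))"
    using real_polynomial_function_span_monomials[OF p] unfolding fun_vs.span_explicit by auto
  have "\<exists>a. v = monomial a" if "v \<in> S" for v using S(2) that by auto
  then obtain a where a: "\<And>v. v \<in> S \<Longrightarrow> v = monomial (a v)" by metis
  define deg where "deg v = (\<Sum>b\<in>Basis. a v b)" for v
  define N where "N = k + (\<Sum>v\<in>S. deg v)"
  have dN: "deg v \<le> N" if "v \<in> S" for v
    using member_le_sum[OF that, of deg] S(1) by (simp add: N_def)
  have ps: "p x = (\<Sum>v\<in>S. u v * v x)" for x by (simp add: pe sum_function_apply)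
  have sc: "v (t *\<^sub>R x) = t ^ deg v * v x" if "v \<in> S" for v t x
    using a[OF that] monomial_scaleR[of "a v" t x] by (simp add: deg_def)
  have "p x = (\<Sum>v | v \<in> S \<and> deg v = k. u v * v x)" for x
  proof -
    define c where "c j = (\<Sum>v | v \<in> S \<and> deg v = j. u v * v x)" for j
    have "(\<Sum>j\<le>N. c j * t ^ j) = (\<Sum>j\<le>N. (if j = k then p x else 0) * t ^ j)" for t
    proof -
      have "(\<Sum>j\<le>N. c j * t ^ j) = (\<Sum>j\<le>N. \<Sum>v | v \<in> S \<and> deg v = j. u v * (t ^ deg v * v x))"
        unfolding c_def sum_distrib_right by (intro sum.cong refl) auto
      also have "\<dots> = (\<Sum>v\<in>S. u v * (t ^ deg v * v x))"
        using S(1) dN by (subst sum.group) auto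
      also have "\<dots> = p (t *\<^sub>R x)" by (simp add: ps sc)
      also have "\<dots> = (\<Sum>j\<le>N. (if j = k then p x * t ^ j else 0))" by (simp add: hom N_def sum.delta)
      also have "\<dots> = (\<Sum>j\<le>N. (if j = k then p x else 0) * t ^ j)" by (intro sum.cong) auto
      finally show ?thesis .
    qed
    then have "c k = p x" using polyfun_eq_coeffs[where n = N and c = c and d = "\<lambda>j. if j = k then p x else 0"] by (simp add: N_def)
    then show ?thesis by (simp add: c_def)
  qed
  then have "p = (\<Sum>v | v \<in> S \<and> deg v = k. (\<lambda>x. u v * v x))" by (simp add: fun_eq_iff sum_function_apply)
  also have "\<dots> \<in> fun_vs.span {monomial a |a. (\<Sum>b\<in>Basis. a b) = k}"
    using a by (intro fun_vs.span_sum fun_vs.span_scale fun_vs.span_base) (auto simp: deg_def)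
  finally show ?thesis .
qed

text \<open>Since \<open>(x \<bullet> e)\<^sup>2 = 1 - (\<Sum>b\<in>Basis - {e}. (x \<bullet> b)\<^sup>2)\<close> on the sphere, the exponent of the coordinate \<open>e\<close>
  can be kept below \<open>2\<close>. This saves one dimension in the count: order \<open>n ^ d\<close> instead of \<open>n ^ (d + 1)\<close>.\<close>

definition reduced_monomials :: "'a::euclidean_space \<Rightarrow> nat \<Rightarrow> ('a \<Rightarrow> real) set" where
  "reduced_monomials e n = {on_sphere (monomial a) |a. a e \<le> 1 \<and> (\<Sum>b\<in>Basis. a b) \<le> n}"

text \<open>Replacing \<open>(x \<bullet> e)\<^sup>2\<close> lowers the exponent of \<open>e\<close> and does not raise the total degree. It is the total
  degree, not the single exponents, that stays bounded by \<open>n\<close>.\<close>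

lemma on_sphere_monomial_span_reduced:
  fixes e :: "'a::euclidean_space"
  assumes e: "e \<in> Basis" and "(\<Sum>b\<in>Basis. a b) \<le> n"
  shows "on_sphere (monomial a) \<in> fun_vs.span (reduced_monomials e n)"
  using assms(2)
proof (induction "a e" arbitrary: a rule: less_induct)
  case less
  show ?case
  proof (cases "a e \<le> 1")
    case True
    then show ?thesis using less.prems by (auto simp: reduced_monomials_def intro!: fun_vs.span_base)
  next
    case False
    define a0 where "a0 = a(e := a e - 2)"
    \<comment> \<open>\<open>a0\<close> drops a factor \<open>(x \<bullet> e)\<^sup>2\<close> from \<open>a\<close>, and \<open>a1 b\<close> puts \<open>(x \<bullet> b)\<^sup>2\<close> in its place; \<open>a1 e = a\<close>.\<close>
    define a1 where "a1 b = (\<lambda>c. a0 c + (if c = b then 2 else 0))" for b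
    have tot: "(\<Sum>b\<in>Basis. a b) = (\<Sum>b\<in>Basis. a0 b) + 2"
      using e False by (simp add: a0_def sum.remove[of Basis e])
    have tot1: "(\<Sum>c\<in>Basis. a1 b c) = (\<Sum>b\<in>Basis. a0 b) + 2" if "b \<in> Basis" for b
      using that by (simp add: a1_def sum.distrib sum.delta)
    have m1: "monomial (a1 b) x = monomial a0 x * (x \<bullet> b)\<^sup>2" if "b \<in> Basis" for b x
      using monomial_mult[of a0 x "\<lambda>c. if c = b then 2 else 0"] monomial_single[OF that, of 2 x]
      by (simp add: a1_def[abs_def])
    have a_eq: "a = a1 e" using False by (auto simp: a1_def a0_def fun_eq_iff)
    have red: "on_sphere (monomial a) = on_sphere (monomial a0) - (\<Sum>b\<in>Basis - {e}. on_sphere (monomial (a1 b)))"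
    proof
      fix x :: 'a
      have "monomial a x = monomial a0 x - (\<Sum>b\<in>Basis - {e}. monomial (a1 b) x)" if "x \<in> sphere 0 1"
      proof -
        have "1 = x \<bullet> x" using that by (simp add: dot_square_norm)
        also have "\<dots> = (\<Sum>b\<in>Basis. (x \<bullet> b)\<^sup>2)" by (simp add: euclidean_inner[of x x] power2_eq_square)
        also have "\<dots> = (x \<bullet> e)\<^sup>2 + (\<Sum>b\<in>Basis - {e}. (x \<bullet> b)\<^sup>2)" by (rule sum.remove) (use e in auto)
        finally have "(x \<bullet> e)\<^sup>2 = 1 - (\<Sum>b\<in>Basis - {e}. (x \<bullet> b)\<^sup>2)" by simp
        then have "monomial a x = monomial a0 x * (1 - (\<Sum>b\<in>Basis - {e}. (x \<bullet> b)\<^sup>2))"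
          using m1[OF e, of x] by (simp add: a_eq[symmetric])
        then show ?thesis by (simp add: algebra_simps sum_distrib_left m1)
      qed
      then show "on_sphere (monomial a) x = (on_sphere (monomial a0) - (\<Sum>b\<in>Basis - {e}. on_sphere (monomial (a1 b)))) x"
        by (auto simp: on_sphere_def sum_function_apply)
    qed
    show ?thesis unfolding red
    proof (intro fun_vs.span_diff fun_vs.span_sum)
      show "on_sphere (monomial a0) \<in> fun_vs.span (reduced_monomials e n)"
        by (rule less.hyps) (use False less.prems tot in \<open>auto simp: a0_def\<close>)
      show "on_sphere (monomial (a1 b)) \<in> fun_vs.span (reduced_monomials e n)" if "b \<in> Basis - {e}" for b
      proof (rule less.hyps)
        show "a1 b e < a e" using that False by (auto simp: a1_def a0_def)
        show "sum (a1 b) Basis \<le> n" using that tot1[of b] tot less.prems by simp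
      qed
    qed
  qed
qed

lemma card_reduced_monomials:
  fixes e :: "'a::euclidean_space"
  assumes e: "e \<in> Basis" and d: "DIM('a) = d + 1"
  shows "finite (reduced_monomials e n)" "card (reduced_monomials e n) \<le> 2 * (n + 1) ^ d"
proof -
  let ?E = "PiE Basis (\<lambda>b. if b = e then {0, 1::nat} else {0..n})"
  have fin: "finite ?E" by (intro finite_PiE) auto
  have sub: "reduced_monomials e n \<subseteq> (\<lambda>a. on_sphere (monomial a)) ` ?E"
  proof
    fix f assume "f \<in> reduced_monomials e n"
    then obtain a where a: "f = on_sphere (monomial a)" "a e \<le> 1" "(\<Sum>b\<in>Basis. a b) \<le> n"
      by (auto simp: reduced_monomials_def)
    have "a b \<le> n" if "b \<in> Basis" for b
      using member_le_sum[OF that, of a] a(3) by simp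
    then have "restrict a Basis \<in> ?E" using a(2) e by (auto simp: PiE_def Pi_def extensional_def)
    moreover have "f = on_sphere (monomial (restrict a Basis))"
      unfolding a(1) by (rule arg_cong[where f=on_sphere], rule monomial_cong) auto
    ultimately show "f \<in> (\<lambda>a. on_sphere (monomial a)) ` ?E" by blast
  qed
  show "finite (reduced_monomials e n)" using sub fin by (meson finite_imageI finite_subset)
  have "card (reduced_monomials e n) \<le> card ?E"
    by (rule order_trans[OF card_mono[OF finite_imageI[OF fin] sub] card_image_le[OF fin]])
  also have "\<dots> = (\<Prod>b\<in>Basis. card (if b = e then {0, 1::nat} else {0..n}))" by (intro card_PiE) auto
  also have "\<dots> = 2 * (\<Prod>b\<in>Basis - {e}. card (if b = e then {0, 1::nat} else {0..n}))"
    by (subst prod.remove[OF _ e]) auto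
  also have "(\<Prod>b\<in>Basis - {e}. card (if b = e then {0, 1::nat} else {0..n})) = (\<Prod>b\<in>Basis - {e}. n + 1)"
    by (intro prod.cong) auto
  also have "\<dots> = (n + 1) ^ d" using e d by simp
  finally show "card (reduced_monomials e n) \<le> 2 * (n + 1) ^ d" .
qed

lemma spherical_harmonics_span_reduced:
  fixes f :: "'a::euclidean_space \<Rightarrow> real"
  assumes f: "f \<in> spherical_harmonics k" and "k \<le> n" and e: "e \<in> Basis"
  shows "on_sphere f \<in> fun_vs.span (reduced_monomials e n)"
proof -
  obtain p where p: "real_polynomial_function p" "\<And>t x. p (t *\<^sub>R x) = t ^ k * p x"
      "\<And>x. x\<in>sphere 0 1 \<Longrightarrow> f x = p x"
    using f unfolding spherical_harmonics_def by auto
  have "on_sphere q \<in> fun_vs.span (reduced_monomials e n)"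
    if "q \<in> fun_vs.span {monomial a |a. (\<Sum>b\<in>Basis. a b) = k}" for q
    using that
  proof (induction rule: fun_vs.span_induct_alt)
    case base
    have "on_sphere (0 :: 'a \<Rightarrow> real) = 0" by (auto simp: on_sphere_def)
    then show ?case by (simp only: fun_vs.span_zero)
  next
    case (step c m h)
    then obtain a where a: "m = monomial a" "(\<Sum>b\<in>Basis. a b) = k" by auto
    have "on_sphere ((\<lambda>x. c * m x) + h) = (\<lambda>x. c * on_sphere m x) + on_sphere h"
      by (auto simp: on_sphere_def fun_eq_iff)
    moreover have "on_sphere m \<in> fun_vs.span (reduced_monomials e n)"
      unfolding a(1) by (rule on_sphere_monomial_span_reduced[OF e]) (use a(2) \<open>k \<le> n\<close> in simp)
    ultimately show ?case
      using fun_vs.span_add[OF fun_vs.span_scale step(2)] by (simp only:)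
  qed
  moreover have "on_sphere f = on_sphere p" using p(3) by (auto simp: on_sphere_def)
  ultimately show ?thesis using homogeneous_polynomial_span_monomials[OF p(1,2)] by simp
qed

text \<open>The harmonics up to degree \<open>n\<close> are orthonormal, hence linearly independent, and on the sphere all of
  them are combinations of the reduced monomials.\<close>

theorem sum_harmonic_dimensions_le:
  fixes Y :: "nat \<Rightarrow> nat \<Rightarrow> 'a::euclidean_space \<Rightarrow> real"
  assumes onb: "harmonic_onb Z Y" and d: "DIM('a) = d + 1" "1 \<le> d"
  shows "(\<Sum>k\<le>n. Z k) \<le> 2 * (n + 1) ^ d"
proof -
  obtain e :: 'a where e: "e \<in> Basis" using nonempty_Basis by blast
  define I where "I = Sigma {..n} (\<lambda>k. {1..Z k})"
  define r where "r = (\<lambda>(k, l). on_sphere (Y k l))"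
  have fI: "finite I" by (simp add: I_def)
  have ip: "(LINT x|sphere_measure. r i x * r j x) = (if i = j then 1 else 0)"
    and int: "integrable sphere_measure (\<lambda>x. r i x * r j x)" if "i \<in> I" "j \<in> I" for i j
  proof -
    obtain k l m q where ij: "i = (k, l)" "j = (m, q)" "l \<in> {1..Z k}" "q \<in> {1..Z m}"
      using \<open>i \<in> I\<close> \<open>j \<in> I\<close> by (auto simp: I_def)
    have eq: "x \<in> space sphere_measure \<Longrightarrow> r i x * r j x = Y k l x * Y m q x" for x
      by (simp add: r_def ij on_sphere_def)
    show "(LINT x|sphere_measure. r i x * r j x) = (if i = j then 1 else 0)"
      using harmonic_onb_orthonormal[OF onb _ ij(3,4)] d
      by (subst Bochner_Integration.integral_cong[OF refl eq]) (auto simp: ij)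
    show "integrable sphere_measure (\<lambda>x. r i x * r j x)"
      using spherical_harmonics_integrable_mult[OF harmonic_onbD[OF onb ij(3)] harmonic_onbD[OF onb ij(4)]]
      by (subst Bochner_Integration.integrable_cong[OF refl eq]) auto
  qed
  have inj: "inj_on r I"
  proof (rule inj_onI)
    fix i j assume ij: "i \<in> I" "j \<in> I" "r i = r j"
    show "i = j"
    proof (rule ccontr)
      assume "i \<noteq> j"
      then have "(LINT x|sphere_measure. r i x * r j x) = 0" using ip[OF ij(1,2)] by (simp only: if_False)
      moreover have "(LINT x|sphere_measure. r i x * r i x) = 1"
        using ip[OF ij(1,1)] unfolding if_P[OF refl] .
      ultimately have "(0::real) = 1" unfolding ij(3) by (rule trans[OF sym])
      then show False by (rule notE[OF zero_neq_one])
    qed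
  qed
  have "fun_vs.independent (r ` I)"
    unfolding fun_vs.independent_explicit_module
  proof (intro allI impI)
    fix T u v assume T: "finite T" "T \<subseteq> r ` I" "(\<Sum>w\<in>T. (\<lambda>x. u w * w x)) = 0" "v \<in> T"
    have ipT: "(LINT x|sphere_measure. w x * v x) = (if w = v then 1 else 0)"
       "integrable sphere_measure (\<lambda>x. w x * v x)" if wT: "w \<in> T" for w
    proof -
      obtain i where i: "i \<in> I" "w = r i" using subsetD[OF T(2) wT] by (rule imageE)
      obtain j where j: "j \<in> I" "v = r j" using subsetD[OF T(2,4)] by (rule imageE)
      note ij = i(1) j(1) and wv = i(2) j(2)
      show "(LINT x|sphere_measure. w x * v x) = (if w = v then 1 else 0)"
        "integrable sphere_measure (\<lambda>x. w x * v x)"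
        unfolding wv inj_on_eq_iff[OF inj ij] by (rule ip[OF ij], rule int[OF ij])
    qed
    have z: "(\<Sum>w\<in>T. u w * w x) = 0" for x
      using fun_cong[OF T(3), of x] by (simp add: sum_function_apply)
    have "u v = (\<Sum>w\<in>T. u w * (if w = v then 1 else 0))"
    proof -
      have "(\<Sum>w\<in>T. u w * (if w = v then 1 else 0)) = (\<Sum>w\<in>T. if w = v then u w else 0)"
        by (intro sum.cong) auto
      then show ?thesis using T(1,4) by (simp only: sum.delta if_True)
    qed
    also have "\<dots> = (\<Sum>w\<in>T. u w * (LINT x|sphere_measure. w x * v x))"
      by (intro sum.cong refl) (simp only: ipT)
    also have "\<dots> = (\<Sum>w\<in>T. LINT x|sphere_measure. u w * (w x * v x))" by simp
    also have "\<dots> = (LINT x|sphere_measure. (\<Sum>w\<in>T. u w * (w x * v x)))"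
      by (intro Bochner_Integration.integral_sum[symmetric] integrable_mult_right ipT)
    also have "\<dots> = (LINT x|(sphere_measure::'a measure). (\<Sum>w\<in>T. u w * w x) * v x)"
      by (simp only: sum_distrib_right mult.assoc)
    finally show "u v = 0" by (simp only: z) simp
  qed
  moreover have "r ` I \<subseteq> fun_vs.span (reduced_monomials e n)"
  proof
    fix g assume "g \<in> r ` I"
    then obtain k l where kl: "k \<le> n" "l \<in> {1..Z k}" "g = on_sphere (Y k l)"
      by (auto simp: I_def r_def)
    show "g \<in> fun_vs.span (reduced_monomials e n)"
      unfolding kl(3) by (rule spherical_harmonics_span_reduced[OF harmonic_onbD[OF onb kl(2)] kl(1) e])
  qed
  ultimately have "card (r ` I) \<le> card (reduced_monomials e n)"
    by (rule fun_vs.independent_span_bound[OF card_reduced_monomials(1)[OF e d(1)], THEN conjunct2])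
  also have "\<dots> \<le> 2 * (n + 1) ^ d" by (rule card_reduced_monomials(2)[OF e d(1)])
  finally have "card I \<le> 2 * (n + 1) ^ d" by (simp only: card_image[OF inj])
  moreover have "card I = (\<Sum>k\<le>n. Z k)" unfolding I_def by (subst card_SigmaI) auto
  ultimately show ?thesis by (simp only:)
qed

section \<open>The effective dimension\<close>

lemma dyadic_block_exists:
  fixes B :: real
  assumes "1 \<le> B" "B \<le> real k" "k < n"
  shows "\<exists>j<n. B * 2 ^ j \<le> real k \<and> real k < B * 2 ^ Suc j"
proof -
  have "real k < B * 2 ^ n"
  proof -
    have "real k < 2 ^ k" using less_exp[of k] by (metis of_nat_less_iff of_nat_power of_nat_numeral)
    also have "(2::real) ^ k \<le> 2 ^ n" using assms by (intro power_increasing) auto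
    also have "\<dots> \<le> B * 2 ^ n" using assms(1) by simp
    finally show ?thesis .
  qed
  define m where "m = (LEAST m. real k < B * 2 ^ m)"
  have m: "real k < B * 2 ^ m" "m \<le> n"
    unfolding m_def by (rule LeastI[of _ n], fact, rule Least_le, fact)
  have "m \<noteq> 0" using m(1) assms by (intro notI) simp
  then obtain j where j: "m = Suc j" by (cases m) auto
  have "\<not> real k < B * 2 ^ j" using not_less_Least[of j "\<lambda>m. real k < B * 2 ^ m"] j by (simp add: m_def)
  then show ?thesis using m j by (intro exI[of _ j]) auto
qed

text \<open>Split the sum into the blocks \<open>B * 2 ^ j \<le> k < B * 2 ^ Suc j\<close>. A block contributes at most
  \<open>(B * 2 ^ j) powr - p\<close> times the count up to its end, so the blocks are dominated by a geometric series of ratio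
  \<open>2 powr (d - p)\<close>. The factor \<open>4 ^ d\<close> comes from \<open>n + 1 \<le> 4 * (B * 2 ^ j)\<close> at the end of a block.\<close>

lemma sum_tail_polynomial_growth:
  fixes Z :: "nat \<Rightarrow> nat" and B p :: real
  assumes Z: "\<And>n. (\<Sum>k\<le>n. Z k) \<le> 2 * (n + 1) ^ d"
    and p: "real d < p" and B: "1 \<le> B"
  shows "(\<Sum>k | B \<le> real k \<and> k < n. real (Z k) * real k powr - p)
      \<le> 2 * 4 ^ d / (1 - 2 powr (real d - p)) * B powr (real d - p)"
proof -
  let ?K = "{k. B \<le> real k \<and> k < n}"
  let ?block = "\<lambda>j. {k. B * 2 ^ j \<le> real k \<and> real k < B * 2 ^ Suc j}"
  have finK: "finite ?K" by simp
  have r1: "2 powr (real d - p) < 1" using p by (simp add: powr_less_one)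
  have block: "(\<Sum>k | k \<in> ?K \<and> k \<in> ?block j. real (Z k) * real k powr - p)
      \<le> 2 * 4 ^ d * B powr (real d - p) * (2 powr (real d - p)) ^ j" for j
  proof -
    let ?N = "nat \<lfloor>B * 2 ^ Suc j\<rfloor>"
    have Bj: "1 \<le> B * 2 ^ j" using mult_mono[OF B, of 1 "2 ^ j"] B by simp
    have "(\<Sum>k | k \<in> ?K \<and> k \<in> ?block j. real (Z k) * real k powr - p)
       \<le> (\<Sum>k | k \<in> ?K \<and> k \<in> ?block j. real (Z k) * (B * 2 ^ j) powr - p)"
    proof (intro sum_mono mult_left_mono)
      fix k assume "k \<in> {k. k \<in> ?K \<and> k \<in> ?block j}"
      then show "real k powr - p \<le> (B * 2 ^ j) powr - p"
        using Bj p by (intro powr_mono2') auto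
    qed simp
    also have "\<dots> = (B * 2 ^ j) powr - p * (\<Sum>k | k \<in> ?K \<and> k \<in> ?block j. real (Z k))"
      by (simp add: sum_distrib_left mult.commute)
    also have "\<dots> \<le> (B * 2 ^ j) powr - p * (2 * 4 ^ d * (B * 2 ^ j) ^ d)"
    proof (intro mult_left_mono)
      have "(\<Sum>k | k \<in> ?K \<and> k \<in> ?block j. real (Z k)) \<le> (\<Sum>k\<le>?N. real (Z k))"
      proof (rule sum_mono2)
        show "{k. k \<in> ?K \<and> k \<in> ?block j} \<subseteq> {..?N}" by (auto simp: le_nat_floor)
      qed auto
      also have "\<dots> = real (\<Sum>k\<le>?N. Z k)" by simp
      also have "\<dots> \<le> real (2 * (?N + 1) ^ d)" using Z by (rule of_nat_mono)
      also have "\<dots> = 2 * (real ?N + 1) ^ d" by (simp add: add.commute)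
      also have "\<dots> \<le> 2 * (4 * (B * 2 ^ j)) ^ d"
      proof (intro mult_left_mono power_mono)
        have "real ?N \<le> B * 2 ^ Suc j" using B by (intro of_nat_floor) simp
        then show "real ?N + 1 \<le> 4 * (B * 2 ^ j)" using Bj unfolding power_Suc by linarith
      qed auto
      also have "\<dots> = 2 * 4 ^ d * (B * 2 ^ j) ^ d" by (simp only: power_mult_distrib mult.assoc)
      finally show "(\<Sum>k | k \<in> ?K \<and> k \<in> ?block j. real (Z k)) \<le> 2 * 4 ^ d * (B * 2 ^ j) ^ d" .
    qed simp
    also have "\<dots> = 2 * 4 ^ d * ((B * 2 ^ j) powr real d * (B * 2 ^ j) powr - p)"
      using Bj by (subst powr_realpow) auto
    also have "(B * 2 ^ j) powr real d * (B * 2 ^ j) powr - p = (B * 2 ^ j) powr (real d - p)"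
      by (simp add: powr_add[symmetric])
    also have "\<dots> = B powr (real d - p) * (2 powr (real d - p)) ^ j"
      using B by (simp add: powr_mult powr_realpow[symmetric] powr_powr mult.commute)
    finally show ?thesis by (simp add: mult_ac)
  qed
  have "(\<Sum>k\<in>?K. real (Z k) * real k powr - p)
      \<le> (\<Sum>k\<in>?K. \<Sum>j<n. if k \<in> ?block j then real (Z k) * real k powr - p else 0)"
  proof (rule sum_mono)
    fix k assume "k \<in> ?K"
    then obtain j where j: "j < n" "k \<in> ?block j" using dyadic_block_exists[OF B, of k n] by auto
    have "real (Z k) * real k powr - p = (if k \<in> ?block j then real (Z k) * real k powr - p else 0)" using j by simp
    also have "\<dots> \<le> (\<Sum>j<n. if k \<in> ?block j then real (Z k) * real k powr - p else 0)"
      using j(1) by (intro member_le_sum) auto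
    finally show "real (Z k) * real k powr - p \<le> (\<Sum>j<n. if k \<in> ?block j then real (Z k) * real k powr - p else 0)" .
  qed
  also have "\<dots> = (\<Sum>j<n. \<Sum>k\<in>?K. if k \<in> ?block j then real (Z k) * real k powr - p else 0)"
    by (rule sum.swap)
  also have "\<dots> = (\<Sum>j<n. \<Sum>k | k \<in> ?K \<and> k \<in> ?block j. real (Z k) * real k powr - p)"
    by (rule sum.cong[OF refl], rule sum.inter_filter[symmetric, OF finK])
  also have "\<dots> \<le> (\<Sum>j<n. 2 * 4 ^ d * B powr (real d - p) * (2 powr (real d - p)) ^ j)"
    by (intro sum_mono block)
  also have "\<dots> = 2 * 4 ^ d * B powr (real d - p) * (\<Sum>j<n. (2 powr (real d - p)) ^ j)"
    by (simp add: sum_distrib_left)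
  also have "\<dots> \<le> 2 * 4 ^ d * B powr (real d - p) * (1 / (1 - 2 powr (real d - p)))"
  proof (rule mult_left_mono)
    have "(\<Sum>j<n. (2 powr (real d - p)) ^ j) \<le> (\<Sum>j. (2 powr (real d - p)) ^ j)"
      using r1 by (intro sum_le_suminf summable_geometric) auto
    then show "(\<Sum>j<n. (2 powr (real d - p)) ^ j) \<le> 1 / (1 - 2 powr (real d - p))"
      using r1 by (simp add: suminf_geometric)
  qed simp
  finally show ?thesis by (simp add: mult_ac)
qed

text \<open>The quotient is at most \<open>1\<close> and at most \<open>c0 / lam\<close>, and the smaller of these two lies below every
  power of \<open>c0 / lam\<close> with exponent between \<open>0\<close> and \<open>1\<close>.\<close>

lemma shrinkage_le_powr:
  fixes c lam c0 \<theta> :: real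
  assumes "0 < c" "c \<le> c0" "0 < lam" "0 \<le> \<theta>" "\<theta> \<le> 1"
  shows "c / (c + lam) \<le> (c0 / lam) powr \<theta>"
proof (cases "c0 / lam \<le> 1")
  case True
  have "c / (c + lam) \<le> c0 / lam" using assms by (intro frac_le) auto
  also have "\<dots> = (c0 / lam) powr 1" using assms by simp
  also have "\<dots> \<le> (c0 / lam) powr \<theta>" using True assms by (intro powr_mono') auto
  finally show ?thesis .
next
  case False
  have "c / (c + lam) \<le> 1" using assms by simp
  also have "\<dots> \<le> (c0 / lam) powr \<theta>" using False assms by (intro ge_one_powr_ge_zero) auto
  finally show ?thesis .
qed

text \<open>Let \<open>\<tau>\<close> be the degree at which the bound \<open>c2 * k powr (- 2 * \<gamma>)\<close> falls to \<open>lam\<close>. Below \<open>\<tau>\<close> the factors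
  \<open>c k / (c k + lam)\<close> are at most \<open>1\<close> and there are \<open>O(\<tau> ^ d)\<close> harmonics; above \<open>\<tau>\<close> the factors are at most
  \<open>(\<tau> / k) powr (2 * \<gamma>)\<close>, and \<open>d < 2 * \<gamma>\<close> makes the tail of the same order
  \<open>\<tau> powr d = (c2 / lam) powr (d / (2 * \<gamma>))\<close>. Degree \<open>0\<close>, where the decay condition says nothing, is bounded
  separately, and for \<open>\<tau> < 1\<close> the tail starts at degree \<open>1\<close>.\<close>

theorem effective_dimension_bound:
  fixes Z :: "nat \<Rightarrow> nat" and c :: "nat \<Rightarrow> real"
  assumes Z: "\<And>n. (\<Sum>k\<le>n. Z k) \<le> 2 * (n + 1) ^ d"
    and \<gamma>: "real d / 2 < \<gamma>" and d: "1 \<le> d" and c0: "0 < c0" and c2: "0 < c2" and lam: "0 < lam"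
    and c: "\<And>k. 0 < c k" "c 0 \<le> c0" "\<And>k. 1 \<le> k \<Longrightarrow> c k \<le> c2 * real k powr (- 2 * \<gamma>)"
  shows "(\<Sum>k<n. c k / (c k + lam) * real (Z k))
     \<le> (2 * c0 powr (real d / (2 * \<gamma>))
          + (2 * 2 ^ d + 2 * 4 ^ d / (1 - 2 powr (real d - 2 * \<gamma>))) * c2 powr (real d / (2 * \<gamma>)))
        * lam powr (- real d / (2 * \<gamma>))"
proof -
  define \<theta> where "\<theta> = real d / (2 * \<gamma>)"
  have \<gamma>0: "\<gamma> > 0" using \<gamma> d by (auto intro: order.strict_trans1[OF _ \<gamma>])
  have \<theta>: "0 \<le> \<theta>" "\<theta> \<le> 1" "2 * \<gamma> * \<theta> = real d" using \<gamma> \<gamma>0 by (auto simp: \<theta>_def)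
  define C where "C = 2 * 4 ^ d / (1 - 2 powr (real d - 2 * \<gamma>))"
  have "2 powr (real d - 2 * \<gamma>) < 1" using \<gamma> by (simp add: powr_less_one)
  then have C0: "C \<ge> 0" by (simp add: C_def)
  define \<tau> where "\<tau> = (c2 / lam) powr (1 / (2 * \<gamma>))"
  have \<tau>0: "\<tau> > 0" using c2 lam by (simp add: \<tau>_def)
  have \<tau>\<gamma>: "\<tau> powr (2 * \<gamma>) = c2 / lam" using c2 lam \<gamma>0 by (simp add: \<tau>_def powr_powr)
  have \<tau>d: "\<tau> powr real d = (c2 / lam) powr \<theta>" by (simp add: \<tau>_def powr_powr \<theta>_def)
  define g where "g k = c k / (c k + lam) * real (Z k)" for k
  have g0: "0 \<le> g k" for k using c(1)[of k] lam by (simp add: g_def)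
  have Z0: "real (Z 0) \<le> 2" using Z[of 0] by simp
  have first: "g 0 \<le> 2 * (c0 / lam) powr \<theta>"
  proof -
    have "g 0 \<le> (c0 / lam) powr \<theta> * 2"
      unfolding g_def using shrinkage_le_powr[OF c(1) c(2) lam \<theta>(1,2)] Z0
      by (intro mult_mono) auto
    then show ?thesis by simp
  qed
  have gk: "g k \<le> c2 / lam * (real (Z k) * real k powr - (2 * \<gamma>))" if "1 \<le> k" for k
  proof -
    have "c k / (c k + lam) \<le> (c2 * real k powr (- 2 * \<gamma>)) / lam"
      using c(1)[of k] c(3)[OF that] lam by (intro frac_le) auto
    then have "g k \<le> (c2 * real k powr (- 2 * \<gamma>)) / lam * real (Z k)"
      unfolding g_def by (rule mult_right_mono) simp
    then show ?thesis by (simp add: mult_ac)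
  qed
  \<comment> \<open>Positive degrees below \<open>B\<close> exist only if \<open>\<tau> > 1\<close>, and then \<open>B = \<tau>\<close>.\<close>
  define B where "B = max 1 \<tau>"
  have B: "1 \<le> B" by (simp add: B_def)
  have tail: "(\<Sum>k | B \<le> real k \<and> k < n. g k) \<le> C * (c2 / lam) powr \<theta>"
  proof -
    have "(\<Sum>k | B \<le> real k \<and> k < n. g k) \<le> (\<Sum>k | B \<le> real k \<and> k < n. c2 / lam * (real (Z k) * real k powr - (2 * \<gamma>)))"
      using B by (intro sum_mono gk) auto
    also have "\<dots> = c2 / lam * (\<Sum>k | B \<le> real k \<and> k < n. real (Z k) * real k powr - (2 * \<gamma>))"
      by (rule sum_distrib_left[symmetric])
    also have "\<dots> \<le> c2 / lam * (C * B powr (real d - 2 * \<gamma>))"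
      unfolding C_def using c2 lam \<gamma> by (intro mult_left_mono sum_tail_polynomial_growth[OF Z _ B]) auto
    also have "\<dots> = C * (\<tau> powr (2 * \<gamma>) * B powr (real d - 2 * \<gamma>))" by (simp add: \<tau>\<gamma>)
    also have "\<dots> \<le> C * (\<tau> powr (2 * \<gamma>) * \<tau> powr (real d - 2 * \<gamma>))"
    proof (intro mult_left_mono C0)
      show "B powr (real d - 2 * \<gamma>) \<le> \<tau> powr (real d - 2 * \<gamma>)"
        using \<gamma> \<tau>0 by (intro powr_mono2') (auto simp: B_def)
    qed simp
    also have "\<tau> powr (2 * \<gamma>) * \<tau> powr (real d - 2 * \<gamma>) = \<tau> powr real d" by (simp add: powr_add[symmetric])
    finally show ?thesis by (simp add: \<tau>d)
  qed
  have head: "(\<Sum>k | 1 \<le> k \<and> real k < B. g k) \<le> 2 * 2 ^ d * (c2 / lam) powr \<theta>"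
  proof (cases "\<tau> \<le> 1")
    case True
    then have "B = 1" by (simp add: B_def)
    then have "{k. 1 \<le> k \<and> real k < B} = {}" by auto
    then have "(\<Sum>k | 1 \<le> k \<and> real k < B. g k) = 0" by (simp only: sum.empty)
    then show ?thesis by simp
  next
    case False
    let ?N = "nat \<lfloor>\<tau>\<rfloor>"
    have B\<tau>: "B = \<tau>" using False by (simp add: B_def)
    have "(\<Sum>k | 1 \<le> k \<and> real k < B. g k) \<le> (\<Sum>k\<le>?N. g k)"
      using g0 by (intro sum_mono2) (auto simp: B\<tau> le_nat_floor)
    also have "\<dots> \<le> (\<Sum>k\<le>?N. real (Z k))"
    proof (rule sum_mono)
      fix k
      have "c k / (c k + lam) \<le> 1" using c(1)[of k] lam by simp
      from mult_right_mono[OF this, of "real (Z k)"] show "g k \<le> real (Z k)" by (simp add: g_def)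
    qed
    also have "\<dots> = real (\<Sum>k\<le>?N. Z k)" by simp
    also have "\<dots> \<le> real (2 * (?N + 1) ^ d)" using Z by (rule of_nat_mono)
    also have "\<dots> = 2 * (real ?N + 1) ^ d" by (simp add: add.commute)
    also have "\<dots> \<le> 2 * (2 * \<tau>) ^ d"
    proof (intro mult_left_mono power_mono)
      have "real ?N \<le> \<tau>" using \<tau>0 by (intro of_nat_floor) simp
      then show "real ?N + 1 \<le> 2 * \<tau>" using False by linarith
    qed auto
    also have "\<dots> = 2 * 2 ^ d * \<tau> powr real d" using \<tau>0 by (simp add: power_mult_distrib powr_realpow)
    finally show ?thesis by (simp add: \<tau>d)
  qed
  have fin: "finite {k. 1 \<le> k \<and> real k < B}"
  proof (rule finite_subset)
    show "{k. 1 \<le> k \<and> real k < B} \<subseteq> {..nat \<lceil>B\<rceil>}" by (auto simp: le_nat_iff ceiling_def) linarith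
  qed simp
  have "(\<Sum>k<n. g k) \<le> sum g ({0} \<union> {k. 1 \<le> k \<and> real k < B} \<union> {k. B \<le> real k \<and> k < n})"
    using fin g0 by (intro sum_mono2) auto
  also have "\<dots> = sum g ({0} \<union> {k. 1 \<le> k \<and> real k < B}) + (\<Sum>k | B \<le> real k \<and> k < n. g k)"
    using fin B by (intro sum.union_disjoint) auto
  also have "sum g ({0} \<union> {k. 1 \<le> k \<and> real k < B}) = g 0 + (\<Sum>k | 1 \<le> k \<and> real k < B. g k)"
    using fin by (subst sum.union_disjoint) auto
  finally have "(\<Sum>k<n. g k) \<le> 2 * (c0 / lam) powr \<theta> + 2 * 2 ^ d * (c2 / lam) powr \<theta> + C * (c2 / lam) powr \<theta>"
    using first head tail by linarith
  also have "\<dots> = (2 * c0 powr \<theta> + (2 * 2 ^ d + C) * c2 powr \<theta>) * lam powr - \<theta>"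
    using c0 c2 lam by (simp add: powr_divide powr_minus field_simps)
  finally show ?thesis by (simp add: g_def C_def \<theta>_def)
qed

section \<open>Quadratic forms in independent sub-Gaussian variables\<close>

text \<open>The use of this inequality is that the linear term has mean zero under a centred variable.\<close>

lemma exp_le_add_exp_square: "exp x \<le> x + exp (x\<^sup>2)" for x :: real
proof -
  have sq: "1 + x\<^sup>2 \<le> exp (x\<^sup>2)" by (rule exp_ge_add_one_self)
  consider "x > 1" | "0 \<le> x" "x \<le> 1" | "x < 0" by linarith
  then show ?thesis
  proof cases
    case 1
    then have "x \<le> x\<^sup>2" by (simp add: power2_eq_square)
    then have "exp x \<le> exp (x\<^sup>2)" by simp
    then show ?thesis using 1 by linarith
  next
    case 2
    then show ?thesis using exp_bound[of x] sq by linarith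
  next
    case 3
    define y where "y = - x"
    have y: "y > 0" "x = - y" using 3 by (simp_all add: y_def)
    have "1 \<le> (1 + y) * (1 - y + y\<^sup>2)"
      using y by (simp add: algebra_simps power2_eq_square power3_eq_cube)
    also have "\<dots> \<le> exp y * (1 - y + y\<^sup>2)"
    proof (rule mult_right_mono)
      have "0 \<le> (y - 1 / 2)\<^sup>2 + 3 / 4" by simp
      also have "\<dots> = 1 - y + y\<^sup>2" by (simp add: power2_eq_square field_simps)
      finally show "0 \<le> 1 - y + y\<^sup>2" .
    qed (rule exp_ge_add_one_self)
    finally have "exp (- y) \<le> 1 - y + y\<^sup>2" by (simp add: exp_minus field_simps)
    then have "exp x \<le> 1 + x + x\<^sup>2" using y by simp
    then show ?thesis using sq by linarith
  qed
qed

lemma exp_mult_le_convex: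
  fixes y t :: real
  assumes "0 \<le> t" "t \<le> 1"
  shows "exp (t * y) \<le> (1 - t) + t * exp y"
  using convex_onD[OF exp_convex, of t 0 y] assms by simp

lemma power_div_fact_le_exp:
  fixes y :: real
  assumes "0 \<le> y"
  shows "y ^ n / fact n \<le> exp y"
proof -
  have s: "(\<lambda>n. y ^ n / fact n) sums exp y"
    using exp_converges[of y] by (simp add: divide_inverse scaleR_conv_of_real mult.commute)
  have "sum (\<lambda>n. y ^ n / fact n) {n} \<le> (\<Sum>n. y ^ n / fact n)"
    using s assms by (intro sum_le_suminf) (auto simp: sums_iff)
  then show ?thesis using s by (simp add: sums_iff)
qed

lemma fact_double_le: "(fact (2 * n) :: real) \<le> 2 ^ n * real n ^ n * fact n"
proof -
  have "fact (2 * n) div fact (2 * n - n) \<le> (2 * n) ^ n"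
    by (rule fact_div_fact_le_pow) simp
  moreover have "fact n dvd (fact (2 * n) :: nat)" by (rule fact_dvd) simp
  ultimately have "(fact (2 * n) :: nat) \<le> (2 * n) ^ n * fact n"
    by (metis dvd_div_mult_self mult_le_mono1 mult_2 add_diff_cancel_left')
  then have "real (fact (2 * n)) \<le> real ((2 * n) ^ n * fact n)" by (rule of_nat_mono)
  then show ?thesis by (simp add: power_mult_distrib)
qed

text \<open>Expand \<open>exp (s * (X \<omega>)\<^sup>2)\<close> into its power series. The \<open>n\<close>-th term contains \<open>(X \<omega>) ^ (2 * n)\<close>, which the
  exponential functions with parameters \<open>sqrt n\<close> and \<open>- sqrt n\<close> dominate up to the factor \<open>fact (2 * n) / n ^ n\<close>. By the
  sub-Gaussian bound the integrals then decay geometrically once \<open>s\<close> is small compared with \<open>exp (- K)\<close>.\<close>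

lemma sub_gaussian_exp_square_finite:
  assumes "prob_space P" and sg: "sub_gaussian P X"
  shows "\<exists>s>0. (\<integral>\<^sup>+ \<omega>. ennreal (exp (s * (X \<omega>)\<^sup>2)) \<partial>P) < \<infinity>"
proof -
  interpret prob_space P by fact
  have X[measurable]: "X \<in> borel_measurable P" using sg by (auto simp: sub_gaussian_def)
  obtain K where K: "\<And>u. (\<integral>\<^sup>+ \<omega>. ennreal (exp (u * X \<omega>)) \<partial>P) \<le> ennreal (exp (K * u\<^sup>2))"
    using sg by (auto simp: sub_gaussian_def)
  \<comment> \<open>The value for which the geometric series at the end has ratio \<open>2 * s * exp K = 1 / 2\<close>.\<close>
  define s where "s = exp (- K) / 4"
  have s: "s > 0" by (simp add: s_def)
  have term_le: "(s * x\<^sup>2) ^ n / fact n \<le> (2 * s) ^ n * (exp (sqrt n * x) + exp (- sqrt n * x))" for x n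
  proof -
    let ?y = "\<bar>sqrt n * x\<bar>"
    have "?y ^ (2 * n) = real n ^ n * (x\<^sup>2) ^ n"
      by (simp add: power_mult power_mult_distrib abs_mult flip: power_abs)
    moreover have "?y ^ (2 * n) / fact (2 * n) \<le> exp ?y" by (rule power_div_fact_le_exp) simp
    ultimately have "real n ^ n * (x\<^sup>2) ^ n \<le> fact (2 * n) * exp ?y" by (simp add: field_simps)
    also have "\<dots> \<le> (2 ^ n * real n ^ n * fact n) * exp ?y"
      by (intro mult_right_mono fact_double_le) simp
    finally have "real n ^ n * ((x\<^sup>2) ^ n) \<le> real n ^ n * (2 ^ n * fact n * exp ?y)" by (simp add: mult_ac)
    then have "(x\<^sup>2) ^ n \<le> 2 ^ n * fact n * exp ?y" by (cases "n = 0") auto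
    also have "\<dots> \<le> 2 ^ n * fact n * (exp (sqrt n * x) + exp (- sqrt n * x))"
      by (intro mult_left_mono) (auto simp: abs_if)
    finally have "s ^ n * (x\<^sup>2) ^ n \<le> s ^ n * (2 ^ n * fact n * (exp (sqrt n * x) + exp (- sqrt n * x)))"
      using s by (intro mult_left_mono) auto
    then show ?thesis by (simp add: power_mult_distrib field_simps)
  qed
  have int_term: "(\<integral>\<^sup>+ \<omega>. ennreal ((s * (X \<omega>)\<^sup>2) ^ n / fact n) \<partial>P) \<le> ennreal (2 * (1 / 2) ^ n)" for n
  proof -
    have "(\<integral>\<^sup>+ \<omega>. ennreal ((s * (X \<omega>)\<^sup>2) ^ n / fact n) \<partial>P)
       \<le> (\<integral>\<^sup>+ \<omega>. ennreal ((2 * s) ^ n) * (ennreal (exp (sqrt n * X \<omega>)) + ennreal (exp (- sqrt n * X \<omega>))) \<partial>P)"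
    proof (rule nn_integral_mono)
      fix \<omega>
      let ?e1 = "exp (sqrt n * X \<omega>)" and ?e2 = "exp (- sqrt n * X \<omega>)"
      have "ennreal ((2 * s) ^ n * (?e1 + ?e2)) = ennreal ((2 * s) ^ n) * (ennreal ?e1 + ennreal ?e2)"
        using s by (subst ennreal_mult) auto
      then show "ennreal ((s * (X \<omega>)\<^sup>2) ^ n / fact n) \<le> ennreal ((2 * s) ^ n) * (ennreal ?e1 + ennreal ?e2)"
        using ennreal_leI[OF term_le[of "X \<omega>" n]] by simp
    qed
    also have "\<dots> = ennreal ((2 * s) ^ n) * ((\<integral>\<^sup>+ \<omega>. ennreal (exp (sqrt n * X \<omega>)) \<partial>P) + (\<integral>\<^sup>+ \<omega>. ennreal (exp (- sqrt n * X \<omega>)) \<partial>P))"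
      by (subst nn_integral_cmult) (simp_all add: nn_integral_add)
    also have "\<dots> \<le> ennreal ((2 * s) ^ n) * (ennreal (exp (K * real n)) + ennreal (exp (K * real n)))"
      using K[of "sqrt n"] K[of "- sqrt n"] by (intro mult_left_mono add_mono) auto
    also have "\<dots> = ennreal ((2 * s) ^ n * (2 * exp (K * real n)))"
      using s by (simp add: ennreal_mult'[symmetric] ennreal_plus[symmetric] del: ennreal_plus)
    also have "(2 * s) ^ n * (2 * exp (K * real n)) = 2 * (1 / 2) ^ n"
    proof -
      have "(2 * s) ^ n * exp (K * real n) = (2 * s * exp K) ^ n"
        by (simp add: power_mult_distrib exp_of_nat_mult mult.commute[of K])
      also have "2 * s * exp K = 1 / 2" by (simp add: s_def exp_minus)
      finally show ?thesis by simp
    qed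
    finally show ?thesis .
  qed
  have "(\<integral>\<^sup>+ \<omega>. ennreal (exp (s * (X \<omega>)\<^sup>2)) \<partial>P) = (\<integral>\<^sup>+ \<omega>. (\<Sum>n. ennreal ((s * (X \<omega>)\<^sup>2) ^ n / fact n)) \<partial>P)"
  proof (rule nn_integral_cong)
    fix \<omega>
    have "(\<lambda>n. (s * (X \<omega>)\<^sup>2) ^ n / fact n) sums exp (s * (X \<omega>)\<^sup>2)"
      using exp_converges[of "s * (X \<omega>)\<^sup>2"] by (simp add: divide_inverse scaleR_conv_of_real mult.commute)
    then show "ennreal (exp (s * (X \<omega>)\<^sup>2)) = (\<Sum>n. ennreal ((s * (X \<omega>)\<^sup>2) ^ n / fact n))"
      using s by (subst suminf_ennreal2) (auto simp: sums_iff)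
  qed
  also have "\<dots> = (\<Sum>n. \<integral>\<^sup>+ \<omega>. ennreal ((s * (X \<omega>)\<^sup>2) ^ n / fact n) \<partial>P)"
    by (rule nn_integral_suminf) measurable
  also have "\<dots> \<le> (\<Sum>n. ennreal (2 * (1 / 2) ^ n))"
    by (intro suminf_le int_term) auto
  also have "\<dots> = ennreal (\<Sum>n. 2 * (1 / 2) ^ n)"
    by (rule suminf_ennreal2) (auto intro!: summable_mult summable_geometric)
  also have "\<dots> < \<infinity>" by simp
  finally show ?thesis using s by blast
qed

text \<open>Convexity of \<open>exp\<close> on the segment from \<open>0\<close> to \<open>X \<omega>\<close>, integrated.\<close>

lemma nn_integral_exp_mult_le:
  assumes "prob_space P" and X[measurable]: "X \<in> borel_measurable P"
    and A: "(\<integral>\<^sup>+ \<omega>. ennreal (exp (X \<omega>)) \<partial>P) \<le> ennreal A" and t: "0 \<le> t" "t \<le> 1" "0 \<le> A"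
  shows "(\<integral>\<^sup>+ \<omega>. ennreal (exp (t * X \<omega>)) \<partial>P) \<le> ennreal (1 - t + t * A)"
proof -
  interpret prob_space P by fact
  have "(\<integral>\<^sup>+ \<omega>. ennreal (exp (t * X \<omega>)) \<partial>P) \<le> (\<integral>\<^sup>+ \<omega>. ennreal (1 - t) + ennreal t * ennreal (exp (X \<omega>)) \<partial>P)"
    using t exp_mult_le_convex[of t]
    by (intro nn_integral_mono) (simp add: ennreal_mult'[symmetric] ennreal_plus[symmetric] del: ennreal_plus)
  also have "\<dots> = ennreal (1 - t) + ennreal t * (\<integral>\<^sup>+ \<omega>. ennreal (exp (X \<omega>)) \<partial>P)"
    by (subst nn_integral_add) (auto simp: nn_integral_cmult emeasure_space_1)
  also have "\<dots> \<le> ennreal (1 - t) + ennreal t * ennreal A"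
    by (intro add_left_mono mult_left_mono A) auto
  also have "\<dots> = ennreal (1 - t + t * A)"
    using t by (simp add: ennreal_mult'[symmetric] ennreal_plus[symmetric] del: ennreal_plus)
  finally show ?thesis .
qed

text \<open>The set of which the norm is the infimum is not empty, because a finite exponential moment of the square
  can be pushed below \<open>2\<close> by shrinking its exponent; otherwise the infimum would carry no information. The bound passes
  to the infimum by Fatou's lemma.\<close>

lemma sub_gaussian_norm_attained:
  assumes "prob_space P" and sg: "sub_gaussian P X" and M: "sub_gaussian_norm P X = M" "M > 0"
  shows "(\<integral>\<^sup>+ \<omega>. ennreal (exp ((X \<omega>)\<^sup>2 / M\<^sup>2)) \<partial>P) \<le> 2"
proof -
  interpret prob_space P by fact
  have X[measurable]: "X \<in> borel_measurable P" using sg by (auto simp: sub_gaussian_def)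
  define S where "S = {t. 0 < t \<and> (\<integral>\<^sup>+ \<omega>. ennreal (exp ((X \<omega>)\<^sup>2 / t\<^sup>2)) \<partial>P) \<le> 2}"
  obtain s where s: "s > 0" "(\<integral>\<^sup>+ \<omega>. ennreal (exp (s * (X \<omega>)\<^sup>2)) \<partial>P) < \<infinity>"
    using sub_gaussian_exp_square_finite[OF assms(1) sg] by blast
  then obtain A where A: "A \<ge> 0" "(\<integral>\<^sup>+ \<omega>. ennreal (exp (s * (X \<omega>)\<^sup>2)) \<partial>P) = ennreal A"
    by (cases "\<integral>\<^sup>+ \<omega>. ennreal (exp (s * (X \<omega>)\<^sup>2)) \<partial>P") auto
  \<comment> \<open>By convexity the exponent scaled by \<open>t\<close> has moment at most \<open>1 - t + t * A\<close>.\<close>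
  define t where "t = 1 / (1 + A)"
  have t: "0 < t" "t \<le> 1" "t * A \<le> 1" using A(1) by (auto simp: t_def field_simps)
  have "(\<integral>\<^sup>+ \<omega>. ennreal (exp (t * (s * (X \<omega>)\<^sup>2))) \<partial>P) \<le> ennreal (1 - t + t * A)"
    by (rule nn_integral_exp_mult_le[OF assms(1)]) (use A t in auto)
  also have "\<dots> \<le> 2" using t ennreal_leI[of "1 - t + t * A" 2] by simp
  finally have "1 / sqrt (t * s) \<in> S"
    using t s by (simp add: S_def power_divide real_sqrt_pow2 mult_ac)
  then have ne: "S \<noteq> {}" by blast
  have M_Inf: "M = Inf S" using M(1) by (simp add: sub_gaussian_norm_def S_def)
  have mem: "r \<in> S" if Mr: "M < r" for r
  proof -
    obtain r' where r': "r' \<in> S" "r' < r" using cInf_lessD[OF ne, of r] Mr M_Inf by auto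
    have "(\<integral>\<^sup>+ \<omega>. ennreal (exp ((X \<omega>)\<^sup>2 / r\<^sup>2)) \<partial>P) \<le> (\<integral>\<^sup>+ \<omega>. ennreal (exp ((X \<omega>)\<^sup>2 / r'\<^sup>2)) \<partial>P)"
    proof (intro nn_integral_mono ennreal_leI)
      fix \<omega>
      have "r'\<^sup>2 \<le> r\<^sup>2" "0 < r'\<^sup>2 * r\<^sup>2" using r' Mr M(2) by (auto simp: S_def intro!: power_mono)
      then have "(X \<omega>)\<^sup>2 / r\<^sup>2 \<le> (X \<omega>)\<^sup>2 / r'\<^sup>2"
        by (intro divide_left_mono) (auto simp: mult.commute)
      then show "exp ((X \<omega>)\<^sup>2 / r\<^sup>2) \<le> exp ((X \<omega>)\<^sup>2 / r'\<^sup>2)" by simp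
    qed
    then show ?thesis using r' Mr M(2) by (auto simp: S_def)
  qed
  define r where "r n = M + 1 / real (Suc n)" for n
  have r: "r \<longlonglongrightarrow> M"
    unfolding r_def using tendsto_add[OF tendsto_const LIMSEQ_Suc[OF lim_1_over_n], of M] by simp
  have rS: "r n \<in> S" for n by (rule mem) (simp add: r_def)
  have "(\<integral>\<^sup>+ \<omega>. ennreal (exp ((X \<omega>)\<^sup>2 / M\<^sup>2)) \<partial>P) = (\<integral>\<^sup>+ \<omega>. liminf (\<lambda>n. ennreal (exp ((X \<omega>)\<^sup>2 / (r n)\<^sup>2))) \<partial>P)"
  proof (rule nn_integral_cong)
    fix \<omega>
    have "(\<lambda>n. ennreal (exp ((X \<omega>)\<^sup>2 / (r n)\<^sup>2))) \<longlonglongrightarrow> ennreal (exp ((X \<omega>)\<^sup>2 / M\<^sup>2))"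
      using M(2) by (intro tendsto_intros r) auto
    then show "ennreal (exp ((X \<omega>)\<^sup>2 / M\<^sup>2)) = liminf (\<lambda>n. ennreal (exp ((X \<omega>)\<^sup>2 / (r n)\<^sup>2)))"
      using lim_imp_Liminf by (metis trivial_limit_sequentially)
  qed
  also have "\<dots> \<le> liminf (\<lambda>n. \<integral>\<^sup>+ \<omega>. ennreal (exp ((X \<omega>)\<^sup>2 / (r n)\<^sup>2)) \<partial>P)"
    by (rule nn_integral_liminf) measurable
  also have "\<dots> \<le> liminf (\<lambda>n. 2)"
    using rS by (intro Liminf_mono) (auto simp: S_def)
  also have "\<dots> = 2" by (simp add: Liminf_const)
  finally show ?thesis .
qed

text \<open>For \<open>M\<^sup>2 * u\<^sup>2 \<le> 1\<close> use \<open>exp_le_add_exp_square\<close> and the vanishing mean. For larger \<open>u\<close> the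
  inequality \<open>u * x \<le> (M\<^sup>2 * u\<^sup>2 + x\<^sup>2 / M\<^sup>2) / 2\<close> is sharp enough, as the remaining factor
  \<open>exp (1 / 2)\<close> is then at most \<open>exp (M\<^sup>2 * u\<^sup>2 / 2)\<close>.\<close>

lemma sub_gaussian_mgf_bound:
  assumes "prob_space P" and sg: "sub_gaussian P X" and M: "sub_gaussian_norm P X = M" "M > 0"
  shows "(\<integral>\<^sup>+ \<omega>. ennreal (exp (u * X \<omega>)) \<partial>P) \<le> ennreal (exp (M\<^sup>2 * u\<^sup>2))"
proof -
  interpret prob_space P by fact
  have X[measurable]: "X \<in> borel_measurable P" and Xi: "integrable P X" "(LINT \<omega>|P. X \<omega>) = 0"
    using sg by (auto simp: sub_gaussian_def)
  define t where "t = M\<^sup>2 * u\<^sup>2"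
  have t0: "t \<ge> 0" by (simp add: t_def)
  note E2 = sub_gaussian_norm_attained[OF assms]
  have half: "(\<integral>\<^sup>+ \<omega>. ennreal (exp (a * ((X \<omega>)\<^sup>2 / M\<^sup>2))) \<partial>P) \<le> ennreal (exp a)" if "0 \<le> a" "a \<le> 1" for a
  proof -
    have "(\<integral>\<^sup>+ \<omega>. ennreal (exp (a * ((X \<omega>)\<^sup>2 / M\<^sup>2))) \<partial>P) \<le> ennreal (1 - a + a * 2)"
      by (rule nn_integral_exp_mult_le[OF assms(1)]) (use E2 that in auto)
    also have "\<dots> \<le> ennreal (exp a)" using exp_ge_add_one_self[of a] by (intro ennreal_leI) linarith
    finally show ?thesis .
  qed
  show ?thesis
  proof (cases "t \<le> 1")
    case True
    let ?Y = "\<lambda>\<omega>. exp (t * ((X \<omega>)\<^sup>2 / M\<^sup>2))"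
    have eq: "t * ((X \<omega>)\<^sup>2 / M\<^sup>2) = (u * X \<omega>)\<^sup>2" for \<omega>
      using M(2) by (simp add: t_def power_mult_distrib)
    have Yi: "integrable P ?Y"
      using half[OF t0 True] by (intro integrableI_bounded) (auto simp: less_top[symmetric] top_unique)
    have le: "exp (u * X \<omega>) \<le> u * X \<omega> + ?Y \<omega>" for \<omega>
      using exp_le_add_exp_square[of "u * X \<omega>"] unfolding eq .
    have "norm (exp (u * X \<omega>)) \<le> norm (u * X \<omega> + ?Y \<omega>)" for \<omega>
      using le[of \<omega>] by (simp only: real_norm_def abs_exp_cancel)
    then have dom: "AE \<omega> in P. norm (exp (u * X \<omega>)) \<le> norm (u * X \<omega> + ?Y \<omega>)" by (rule AE_I2)
    have ei: "integrable P (\<lambda>\<omega>. exp (u * X \<omega>))"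
    proof (rule Bochner_Integration.integrable_bound[OF _ _ dom])
      show "integrable P (\<lambda>\<omega>. u * X \<omega> + ?Y \<omega>)"
        by (rule Bochner_Integration.integrable_add[OF integrable_mult_right[OF Xi(1)] Yi])
      show "(\<lambda>\<omega>. exp (u * X \<omega>)) \<in> borel_measurable P" by measurable
    qed
    have "(LINT \<omega>|P. exp (u * X \<omega>)) \<le> (LINT \<omega>|P. u * X \<omega> + ?Y \<omega>)"
      using ei Xi Yi le by (intro integral_mono) auto
    also have "\<dots> = (LINT \<omega>|P. ?Y \<omega>)" using Xi Yi by simp
    also have "\<dots> \<le> exp t"
      using half[OF t0 True] nn_integral_eq_integral[OF Yi] by (simp add: ennreal_le_iff)
    finally show ?thesis
      using nn_integral_eq_integral[OF ei] by (simp add: t_def ennreal_leI)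
  next
    case False
    have "u * x \<le> t / 2 + 1 / 2 * (x\<^sup>2 / M\<^sup>2)" for x
    proof -
      have "0 \<le> (M * u - x / M)\<^sup>2" by simp
      also have "\<dots> = t - 2 * (u * x) + x\<^sup>2 / M\<^sup>2"
        using M(2) by (simp add: power2_diff t_def power_mult_distrib power_divide)
      finally show ?thesis by simp
    qed
    then have "(\<integral>\<^sup>+ \<omega>. ennreal (exp (u * X \<omega>)) \<partial>P)
        \<le> (\<integral>\<^sup>+ \<omega>. ennreal (exp (t / 2)) * ennreal (exp (1 / 2 * ((X \<omega>)\<^sup>2 / M\<^sup>2))) \<partial>P)"
      by (intro nn_integral_mono) (simp add: ennreal_mult'[symmetric] exp_add[symmetric])
    also have "\<dots> = ennreal (exp (t / 2)) * (\<integral>\<^sup>+ \<omega>. ennreal (exp (1 / 2 * ((X \<omega>)\<^sup>2 / M\<^sup>2))) \<partial>P)"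
      by (rule nn_integral_cmult) measurable
    also have "\<dots> \<le> ennreal (exp (t / 2)) * ennreal (exp (1 / 2))"
      by (intro mult_left_mono half) auto
    also have "\<dots> \<le> ennreal (exp t)"
      using False by (simp add: ennreal_mult'[symmetric] exp_add[symmetric] ennreal_leI)
    finally show ?thesis by (simp add: t_def)
  qed
qed

definition quad_form :: "('i \<Rightarrow> 'i \<Rightarrow> real) \<Rightarrow> 'i set \<Rightarrow> ('i \<Rightarrow> real) \<Rightarrow> real" where
  "quad_form Q I e = (\<Sum>i\<in>I. \<Sum>j\<in>I. e i * e j * Q i j)"

lemma quad_form_insert:
  assumes "finite I" "i \<notin> I" and sym: "\<And>i j. Q i j = Q j i"
  shows "quad_form Q (insert i I) (e(i := y))
       = quad_form Q I e + 2 * y * (\<Sum>j\<in>I. e j * Q i j) + y\<^sup>2 * Q i i"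
proof -
  let ?e = "e(i := y)"
  have e: "?e j = e j" if "j \<in> I" for j using that assms(2) by auto
  have row: "(\<Sum>j\<in>insert i I. ?e k * ?e j * Q k j) = ?e k * (y * Q k i + (\<Sum>j\<in>I. e j * Q k j))" for k
  proof -
    have "(\<Sum>j\<in>insert i I. ?e k * ?e j * Q k j) = ?e k * ?e i * Q k i + (\<Sum>j\<in>I. ?e k * ?e j * Q k j)"
      using assms(1,2) by (rule sum.insert)
    also have "(\<Sum>j\<in>I. ?e k * ?e j * Q k j) = ?e k * (\<Sum>j\<in>I. e j * Q k j)"
      unfolding sum_distrib_left by (intro sum.cong refl) (simp only: e mult.assoc)
    finally show ?thesis by (simp add: algebra_simps)
  qed
  have "quad_form Q (insert i I) ?e
      = y * (y * Q i i + (\<Sum>j\<in>I. e j * Q i j)) + (\<Sum>k\<in>I. ?e k * (y * Q k i + (\<Sum>j\<in>I. e j * Q k j)))"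
    unfolding quad_form_def row by (subst sum.insert[OF assms(1,2)]) simp
  also have "(\<Sum>k\<in>I. ?e k * (y * Q k i + (\<Sum>j\<in>I. e j * Q k j)))
     = y * (\<Sum>k\<in>I. e k * Q i k) + quad_form Q I e"
  proof -
    have "(\<Sum>k\<in>I. ?e k * (y * Q k i + (\<Sum>j\<in>I. e j * Q k j)))
        = (\<Sum>k\<in>I. y * (e k * Q i k) + (\<Sum>j\<in>I. e k * e j * Q k j))"
    proof (intro sum.cong refl)
      fix k assume "k \<in> I"
      show "?e k * (y * Q k i + (\<Sum>j\<in>I. e j * Q k j)) = y * (e k * Q i k) + (\<Sum>j\<in>I. e k * e j * Q k j)"
        unfolding e[OF \<open>k \<in> I\<close>] sym[of i k] by (simp add: algebra_simps sum_distrib_left)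
    qed
    then show ?thesis by (simp add: quad_form_def sum.distrib sum_distrib_left)
  qed
  finally show ?thesis
    by (rule trans) (simp add: algebra_simps power2_eq_square)
qed

text \<open>As a function of the entry at \<open>i\<close>, the form on \<open>insert i I\<close> is a nonnegative quadratic polynomial, so its
  discriminant is not positive.\<close>

lemma quad_form_Cauchy_Schwarz:
  assumes "finite I" "i \<notin> I" and sym: "\<And>i j. Q i j = Q j i"
    and psd: "\<And>e. 0 \<le> quad_form Q (insert i I) e"
  shows "(\<Sum>j\<in>I. e j * Q i j)\<^sup>2 \<le> quad_form Q I e * Q i i" and "0 \<le> Q i i" and "0 \<le> quad_form Q I e"
proof -
  define a b q where "a = (\<Sum>j\<in>I. e j * Q i j)" and "b = Q i i" and "q = quad_form Q I e"
  have pos: "0 \<le> q + 2 * y * a + y\<^sup>2 * b" for y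
    using psd[of "e(i := y)"] quad_form_insert[OF assms(1,2) sym, where e = e and y = y] by (simp add: a_def b_def q_def)
  have "0 \<le> 0 + 2 * 1 * (\<Sum>j\<in>I. 0 * Q i j) + 1\<^sup>2 * b"
    using psd[of "(\<lambda>_. 0)(i := 1)"] quad_form_insert[OF assms(1,2) sym, where e = "\<lambda>_. 0" and y = 1]
    by (simp add: b_def quad_form_def)
  then have b0: "0 \<le> b" by simp
  have q0: "0 \<le> q" using pos[of 0] by simp
  have "a\<^sup>2 \<le> q * b"
  proof (cases "b = 0")
    case True
    have "a = 0"
    proof (rule ccontr)
      assume "a \<noteq> 0"
      then show False using pos[of "- (q + 1) / (2 * a)"] True by (simp add: field_simps)
    qed
    then show ?thesis using True by simp
  next
    case False
    then have "0 \<le> q - a\<^sup>2 / b" using pos[of "- a / b"] by (simp add: power2_eq_square field_simps)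
    then show ?thesis using b0 False by (simp add: field_simps)
  qed
  then show "(\<Sum>j\<in>I. e j * Q i j)\<^sup>2 \<le> quad_form Q I e * Q i i" and "0 \<le> Q i i" and "0 \<le> quad_form Q I e"
    using b0 q0 by (simp_all add: a_def b_def q_def)
qed

text \<open>The linear and the quadratic part of the exponent are separated by
  \<open>2 * X * Y \<le> t * X\<^sup>2 + Y\<^sup>2 / t\<close> with the weight \<open>t\<close> for which both terms have the same bound.\<close>

lemma nn_integral_exp_quadratic_step:
  fixes N :: "real measure"
  assumes N: "prob_space N" "sets N = sets borel"
    and mgf: "\<And>u. (\<integral>\<^sup>+ y. ennreal (exp (u * y)) \<partial>N) \<le> ennreal (exp (M\<^sup>2 * u\<^sup>2))"
    and sq: "(\<integral>\<^sup>+ y. ennreal (exp (y\<^sup>2 / M\<^sup>2)) \<partial>N) \<le> 2"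
    and s: "0 \<le> s" "0 \<le> b" "2 * s * b * M\<^sup>2 \<le> 1" and M: "M > 0"
  shows "(\<integral>\<^sup>+ y. ennreal (exp (s * (2 * y * a + y\<^sup>2 * b))) \<partial>N) \<le> ennreal (exp (8 * M\<^sup>2 * s\<^sup>2 * a\<^sup>2 + s * b * M\<^sup>2))"
proof -
  interpret prob_space N by fact
  note N(2)[measurable_cong]
  define \<alpha> \<beta> where "\<alpha> = 16 * M\<^sup>2 * s\<^sup>2 * a\<^sup>2" and "\<beta> = 2 * s * b * M\<^sup>2"
  have \<beta>: "0 \<le> \<beta>" "\<beta> \<le> 1" using s by (auto simp: \<beta>_def)
  \<comment> \<open>The weight is \<open>exp t\<close>; it balances the bounds \<open>exp \<alpha>\<close> and \<open>exp \<beta>\<close> of the two terms.\<close>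
  define t where "t = (\<beta> - \<alpha>) / 2"
  have am_gm: "exp (s * (2 * y * a + y\<^sup>2 * b))
      \<le> exp t / 2 * exp (4 * s * a * y) + exp (- t) / 2 * exp (\<beta> * (y\<^sup>2 / M\<^sup>2))" for y
  proof -
    let ?X = "exp (t / 2 + 2 * s * a * y)" and ?Y = "exp (- t / 2 + s * b * y\<^sup>2)"
    have "0 \<le> (?X - ?Y)\<^sup>2" by simp
    also have "\<dots> = ?X\<^sup>2 + ?Y\<^sup>2 - 2 * (?X * ?Y)" by (simp add: power2_diff)
    also have "?X\<^sup>2 = exp t * exp (4 * s * a * y)"
      by (simp add: exp_double[symmetric] exp_add[symmetric] algebra_simps)
    also have "?Y\<^sup>2 = exp (- t) * exp (\<beta> * (y\<^sup>2 / M\<^sup>2))"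
      using M by (simp add: exp_double[symmetric] exp_add[symmetric] \<beta>_def algebra_simps)
    also have "?X * ?Y = exp (s * (2 * y * a + y\<^sup>2 * b))"
      by (simp add: exp_add[symmetric] algebra_simps)
    finally show ?thesis by simp
  qed
  have E1: "(\<integral>\<^sup>+ y. ennreal (exp (4 * s * a * y)) \<partial>N) \<le> ennreal (exp \<alpha>)"
    using mgf[of "4 * s * a"] by (simp add: \<alpha>_def power_mult_distrib mult_ac)
  have "(\<integral>\<^sup>+ y. ennreal (exp (\<beta> * (y\<^sup>2 / M\<^sup>2))) \<partial>N) \<le> ennreal (1 - \<beta> + \<beta> * 2)"
    by (rule nn_integral_exp_mult_le[OF N(1)]) (use \<beta> sq in auto)
  also have "\<dots> \<le> ennreal (exp \<beta>)" using exp_ge_add_one_self[of \<beta>] by (intro ennreal_leI) linarith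
  finally have E2: "(\<integral>\<^sup>+ y. ennreal (exp (\<beta> * (y\<^sup>2 / M\<^sup>2))) \<partial>N) \<le> ennreal (exp \<beta>)" .
  have "(\<integral>\<^sup>+ y. ennreal (exp (s * (2 * y * a + y\<^sup>2 * b))) \<partial>N)
     \<le> (\<integral>\<^sup>+ y. ennreal (exp t / 2) * ennreal (exp (4 * s * a * y)) + ennreal (exp (- t) / 2) * ennreal (exp (\<beta> * (y\<^sup>2 / M\<^sup>2))) \<partial>N)"
    using am_gm by (intro nn_integral_mono) (simp add: ennreal_mult'[symmetric] ennreal_plus[symmetric] del: ennreal_plus)
  also have "\<dots> = ennreal (exp t / 2) * (\<integral>\<^sup>+ y. ennreal (exp (4 * s * a * y)) \<partial>N)
     + ennreal (exp (- t) / 2) * (\<integral>\<^sup>+ y. ennreal (exp (\<beta> * (y\<^sup>2 / M\<^sup>2))) \<partial>N)"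
    by (subst nn_integral_add) (auto simp: nn_integral_cmult)
  also have "\<dots> \<le> ennreal (exp t / 2) * ennreal (exp \<alpha>) + ennreal (exp (- t) / 2) * ennreal (exp \<beta>)"
    by (intro add_mono mult_left_mono E1 E2) auto
  also have "\<dots> = ennreal (exp ((\<alpha> + \<beta>) / 2))"
  proof -
    have "exp t * exp \<alpha> = exp ((\<alpha> + \<beta>) / 2)" "exp (- t) * exp \<beta> = exp ((\<alpha> + \<beta>) / 2)"
      by (simp_all add: exp_add[symmetric] t_def field_simps)
    then show ?thesis
      by (simp add: ennreal_mult'[symmetric] ennreal_plus[symmetric] del: ennreal_plus)
  qed
  also have "(\<alpha> + \<beta>) / 2 = 8 * M\<^sup>2 * s\<^sup>2 * a\<^sup>2 + s * b * M\<^sup>2" by (simp add: \<alpha>_def \<beta>_def)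
  finally show ?thesis .
qed

text \<open>Integrating out one variable with diagonal entry \<open>b\<close> turns the coefficient \<open>s\<close> of the form in the
  exponent into at most \<open>s + 8 * M\<^sup>2 * s\<^sup>2 * b\<close>, by the Cauchy-Schwarz inequality for the form, and costs a factor
  \<open>exp (s * b * M\<^sup>2)\<close>. The reciprocals of the coefficients \<open>1 / (A + 8 * M\<^sup>2 * S)\<close>, with \<open>S\<close> the trace over the remaining
  variables, drop by exactly \<open>8 * M\<^sup>2 * b\<close> in each step, which absorbs this growth.\<close>

lemma nn_integral_exp_quad_form_PiM:
  fixes N :: "'i \<Rightarrow> real measure"
  assumes N: "\<And>i. prob_space (N i)" "\<And>i. sets (N i) = sets borel"
    and M: "M > 0" and A: "A > 0" and sym: "\<And>i j. Q i j = Q j i"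
    and I: "finite I"
    and mgf: "\<And>i u. i \<in> I \<Longrightarrow> (\<integral>\<^sup>+ y. ennreal (exp (u * y)) \<partial>N i) \<le> ennreal (exp (M\<^sup>2 * u\<^sup>2))"
    and sq: "\<And>i. i \<in> I \<Longrightarrow> (\<integral>\<^sup>+ y. ennreal (exp (y\<^sup>2 / M\<^sup>2)) \<partial>N i) \<le> 2"
    and psd: "\<And>J e. J \<subseteq> I \<Longrightarrow> 0 \<le> quad_form Q J e"
    and diag: "\<And>i. i \<in> I \<Longrightarrow> 2 * M\<^sup>2 * Q i i \<le> A"
  shows "(\<integral>\<^sup>+ x. ennreal (exp (quad_form Q I x / (A + 8 * M\<^sup>2 * (\<Sum>i\<in>I. Q i i)))) \<partial>PiM I N)
      \<le> ennreal (exp (M\<^sup>2 * (\<Sum>i\<in>I. Q i i) / A))"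
  using I mgf sq psd diag
proof (induction I rule: finite_induct)
  case empty
  then show ?case by (simp add: PiM_empty quad_form_def nn_integral_count_space_finite)
next
  case (insert i I)
  interpret product_sigma_finite N
    by (simp add: product_sigma_finite_def prob_space_imp_sigma_finite N(1))
  define S where "S = (\<Sum>i\<in>I. Q i i)"
  define b where "b = Q i i"
  \<comment> \<open>The coefficients of the form after and before adding the variable \<open>i\<close>.\<close>
  define s s' where "s = 1 / (A + 8 * M\<^sup>2 * (b + S))" and "s' = 1 / (A + 8 * M\<^sup>2 * S)"
  note CS = quad_form_Cauchy_Schwarz[OF insert.hyps sym insert.prems(3)[OF order_refl]]
  have b0: "0 \<le> b" unfolding b_def by (rule CS(2))
  have "0 \<le> Q j j" if "j \<in> I" for j
    using insert.prems(3)[of "{j}" "\<lambda>_. 1"] that by (simp add: quad_form_def)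
  then have S0: "0 \<le> S" unfolding S_def by (rule sum_nonneg)
  have den: "A + 8 * M\<^sup>2 * S > 0" "A + 8 * M\<^sup>2 * (b + S) > 0" "A + 8 * M\<^sup>2 * (b + S) \<ge> A"
    using A b0 S0 by (auto intro!: add_pos_nonneg)
  have s0: "0 < s" "0 < s'" "s \<le> 1 / A"
    unfolding s_def s'_def
    by (rule divide_pos_pos[OF zero_less_one den(2)], rule divide_pos_pos[OF zero_less_one den(1)],
        rule divide_left_mono[OF den(3) _ mult_pos_pos[OF den(2) A]]) simp
  have s_step: "s + 8 * M\<^sup>2 * s\<^sup>2 * b \<le> s'"
  proof -
    have "s' - s = s * s' * (8 * M\<^sup>2 * b)" using den by (simp add: s_def s'_def field_simps)
    moreover have "8 * M\<^sup>2 * S \<le> 8 * M\<^sup>2 * (b + S)" using b0 by (intro mult_left_mono) auto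
    then have "s \<le> s'" unfolding s_def s'_def using den by (intro divide_left_mono mult_pos_pos) auto
    then have "s * s * (8 * M\<^sup>2 * b) \<le> s * s' * (8 * M\<^sup>2 * b)"
      using s0 b0 by (intro mult_right_mono mult_left_mono) auto
    ultimately show ?thesis by (simp add: power2_eq_square algebra_simps)
  qed
  have cond: "2 * s * b * M\<^sup>2 \<le> 1"
  proof -
    have "2 * s * b * M\<^sup>2 = s * (2 * M\<^sup>2 * b)" by simp
    also have "\<dots> \<le> 1 / A * A"
      using s0 insert.prems(4)[of i] b0 A by (intro mult_mono) (auto simp: b_def)
    finally show ?thesis using A by simp
  qed
  have sb: "s * b * M\<^sup>2 \<le> M\<^sup>2 * b / A"
  proof -
    have "s * (b * M\<^sup>2) \<le> 1 / A * (b * M\<^sup>2)" using s0(3) b0 by (intro mult_right_mono) auto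
    then show ?thesis by (simp add: mult_ac)
  qed
  have [measurable_cong]: "sets (N j) = sets borel" for j by (rule N(2))
  have meas: "(\<lambda>x. ennreal (exp (quad_form Q J x / c))) \<in> borel_measurable (PiM J N)" for J c
    unfolding quad_form_def by measurable
  have "(\<integral>\<^sup>+ x. ennreal (exp (quad_form Q (insert i I) x / (A + 8 * M\<^sup>2 * (\<Sum>i\<in>insert i I. Q i i)))) \<partial>PiM (insert i I) N)
      = (\<integral>\<^sup>+ x. ennreal (exp (s * quad_form Q (insert i I) x)) \<partial>PiM (insert i I) N)"
    using insert.hyps by (simp add: s_def b_def S_def)
  also have "\<dots> = (\<integral>\<^sup>+ x. (\<integral>\<^sup>+ y. ennreal (exp (s * quad_form Q (insert i I) (x(i := y)))) \<partial>N i) \<partial>PiM I N)"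
    using meas[of "insert i I" "1 / s"] insert.hyps by (intro product_nn_integral_insert) (auto simp: mult.commute)
  also have "\<dots> \<le> (\<integral>\<^sup>+ x. ennreal (exp (M\<^sup>2 * b / A)) * ennreal (exp (quad_form Q I x / (A + 8 * M\<^sup>2 * S))) \<partial>PiM I N)"
  proof (rule nn_integral_mono)
    fix x
    define a where "a = (\<Sum>j\<in>I. x j * Q i j)"
    define q where "q = quad_form Q I x"
    have CSx: "a\<^sup>2 \<le> q * b" "0 \<le> q" unfolding a_def q_def b_def by (rule CS(1), rule CS(3))
    have "(\<integral>\<^sup>+ y. ennreal (exp (s * quad_form Q (insert i I) (x(i := y)))) \<partial>N i)
        = (\<integral>\<^sup>+ y. ennreal (exp (s * q)) * ennreal (exp (s * (2 * y * a + y\<^sup>2 * b))) \<partial>N i)"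
      unfolding quad_form_insert[OF insert.hyps sym] a_def[symmetric] b_def[symmetric] q_def[symmetric]
      by (intro nn_integral_cong) (simp add: ennreal_mult'[symmetric] exp_add[symmetric] algebra_simps)
    also have "\<dots> = ennreal (exp (s * q)) * (\<integral>\<^sup>+ y. ennreal (exp (s * (2 * y * a + y\<^sup>2 * b))) \<partial>N i)"
      by (rule nn_integral_cmult) measurable
    also have "\<dots> \<le> ennreal (exp (s * q)) * ennreal (exp (8 * M\<^sup>2 * s\<^sup>2 * a\<^sup>2 + s * b * M\<^sup>2))"
      using s0 b0 cond M insert.prems(1,2)
      by (intro mult_left_mono nn_integral_exp_quadratic_step N) auto
    also have "\<dots> = ennreal (exp (s * q + (8 * M\<^sup>2 * s\<^sup>2 * a\<^sup>2 + s * b * M\<^sup>2)))"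
      by (simp add: ennreal_mult'[symmetric] exp_add[symmetric])
    also have "\<dots> \<le> ennreal (exp (M\<^sup>2 * b / A + s' * q))"
    proof -
      have "8 * M\<^sup>2 * s\<^sup>2 * a\<^sup>2 \<le> 8 * M\<^sup>2 * s\<^sup>2 * (q * b)" using CSx(1) by (intro mult_left_mono) auto
      moreover have "(s + 8 * M\<^sup>2 * s\<^sup>2 * b) * q \<le> s' * q" using s_step CSx(2) by (rule mult_right_mono)
      ultimately have "s * q + (8 * M\<^sup>2 * s\<^sup>2 * a\<^sup>2 + s * b * M\<^sup>2) \<le> M\<^sup>2 * b / A + s' * q"
        using sb by (simp add: algebra_simps)
      then show ?thesis by (intro ennreal_leI) simp
    qed
    also have "\<dots> = ennreal (exp (M\<^sup>2 * b / A)) * ennreal (exp (q / (A + 8 * M\<^sup>2 * S)))"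
      by (simp add: ennreal_mult'[symmetric] exp_add[symmetric] s'_def)
    finally show "(\<integral>\<^sup>+ y. ennreal (exp (s * quad_form Q (insert i I) (x(i := y)))) \<partial>N i)
        \<le> ennreal (exp (M\<^sup>2 * b / A)) * ennreal (exp (quad_form Q I x / (A + 8 * M\<^sup>2 * S)))"
      by (simp add: q_def)
  qed
  also have "\<dots> = ennreal (exp (M\<^sup>2 * b / A)) * (\<integral>\<^sup>+ x. ennreal (exp (quad_form Q I x / (A + 8 * M\<^sup>2 * S))) \<partial>PiM I N)"
    by (rule nn_integral_cmult) (rule meas)
  also have "\<dots> \<le> ennreal (exp (M\<^sup>2 * b / A)) * ennreal (exp (M\<^sup>2 * S / A))"
  proof (rule mult_left_mono)
    show "(\<integral>\<^sup>+ x. ennreal (exp (quad_form Q I x / (A + 8 * M\<^sup>2 * S))) \<partial>PiM I N) \<le> ennreal (exp (M\<^sup>2 * S / A))"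
      unfolding S_def
      by (rule insert.IH) (blast intro: insert.prems(1) insert.prems(2) insert.prems(3) insert.prems(4))+
  qed simp
  also have "\<dots> = ennreal (exp (M\<^sup>2 * (\<Sum>i\<in>insert i I. Q i i) / A))"
    using insert.hyps by (simp add: ennreal_mult'[symmetric] exp_add[symmetric] b_def S_def algebra_simps add_divide_distrib)
  finally show ?case .
qed

text \<open>Markov's inequality for the exponential of the form. A diagonal entry is at most the trace, so
  \<open>A = 2 * M\<^sup>2 * V\<close> is admissible in the previous lemma. It bounds the exponential moment by \<open>exp (1 / 2)\<close>
  and leads to the constant \<open>10 = 2 + 8\<close>.\<close>

theorem sub_gaussian_quad_form_tail:
  fixes \<epsilon> :: "'i \<Rightarrow> 'w \<Rightarrow> real"
  assumes P: "prob_space P" and ind: "prob_space.indep_vars P (\<lambda>_. borel) \<epsilon> I"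
    and I: "finite I" "I \<noteq> {}" and M: "M > 0"
    and sg: "\<And>i. i \<in> I \<Longrightarrow> sub_gaussian P (\<epsilon> i)" "\<And>i. i \<in> I \<Longrightarrow> sub_gaussian_norm P (\<epsilon> i) = M"
    and sym: "\<And>i j. Q i j = Q j i" and psd: "\<And>J e. J \<subseteq> I \<Longrightarrow> 0 \<le> quad_form Q J e"
    and V: "(\<Sum>i\<in>I. Q i i) \<le> V" "0 < V"
  shows "measure P {\<omega> \<in> space P. quad_form Q I (\<lambda>i. \<epsilon> i \<omega>) > 10 * M\<^sup>2 * V * L} \<le> exp (1 / 2 - L)"
proof -
  interpret prob_space P by fact
  have m[measurable]: "\<epsilon> i \<in> borel_measurable P" if "i \<in> I" for i
    using sg(1)[OF that] by (auto simp: sub_gaussian_def)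
  \<comment> \<open>Outside \<open>I\<close> any probability measure will do; the product needs one for every index.\<close>
  define N where "N i = (if i \<in> I then distr P borel (\<epsilon> i) else return borel 0)" for i
  have N: "prob_space (N i)" "sets (N i) = sets borel" for i
    using m by (auto simp: N_def intro!: prob_space_distr prob_space_return)
  define A where "A = 2 * M\<^sup>2 * V"
  define S where "S = (\<Sum>i\<in>I. Q i i)"
  have Q0: "0 \<le> Q j j" if "j \<in> I" for j
    using psd[of "{j}" "\<lambda>_. 1"] that by (simp add: quad_form_def)
  have S: "0 \<le> S" "S \<le> V" using V Q0 by (auto simp: S_def intro: sum_nonneg)
  have A: "A > 0" using M V by (simp add: A_def)
  have diag: "2 * M\<^sup>2 * Q i i \<le> A" if "i \<in> I" for i
  proof -
    have "Q i i \<le> S" unfolding S_def using that I(1) Q0 by (intro member_le_sum) auto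
    then show ?thesis using S unfolding A_def by (intro mult_left_mono) auto
  qed
  have [measurable_cong]: "sets (N j) = sets borel" for j by (rule N(2))
  let ?c = "A + 8 * M\<^sup>2 * S"
  have meas: "(\<lambda>x. ennreal (exp (quad_form Q I x / c))) \<in> borel_measurable (PiM I (\<lambda>_. borel))" for c
    unfolding quad_form_def by measurable
  have qm[measurable]: "(\<lambda>\<omega>. quad_form Q I (\<lambda>i. \<epsilon> i \<omega>)) \<in> borel_measurable P"
    unfolding quad_form_def by (intro borel_measurable_sum borel_measurable_times m) auto
  have "(\<integral>\<^sup>+ x. ennreal (exp (quad_form Q I x / ?c)) \<partial>PiM I N) \<le> ennreal (exp (M\<^sup>2 * S / A))"
    unfolding S_def
  proof (rule nn_integral_exp_quad_form_PiM[OF N M A sym I(1) _ _ psd diag])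
    fix i u assume i: "i \<in> I"
    note [measurable] = m[OF i]
    show "(\<integral>\<^sup>+ y. ennreal (exp (u * y)) \<partial>N i) \<le> ennreal (exp (M\<^sup>2 * u\<^sup>2))"
      using sub_gaussian_mgf_bound[OF P sg[OF i] M] i by (simp add: N_def nn_integral_distr)
    show "(\<integral>\<^sup>+ y. ennreal (exp (y\<^sup>2 / M\<^sup>2)) \<partial>N i) \<le> 2"
      using sub_gaussian_norm_attained[OF P sg[OF i] M] i by (simp add: N_def nn_integral_distr)
  qed
  also have "PiM I N = distr P (PiM I (\<lambda>_. borel)) (\<lambda>\<omega>. \<lambda>i\<in>I. \<epsilon> i \<omega>)"
  proof -
    have "PiM I N = PiM I (\<lambda>i. distr P borel (\<epsilon> i))" by (intro PiM_cong) (auto simp: N_def)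
    then show ?thesis using indep_vars_iff_distr_eq_PiM'[OF I(2), of \<epsilon> "\<lambda>_. borel"] ind m by simp
  qed
  also have "(\<integral>\<^sup>+ x. ennreal (exp (quad_form Q I x / ?c)) \<partial>distr P (PiM I (\<lambda>_. borel)) (\<lambda>\<omega>. \<lambda>i\<in>I. \<epsilon> i \<omega>))
     = (\<integral>\<^sup>+ \<omega>. ennreal (exp (quad_form Q I (\<lambda>i. \<epsilon> i \<omega>) / ?c)) \<partial>P)"
  proof (subst nn_integral_distr)
    show "(\<lambda>\<omega>. \<lambda>i\<in>I. \<epsilon> i \<omega>) \<in> P \<rightarrow>\<^sub>M PiM I (\<lambda>_. borel)" by (intro measurable_restrict m)
    have "quad_form Q I (\<lambda>i\<in>I. e i) = quad_form Q I e" for e :: "'i \<Rightarrow> real"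
      unfolding quad_form_def by (intro sum.cong refl) auto
    then show "(\<integral>\<^sup>+ \<omega>. ennreal (exp (quad_form Q I (\<lambda>i\<in>I. \<epsilon> i \<omega>) / ?c)) \<partial>P)
        = (\<integral>\<^sup>+ \<omega>. ennreal (exp (quad_form Q I (\<lambda>i. \<epsilon> i \<omega>) / ?c)) \<partial>P)" by simp
  qed (simp add: meas)
  finally have E: "(\<integral>\<^sup>+ \<omega>. ennreal (exp (quad_form Q I (\<lambda>i. \<epsilon> i \<omega>) / ?c)) \<partial>P) \<le> ennreal (exp (M\<^sup>2 * S / A))" .
  have MSV: "M\<^sup>2 * S \<le> M\<^sup>2 * V" using S by (intro mult_left_mono) auto
  have "M\<^sup>2 * S / A \<le> M\<^sup>2 * V / A" using A by (intro divide_right_mono MSV) auto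
  also have "\<dots> = 1 / 2" using M V by (simp add: A_def)
  finally have SA: "M\<^sup>2 * S / A \<le> 1 / 2" .
  let ?B = "{\<omega> \<in> space P. quad_form Q I (\<lambda>i. \<epsilon> i \<omega>) > 10 * M\<^sup>2 * V * L}"
  show ?thesis
  proof (cases "L \<ge> 0")
    case True
    have c: "0 < ?c" using A S by (auto intro!: add_pos_nonneg)
    have c': "?c \<le> 10 * M\<^sup>2 * V" using MSV by (simp add: A_def algebra_simps)
    have "?B \<subseteq> {\<omega> \<in> space P. ennreal (exp L) \<le> ennreal (exp (quad_form Q I (\<lambda>i. \<epsilon> i \<omega>) / ?c))}"
    proof safe
      fix \<omega> assume "10 * M\<^sup>2 * V * L < quad_form Q I (\<lambda>i. \<epsilon> i \<omega>)"
      moreover have "?c * L \<le> 10 * M\<^sup>2 * V * L" by (rule mult_right_mono[OF c' True])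
      ultimately have "L \<le> quad_form Q I (\<lambda>i. \<epsilon> i \<omega>) / ?c" using c by (simp add: field_simps)
      then show "ennreal (exp L) \<le> ennreal (exp (quad_form Q I (\<lambda>i. \<epsilon> i \<omega>) / ?c))"
        by (intro ennreal_leI) simp
    qed
    then have "emeasure P ?B \<le> emeasure P {\<omega> \<in> space P. ennreal (exp L) \<le> ennreal (exp (quad_form Q I (\<lambda>i. \<epsilon> i \<omega>) / ?c))}"
      by (intro emeasure_mono) auto
    also have "\<dots> \<le> emeasure P {\<omega> \<in> space P. 1 \<le> ennreal (exp (- L)) * ennreal (exp (quad_form Q I (\<lambda>i. \<epsilon> i \<omega>) / ?c))}"
      by (intro emeasure_mono) (auto simp: ennreal_mult'[symmetric] exp_add[symmetric] ennreal_le_iff)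
    also have "\<dots> \<le> ennreal (exp (- L)) * (\<integral>\<^sup>+ \<omega>. ennreal (exp (quad_form Q I (\<lambda>i. \<epsilon> i \<omega>) / ?c)) * indicator (space P) \<omega> \<partial>P)"
      by (rule nn_integral_Markov_inequality[of "\<lambda>\<omega>. ennreal (exp (quad_form Q I (\<lambda>i. \<epsilon> i \<omega>) / ?c))" "space P", simplified]) auto
    also have "\<dots> \<le> ennreal (exp (- L)) * ennreal (exp (M\<^sup>2 * S / A))"
      using E by (intro mult_left_mono) (auto cong: nn_integral_cong)
    also have "\<dots> \<le> ennreal (exp (1 / 2 - L))"
      using SA by (simp add: ennreal_mult'[symmetric] exp_add[symmetric] ennreal_leI)
    finally show ?thesis by (simp add: emeasure_eq_measure)
  next
    case False
    have "measure P ?B \<le> 1" by (rule prob_le_1)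
    also have "\<dots> \<le> exp (1 / 2 - L)" using False by simp
    finally show ?thesis .
  qed
qed

section \<open>Harmonic series and the integral operator on the native space\<close>

lemma fourier_coeff_cong:
  "(\<And>x. x \<in> sphere 0 1 \<Longrightarrow> f x = g x) \<Longrightarrow> fourier_coeff Y f = fourier_coeff Y g"
  by (auto simp: fun_eq_iff fourier_coeff_def intro!: Bochner_Integration.integral_cong)

lemma native_space_cong:
  assumes "f \<in> native_space Z Y c" and eq: "\<And>x. x \<in> sphere 0 1 \<Longrightarrow> g x = f x"
  shows "g \<in> native_space Z Y c" "fourier_coeff Y g = fourier_coeff Y f"
proof -
  show fc: "fourier_coeff Y g = fourier_coeff Y f"
    by (rule fourier_coeff_cong) (rule eq)
  have 1: "g \<in> borel_measurable sphere_measure \<longleftrightarrow> f \<in> borel_measurable sphere_measure"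
    by (rule measurable_cong) (simp add: eq)
  have 2: "integrable sphere_measure (\<lambda>x. (g x)\<^sup>2) \<longleftrightarrow> integrable sphere_measure (\<lambda>x. (f x)\<^sup>2)"
    by (rule Bochner_Integration.integrable_cong) (auto simp: eq)
  have 3: "(LINT x|sphere_measure. (g x - s x)\<^sup>2) = (LINT x|sphere_measure. (f x - s x)\<^sup>2)" for s
    by (rule Bochner_Integration.integral_cong) (auto simp: eq)
  show "g \<in> native_space Z Y c"
    using assms(1) unfolding native_space_def mem_Collect_eq fc 1 2 3 .
qed

text \<open>The bound \<open>cmax\<close> makes multiplication by \<open>c k\<close> and by \<open>sqrt (c k + lam)\<close> a bounded operation on the
  native space.\<close>

locale harmonic_kernel =
  fixes Z :: "nat \<Rightarrow> nat" and Y :: "nat \<Rightarrow> nat \<Rightarrow> 'a::euclidean_space \<Rightarrow> real"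
    and c :: "nat \<Rightarrow> real" and \<phi> :: "real \<Rightarrow> real" and cmax :: real
  assumes onb: "harmonic_onb Z Y" and dim: "2 \<le> DIM('a)"
    and sbf: "spherical_basis_function Z Y c \<phi>" and c_le: "\<And>k. c k \<le> cmax"
begin

abbreviation "fcoef \<equiv> fourier_coeff Y"
abbreviation "\<N> \<equiv> native_space Z Y c"

sublocale prob_space "sphere_measure :: 'a measure" by (rule prob_space_sphere_measure)

lemma c_pos: "0 < c k" using sbf by (simp add: spherical_basis_function_def)
lemma summable_cZ: "summable (\<lambda>k. c k * real (Z k))" using sbf by (simp add: spherical_basis_function_def)

lemma Y_measurable: "l \<in> {1..Z k} \<Longrightarrow> Y k l \<in> borel_measurable sphere_measure"
  by (rule spherical_harmonics_measurable[OF harmonic_onbD[OF onb]])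

lemma Y_bounded:
  assumes "l \<in> {1..Z k}" "x \<in> sphere 0 1"
  shows "\<bar>Y k l x\<bar> \<le> sqrt (real (Z k))"
proof -
  have "(Y k l x)\<^sup>2 \<le> (\<Sum>l=1..Z k. (Y k l x)\<^sup>2)"
    using assms(1) by (intro member_le_sum[where f = "\<lambda>l. (Y k l x)\<^sup>2"]) auto
  then have "(Y k l x)\<^sup>2 \<le> real (Z k)" by (simp only: addition_theorem_diagonal[OF onb assms(2)])
  then show ?thesis by (rule real_le_rsqrt[OF _, of "\<bar>_\<bar>", simplified])
qed

text \<open>The coefficient arrays of the elements of the native space.\<close>

definition admissible :: "(nat \<Rightarrow> nat \<Rightarrow> real) \<Rightarrow> bool" where
  "admissible a \<longleftrightarrow> summable (\<lambda>k. inverse (c k) * (\<Sum>l=1..Z k. (a k l)\<^sup>2))"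

definition component :: "(nat \<Rightarrow> nat \<Rightarrow> real) \<Rightarrow> nat \<Rightarrow> 'a \<Rightarrow> real" where
  "component a k x = (\<Sum>l=1..Z k. a k l * Y k l x)"

definition harmonic_series :: "(nat \<Rightarrow> nat \<Rightarrow> real) \<Rightarrow> 'a \<Rightarrow> real" where
  "harmonic_series a x = (\<Sum>k. component a k x)"

text \<open>A summable bound for the components of an admissible series that is the same at all points of the sphere.\<close>

definition majorant :: "(nat \<Rightarrow> nat \<Rightarrow> real) \<Rightarrow> nat \<Rightarrow> real" where
  "majorant a k = (inverse (c k) * (\<Sum>l=1..Z k. (a k l)\<^sup>2) + c k * real (Z k)) / 2"

lemma summable_majorant: "admissible a \<Longrightarrow> summable (majorant a)"
  unfolding majorant_def[abs_def] admissible_def by (intro summable_divide summable_add summable_cZ)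

text \<open>Cauchy-Schwarz and the addition theorem give \<open>sqrt (p * q)\<close> with \<open>p\<close> and \<open>q\<close> the two terms of the majorant;
  the inequality of the arithmetic and the geometric mean does the rest.\<close>

lemma component_le_majorant:
  assumes "x \<in> sphere 0 1"
  shows "\<bar>component a k x\<bar> \<le> majorant a k"
proof -
  define p q where "p = inverse (c k) * (\<Sum>l=1..Z k. (a k l)\<^sup>2)" and "q = c k * real (Z k)"
  have pq: "0 \<le> p" "0 \<le> q" using c_pos[of k] by (auto simp: p_def q_def intro!: mult_nonneg_nonneg sum_nonneg)
  have "(component a k x)\<^sup>2 \<le> (\<Sum>l=1..Z k. (a k l)\<^sup>2) * (\<Sum>l=1..Z k. (Y k l x)\<^sup>2)"
    unfolding component_def by (rule Cauchy_Schwarz_ineq_sum)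
  also have "\<dots> = p * q"
    using c_pos[of k] unfolding addition_theorem_diagonal[OF onb assms] p_def q_def by (simp add: field_simps)
  also have "\<dots> \<le> ((p + q) / 2)\<^sup>2"
    using sum_squares_ge_zero[of "p - q" 0] by (simp add: power2_eq_square field_simps)
  finally have "\<bar>component a k x\<bar> \<le> \<bar>(p + q) / 2\<bar>" by (simp only: abs_le_square_iff)
  then show ?thesis using pq by (simp add: majorant_def p_def q_def)
qed

lemma summable_component:
  assumes "admissible a" "x \<in> sphere 0 1"
  shows "summable (\<lambda>k. component a k x)" "(\<lambda>k. component a k x) sums harmonic_series a x"
proof -
  show s: "summable (\<lambda>k. component a k x)"
    by (rule summable_comparison_test'[OF summable_majorant[OF assms(1)], of 0])
       (simp add: component_le_majorant[OF assms(2)])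
  show "(\<lambda>k. component a k x) sums harmonic_series a x"
    unfolding harmonic_series_def by (rule summable_sums[OF s])
qed

lemma component_measurable: "component a k \<in> borel_measurable sphere_measure"
  unfolding component_def[abs_def] using Y_measurable by (intro borel_measurable_sum borel_measurable_times) auto

lemma harmonic_series_measurable: "harmonic_series a \<in> borel_measurable sphere_measure"
  unfolding harmonic_series_def[abs_def] by (intro borel_measurable_suminf component_measurable)

lemma harmonic_series_tail:
  assumes "admissible a" "x \<in> sphere 0 1"
  shows "\<bar>harmonic_series a x - (\<Sum>k<n. component a k x)\<bar> \<le> (\<Sum>k. majorant a (k + n))"
proof -
  have s: "summable (\<lambda>k. component a (k + n) x)"
    using summable_component(1)[OF assms] by (rule summable_ignore_initial_segment)
  have m: "summable (\<lambda>k. majorant a (k + n))"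
    using summable_majorant[OF assms(1)] by (rule summable_ignore_initial_segment)
  have "harmonic_series a x - (\<Sum>k<n. component a k x) = (\<Sum>k. component a (k + n) x)"
    unfolding harmonic_series_def using suminf_minus_initial_segment[OF summable_component(1)[OF assms], of n] by simp
  also have "\<bar>\<dots>\<bar> \<le> (\<Sum>k. majorant a (k + n))"
    by (rule norm_suminf_le[of "\<lambda>k. component a (k + n) x", unfolded real_norm_def])
       (use m in \<open>simp_all add: component_le_majorant[OF assms(2)] summable_majorant[OF assms(1)]\<close>)
  finally show ?thesis .
qed

lemma harmonic_series_bounded:
  assumes "admissible a" "x \<in> sphere 0 1"
  shows "\<bar>harmonic_series a x\<bar> \<le> (\<Sum>k. majorant a k)"
  using harmonic_series_tail[OF assms, of 0] by simp

lemma integrable_mult_Y: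
  assumes "integrable sphere_measure g" "l \<in> {1..Z k}"
  shows "integrable sphere_measure (\<lambda>x. g x * Y k l x)"
proof (rule Bochner_Integration.integrable_bound[of _ "\<lambda>x. g x * sqrt (real (Z k))"])
  show "AE x in sphere_measure. norm (g x * Y k l x) \<le> norm (g x * sqrt (real (Z k)))"
    using Y_bounded[OF assms(2)] by (intro AE_I2) (auto simp: abs_mult intro!: mult_left_mono)
  show "(\<lambda>x. g x * Y k l x) \<in> borel_measurable sphere_measure"
    using assms Y_measurable by (intro borel_measurable_times) auto
qed (use assms in auto)

lemma integral_mult_component:
  assumes "integrable sphere_measure g"
  shows "(LINT x|sphere_measure. g x * component a k x) = (\<Sum>l=1..Z k. a k l * fcoef g k l)"
    and "integrable sphere_measure (\<lambda>x. g x * component a k x)"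
proof -
  have e: "g x * component a k x = (\<Sum>l=1..Z k. a k l * (g x * Y k l x))" for x
    by (simp add: component_def sum_distrib_left mult_ac)
  show "integrable sphere_measure (\<lambda>x. g x * component a k x)"
    unfolding e by (intro Bochner_Integration.integrable_sum integrable_mult_right integrable_mult_Y[OF assms])
  have "(LINT x|sphere_measure. g x * component a k x) = (\<Sum>l=1..Z k. LINT x|sphere_measure. a k l * (g x * Y k l x))"
    unfolding e by (intro Bochner_Integration.integral_sum integrable_mult_right integrable_mult_Y[OF assms])
  then show "(LINT x|sphere_measure. g x * component a k x) = (\<Sum>l=1..Z k. a k l * fcoef g k l)"
    by (simp add: fourier_coeff_def)
qed

lemma integral_mult_harmonic_series:
  assumes a: "admissible a" and g: "integrable sphere_measure g"
  shows "(\<lambda>k. \<Sum>l=1..Z k. a k l * fcoef g k l) sums (LINT x|sphere_measure. g x * harmonic_series a x)"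
proof -
  let ?h = "\<lambda>k x. g x * component a k x"
  have le: "norm (?h k x) \<le> majorant a k * norm (g x)" if "x \<in> sphere 0 1" for k x
    using component_le_majorant[OF that, of a k] by (simp add: abs_mult mult.commute mult_left_mono)
  have gn: "integrable sphere_measure (\<lambda>x. norm (g x))" using g by simp
  have hi: "integrable sphere_measure (?h k)" for k by (rule integral_mult_component(2)[OF g])
  have "(\<lambda>k. LINT x|sphere_measure. ?h k x) sums (LINT x|sphere_measure. (\<Sum>k. ?h k x))"
  proof (rule sums_integral[OF hi])
    show "AE x in sphere_measure. summable (\<lambda>k. norm (?h k x))"
    proof (rule AE_I2)
      fix x :: 'a assume "x \<in> space sphere_measure"
      then have x: "x \<in> sphere 0 1" by simp
      show "summable (\<lambda>k. norm (?h k x))"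
        by (rule summable_comparison_test'[OF summable_mult2[OF summable_majorant[OF a]], of 0])
           (use le[OF x] in simp)
    qed
    show "summable (\<lambda>k. LINT x|sphere_measure. norm (?h k x))"
    proof (rule summable_comparison_test'[OF summable_mult2[OF summable_majorant[OF a], of "LINT x|sphere_measure. norm (g x)"], of 0])
      fix k
      have "(LINT x|sphere_measure. norm (?h k x)) \<le> (LINT x|sphere_measure. majorant a k * norm (g x))"
        by (rule integral_mono[OF integrable_norm[OF hi] integrable_mult_right[OF gn]]) (use le in simp)
      then show "norm (LINT x|sphere_measure. norm (?h k x)) \<le> majorant a k * (LINT x|sphere_measure. norm (g x))"
        by (simp add: Bochner_Integration.integral_nonneg)
    qed
  qed
  also have "(LINT x|sphere_measure. (\<Sum>k. ?h k x)) = (LINT x|sphere_measure. g x * harmonic_series a x)"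
    by (rule Bochner_Integration.integral_cong[OF refl])
       (simp add: harmonic_series_def suminf_mult summable_component(1)[OF a])
  finally show ?thesis by (simp only: integral_mult_component(1)[OF g])
qed

lemma Y_integrable: "l \<in> {1..Z k} \<Longrightarrow> integrable sphere_measure (Y k l)"
  using integrable_mult_Y[of "\<lambda>_. 1"] by simp

lemma fourier_coeff_Y:
  assumes "l \<in> {1..Z k}" "j \<in> {1..Z m}"
  shows "fcoef (Y k l) m j = (if m = k \<and> j = l then 1 else 0)"
  using harmonic_onb_orthonormal[OF onb dim assms] by (auto simp: fourier_coeff_def)

lemma fourier_coeff_harmonic_series:
  assumes a: "admissible a" and l: "l \<in> {1..Z k}"
  shows "fcoef (harmonic_series a) k l = a k l"
proof -
  have "(\<Sum>j=1..Z m. a m j * fcoef (Y k l) m j) = (if m = k then a k l else 0)" for m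
  proof -
    have "(\<Sum>j=1..Z m. a m j * fcoef (Y k l) m j)
        = (\<Sum>j=1..Z m. if j = l then (if m = k then a k l else 0) else 0)"
      by (intro sum.cong refl) (auto simp: fourier_coeff_Y[OF l])
    also have "\<dots> = (if m = k then a k l else 0)" using l by (auto simp: sum.delta)
    finally show ?thesis .
  qed
  then have "(\<lambda>m. if m = k then a k l else 0) sums (LINT x|sphere_measure. Y k l x * harmonic_series a x)"
    using integral_mult_harmonic_series[OF a Y_integrable[OF l]] by simp
  moreover have "(\<lambda>m. if m = k then a k l else 0) sums a k l" by (rule sums_single)
  ultimately show ?thesis
    unfolding fourier_coeff_def by (subst mult.commute) (rule sums_unique2)
qed

lemma component_cong: "(\<And>l. l \<in> {1..Z k} \<Longrightarrow> a k l = b k l) \<Longrightarrow> component a k x = component b k x"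
  by (simp add: component_def)

lemma harmonic_series_cong: "(\<And>k l. l \<in> {1..Z k} \<Longrightarrow> a k l = b k l) \<Longrightarrow> harmonic_series a = harmonic_series b"
  by (auto simp: harmonic_series_def fun_eq_iff intro!: suminf_cong component_cong)

lemma admissible_cong: "(\<And>k l. l \<in> {1..Z k} \<Longrightarrow> a k l = b k l) \<Longrightarrow> admissible a = admissible b"
  by (auto simp: admissible_def intro!: summable_cong)

lemma harmonic_series_in_native_space:
  assumes a: "admissible a"
  shows "harmonic_series a \<in> \<N>"
proof -
  let ?F = "harmonic_series a"
  have fc: "fcoef ?F k l = a k l" if "l \<in> {1..Z k}" for k l
    by (rule fourier_coeff_harmonic_series[OF a that])
  have part: "(\<Sum>k<n. \<Sum>l=1..Z k. fcoef ?F k l * Y k l x) = (\<Sum>k<n. component a k x)" for n x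
    unfolding component_def by (intro sum.cong refl) (simp only: fc)
  have "integrable sphere_measure (\<lambda>x. (?F x)\<^sup>2)"
  proof (rule integrable_const_bound[of _ "(\<Sum>k. majorant a k)\<^sup>2"])
    show "AE x in sphere_measure. norm ((?F x)\<^sup>2) \<le> (\<Sum>k. majorant a k)\<^sup>2"
    proof (rule AE_I2)
      fix x :: 'a assume "x \<in> space sphere_measure"
      then have "\<bar>?F x\<bar> \<le> (\<Sum>k. majorant a k)" using harmonic_series_bounded[OF a] by simp
      then have "\<bar>?F x\<bar>\<^sup>2 \<le> (\<Sum>k. majorant a k)\<^sup>2" by (rule power_mono) simp
      then show "norm ((?F x)\<^sup>2) \<le> (\<Sum>k. majorant a k)\<^sup>2" by simp
    qed
  qed (intro borel_measurable_power harmonic_series_measurable)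
  moreover have "(\<lambda>n. LINT x|sphere_measure. (?F x - (\<Sum>k<n. component a k x))\<^sup>2) \<longlonglongrightarrow> 0"
  proof (rule tendsto_sandwich[OF _ _ tendsto_const])
    let ?t = "\<lambda>n. (\<Sum>k. majorant a (k + n))"
    have "?t \<longlonglongrightarrow> 0" by (rule suminf_exist_split2[OF summable_majorant[OF a]])
    then show "(\<lambda>n. (?t n)\<^sup>2) \<longlonglongrightarrow> 0" using tendsto_power[of ?t 0 sequentially 2] by simp
    show "\<forall>\<^sub>F n in sequentially. (LINT x|sphere_measure. (?F x - (\<Sum>k<n. component a k x))\<^sup>2) \<le> (?t n)\<^sup>2"
    proof (intro always_eventually allI)
      fix n
      have "(LINT x|sphere_measure. (?F x - (\<Sum>k<n. component a k x))\<^sup>2) \<le> (LINT x|(sphere_measure::'a measure). (?t n)\<^sup>2)"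
      proof (rule integral_mono_AE')
        show "AE x in sphere_measure. (?F x - (\<Sum>k<n. component a k x))\<^sup>2 \<le> (?t n)\<^sup>2"
        proof (rule AE_I2)
          fix x :: 'a assume "x \<in> space sphere_measure"
          then have "\<bar>?F x - (\<Sum>k<n. component a k x)\<bar> \<le> ?t n" using harmonic_series_tail[OF a] by simp
          then have "\<bar>?F x - (\<Sum>k<n. component a k x)\<bar>\<^sup>2 \<le> (?t n)\<^sup>2" by (rule power_mono) simp
          then show "(?F x - (\<Sum>k<n. component a k x))\<^sup>2 \<le> (?t n)\<^sup>2" by simp
        qed
      qed simp_all
      then show "(LINT x|sphere_measure. (?F x - (\<Sum>k<n. component a k x))\<^sup>2) \<le> (?t n)\<^sup>2"
        using prob_space by simp
    qed
  qed (simp add: Bochner_Integration.integral_nonneg)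
  moreover have "summable (\<lambda>k. inverse (c k) * (\<Sum>l=1..Z k. (fcoef ?F k l)\<^sup>2))"
    using a admissible_cong[of a "fcoef ?F"] fc by (simp add: admissible_def)
  ultimately show ?thesis
    unfolding native_space_def mem_Collect_eq part using harmonic_series_measurable by blast
qed

lemma native_spaceD:
  assumes "f \<in> \<N>"
  shows "f \<in> borel_measurable sphere_measure" "integrable sphere_measure (\<lambda>x. (f x)\<^sup>2)"
    "integrable sphere_measure f" "admissible (fcoef f)"
    "(\<lambda>n. LINT x|sphere_measure. (f x - (\<Sum>k<n. component (fcoef f) k x))\<^sup>2) \<longlonglongrightarrow> 0"
proof -
  show m: "f \<in> borel_measurable sphere_measure" and i2: "integrable sphere_measure (\<lambda>x. (f x)\<^sup>2)"
    and "admissible (fcoef f)"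
    and "(\<lambda>n. LINT x|sphere_measure. (f x - (\<Sum>k<n. component (fcoef f) k x))\<^sup>2) \<longlonglongrightarrow> 0"
    using assms by (simp_all add: native_space_def admissible_def component_def)
  show "integrable sphere_measure f" by (rule square_integrable_imp_integrable[OF m i2])
qed

text \<open>Both sides are limits in mean square of the same partial sums.\<close>

lemma native_space_eq_harmonic_series:
  assumes f: "f \<in> \<N>"
  shows "AE x in sphere_measure. f x = harmonic_series (fcoef f) x"
proof -
  let ?a = "fcoef f"
  let ?F = "harmonic_series ?a"
  note fD = native_spaceD[OF f]
  have F: "?F \<in> \<N>" by (rule harmonic_series_in_native_space[OF fD(4)])
  note FD = native_spaceD[OF F]
  have Fc: "component (fcoef ?F) k x = component ?a k x" for k x
    by (rule component_cong) (rule fourier_coeff_harmonic_series[OF fD(4)])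
  let ?S = "\<lambda>n x. \<Sum>k<n. component ?a k x"
  have sq: "integrable sphere_measure (\<lambda>x. (g x - h x)\<^sup>2)"
    if "g \<in> borel_measurable sphere_measure" "h \<in> borel_measurable sphere_measure"
      "integrable sphere_measure (\<lambda>x. (g x)\<^sup>2)" "integrable sphere_measure (\<lambda>x. (h x)\<^sup>2)" for g h :: "'a \<Rightarrow> real"
  proof (rule Bochner_Integration.integrable_bound[of _ "\<lambda>x. 2 * (g x)\<^sup>2 + 2 * (h x)\<^sup>2"])
    have "(g x - h x)\<^sup>2 \<le> 2 * (g x)\<^sup>2 + 2 * (h x)\<^sup>2" for x
      using zero_le_power2[of "g x + h x"] by (simp add: power2_eq_square algebra_simps)
    then show "AE x in sphere_measure. norm ((g x - h x)\<^sup>2) \<le> norm (2 * (g x)\<^sup>2 + 2 * (h x)\<^sup>2)"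
      by (intro AE_I2) simp
    show "integrable sphere_measure (\<lambda>x. 2 * (g x)\<^sup>2 + 2 * (h x)\<^sup>2)" using that by simp
    show "(\<lambda>x. (g x - h x)\<^sup>2) \<in> borel_measurable sphere_measure" using that by simp
  qed
  have Sm: "?S n \<in> borel_measurable sphere_measure" for n
    by (intro borel_measurable_sum component_measurable)
  have S2: "integrable sphere_measure (\<lambda>x. (?S n x)\<^sup>2)" for n
  proof (rule integrable_const_bound[of _ "(\<Sum>k<n. majorant ?a k)\<^sup>2"])
    show "AE x in sphere_measure. norm ((?S n x)\<^sup>2) \<le> (\<Sum>k<n. majorant ?a k)\<^sup>2"
    proof (rule AE_I2)
      fix x :: 'a assume "x \<in> space sphere_measure"
      then have "\<bar>?S n x\<bar> \<le> (\<Sum>k<n. majorant ?a k)"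
        by (intro sum_abs[THEN order_trans] sum_mono component_le_majorant) simp
      then have "\<bar>?S n x\<bar>\<^sup>2 \<le> (\<Sum>k<n. majorant ?a k)\<^sup>2" by (rule power_mono) simp
      then show "norm ((?S n x)\<^sup>2) \<le> (\<Sum>k<n. majorant ?a k)\<^sup>2" by simp
    qed
    show "(\<lambda>x. (?S n x)\<^sup>2) \<in> borel_measurable sphere_measure" using Sm by (rule borel_measurable_power)
  qed
  let ?d = "LINT x|sphere_measure. (f x - ?F x)\<^sup>2"
  have lim: "(\<lambda>n. 2 * (LINT x|sphere_measure. (f x - ?S n x)\<^sup>2) + 2 * (LINT x|sphere_measure. (?F x - ?S n x)\<^sup>2)) \<longlonglongrightarrow> 2 * 0 + 2 * 0"
    using fD(5) FD(5) unfolding Fc by (intro tendsto_add tendsto_mult_left)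
  have "?d \<le> 2 * 0 + 2 * 0"
  proof (rule LIMSEQ_le_const[OF lim], intro exI allI impI)
    fix n
    have i1: "integrable sphere_measure (\<lambda>x. (f x - ?S n x)\<^sup>2)" by (rule sq[OF fD(1) Sm fD(2) S2])
    have i2: "integrable sphere_measure (\<lambda>x. (?F x - ?S n x)\<^sup>2)" by (rule sq[OF FD(1) Sm FD(2) S2])
    have "?d \<le> (LINT x|sphere_measure. 2 * (f x - ?S n x)\<^sup>2 + 2 * (?F x - ?S n x)\<^sup>2)"
    proof (rule integral_mono[OF sq[OF fD(1) FD(1) fD(2) FD(2)]])
      show "integrable sphere_measure (\<lambda>x. 2 * (f x - ?S n x)\<^sup>2 + 2 * (?F x - ?S n x)\<^sup>2)"
        by (intro Bochner_Integration.integrable_add integrable_mult_right i1 i2)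
      show "(f x - ?F x)\<^sup>2 \<le> 2 * (f x - ?S n x)\<^sup>2 + 2 * (?F x - ?S n x)\<^sup>2" for x
        using zero_le_power2[of "(f x - ?S n x) + (?F x - ?S n x)"] by (simp only: power2_eq_square) (simp add: algebra_simps)
    qed
    also have "\<dots> = 2 * (LINT x|sphere_measure. (f x - ?S n x)\<^sup>2) + 2 * (LINT x|sphere_measure. (?F x - ?S n x)\<^sup>2)"
      using i1 i2 by simp
    finally show "?d \<le> 2 * (LINT x|sphere_measure. (f x - ?S n x)\<^sup>2) + 2 * (LINT x|sphere_measure. (?F x - ?S n x)\<^sup>2)" .
  qed
  moreover have "0 \<le> ?d" by (rule Bochner_Integration.integral_nonneg) simp
  ultimately have "?d = 0" by simp
  then have "AE x in sphere_measure. (f x - ?F x)\<^sup>2 = 0"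
    using integral_nonneg_eq_0_iff_AE[OF sq[OF fD(1) FD(1) fD(2) FD(2)]] by simp
  then show ?thesis by (rule AE_mp) (intro AE_I2 impI, simp)
qed

lemma admissible_mult:
  assumes a: "admissible a" and m: "\<And>k. \<bar>m k\<bar> \<le> B"
  shows "admissible (\<lambda>k l. m k * a k l)"
  unfolding admissible_def
proof (rule summable_comparison_test'[OF summable_mult[OF a[unfolded admissible_def], of "B\<^sup>2"], of 0])
  fix k
  have "(m k)\<^sup>2 \<le> B\<^sup>2" using m[of k] power_mono[of "\<bar>m k\<bar>" B 2] by simp
  moreover have nn: "0 \<le> inverse (c k) * (\<Sum>l=1..Z k. (a k l)\<^sup>2)"
    using c_pos[of k] by (intro mult_nonneg_nonneg sum_nonneg) auto
  ultimately have "(m k)\<^sup>2 * (inverse (c k) * (\<Sum>l=1..Z k. (a k l)\<^sup>2)) \<le> B\<^sup>2 * (inverse (c k) * (\<Sum>l=1..Z k. (a k l)\<^sup>2))"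
    by (intro mult_right_mono)
  moreover have eq: "inverse (c k) * (\<Sum>l=1..Z k. (m k * a k l)\<^sup>2) = (m k)\<^sup>2 * (inverse (c k) * (\<Sum>l=1..Z k. (a k l)\<^sup>2))"
    by (simp add: power_mult_distrib sum_distrib_left mult_ac)
  ultimately show "norm (inverse (c k) * (\<Sum>l=1..Z k. (m k * a k l)\<^sup>2)) \<le> B\<^sup>2 * (inverse (c k) * (\<Sum>l=1..Z k. (a k l)\<^sup>2))"
    unfolding eq by (simp only: real_norm_def abs_mult[of "(m k)\<^sup>2"] abs_power2 abs_of_nonneg[OF nn])
qed

lemma admissible_add:
  assumes a: "admissible a" and b: "admissible b"
  shows "admissible (\<lambda>k l. s * a k l + t * b k l)"
  unfolding admissible_def
proof (rule summable_comparison_test'[of _ 0])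
  let ?sq = "\<lambda>a k. inverse (c k) * (\<Sum>l=1..Z k. (a k l)\<^sup>2)"
  show "summable (\<lambda>k. 2 * s\<^sup>2 * ?sq a k + 2 * t\<^sup>2 * ?sq b k)"
    using a b unfolding admissible_def by (intro summable_add summable_mult)
  fix k
  have "(\<Sum>l=1..Z k. (s * a k l + t * b k l)\<^sup>2) \<le> (\<Sum>l=1..Z k. 2 * s\<^sup>2 * (a k l)\<^sup>2 + 2 * t\<^sup>2 * (b k l)\<^sup>2)"
  proof (rule sum_mono)
    fix l
    have "(p + q)\<^sup>2 \<le> 2 * p\<^sup>2 + 2 * q\<^sup>2" for p q :: real
      using zero_le_power2[of "p - q"] by (simp add: power2_eq_square algebra_simps)
    from this[of "s * a k l" "t * b k l"]
    show "(s * a k l + t * b k l)\<^sup>2 \<le> 2 * s\<^sup>2 * (a k l)\<^sup>2 + 2 * t\<^sup>2 * (b k l)\<^sup>2"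
      by (simp only: power_mult_distrib mult.assoc)
  qed
  also have "\<dots> = 2 * s\<^sup>2 * (\<Sum>l=1..Z k. (a k l)\<^sup>2) + 2 * t\<^sup>2 * (\<Sum>l=1..Z k. (b k l)\<^sup>2)"
    by (simp only: sum.distrib sum_distrib_left)
  finally have "?sq (\<lambda>k l. s * a k l + t * b k l) k
      \<le> inverse (c k) * (2 * s\<^sup>2 * (\<Sum>l=1..Z k. (a k l)\<^sup>2) + 2 * t\<^sup>2 * (\<Sum>l=1..Z k. (b k l)\<^sup>2))"
    using c_pos[of k] by (intro mult_left_mono) auto
  moreover have "0 \<le> ?sq (\<lambda>k l. s * a k l + t * b k l) k"
    using c_pos[of k] by (intro mult_nonneg_nonneg sum_nonneg) auto
  ultimately show "norm (?sq (\<lambda>k l. s * a k l + t * b k l) k) \<le> 2 * s\<^sup>2 * ?sq a k + 2 * t\<^sup>2 * ?sq b k"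
    by (simp only: real_norm_def abs_of_nonneg distrib_left mult.left_commute mult.assoc)
qed

lemma harmonic_series_add:
  assumes "admissible a" "admissible b" "x \<in> sphere 0 1"
  shows "harmonic_series (\<lambda>k l. s * a k l + t * b k l) x = s * harmonic_series a x + t * harmonic_series b x"
proof (rule sums_unique2)
  have "component (\<lambda>k l. s * a k l + t * b k l) k x = s * component a k x + t * component b k x" for k
    by (simp add: component_def sum.distrib sum_distrib_left algebra_simps)
  then show sums: "(\<lambda>k. component (\<lambda>k l. s * a k l + t * b k l) k x) sums (s * harmonic_series a x + t * harmonic_series b x)"
    using sums_add[OF sums_mult[OF summable_component(2)[OF assms(1,3)], of s] sums_mult[OF summable_component(2)[OF assms(2,3)], of t]]
    by simp
  then show "(\<lambda>k. component (\<lambda>k l. s * a k l + t * b k l) k x) sums harmonic_series (\<lambda>k l. s * a k l + t * b k l) x"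
    unfolding harmonic_series_def by (simp add: sums_iff)
qed

lemma fourier_coeff_add:
  assumes "integrable sphere_measure f" "integrable sphere_measure g" "l \<in> {1..Z k}"
  shows "fcoef (\<lambda>z. s * f z + t * g z) k l = s * fcoef f k l + t * fcoef g k l"
proof -
  have "(s * f z + t * g z) * Y k l z = s * (f z * Y k l z) + t * (g z * Y k l z)" for z
    by (simp add: algebra_simps)
  then show ?thesis
    using integrable_mult_Y[OF assms(1,3)] integrable_mult_Y[OF assms(2,3)]
    by (simp add: fourier_coeff_def)
qed

lemma fourier_coeff_cong_AE:
  assumes "AE x in sphere_measure. f x = g x" "f \<in> borel_measurable sphere_measure"
    "g \<in> borel_measurable sphere_measure" "l \<in> {1..Z k}"
  shows "fcoef f k l = fcoef g k l"
  unfolding fourier_coeff_def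
proof (rule integral_cong_AE)
  show "AE x in sphere_measure. f x * Y k l x = g x * Y k l x" using assms(1) by (rule AE_mp) (intro AE_I2 impI, simp)
qed (intro borel_measurable_times assms Y_measurable)+

lemma admissible_kernel:
  assumes "x \<in> sphere 0 1"
  shows "admissible (\<lambda>k l. c k * Y k l x)"
  unfolding admissible_def
proof (rule summable_cong[THEN iffD2, OF _ summable_cZ], intro always_eventually allI)
  fix k
  have "inverse (c k) * (\<Sum>l=1..Z k. (c k * Y k l x)\<^sup>2) = inverse (c k) * ((c k)\<^sup>2 * (\<Sum>l=1..Z k. (Y k l x)\<^sup>2))"
    by (simp add: power_mult_distrib sum_distrib_left)
  also have "\<dots> = c k * real (Z k)"
    unfolding addition_theorem_diagonal[OF onb assms] using c_pos[of k] by (simp add: power2_eq_square)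
  finally show "inverse (c k) * (\<Sum>l=1..Z k. (c k * Y k l x)\<^sup>2) = c k * real (Z k)" .
qed

lemma kernel_eq_harmonic_series:
  assumes "x \<in> sphere 0 1" "z \<in> sphere 0 1"
  shows "\<phi> (x \<bullet> z) = harmonic_series (\<lambda>k l. c k * Y k l x) z"
proof -
  have "(\<lambda>k. c k * (\<Sum>l=1..Z k. Y k l x * Y k l z)) sums \<phi> (x \<bullet> z)"
    using sbf assms by (simp add: spherical_basis_function_def)
  moreover have "c k * (\<Sum>l=1..Z k. Y k l x * Y k l z) = component (\<lambda>k l. c k * Y k l x) k z" for k
    by (simp add: component_def sum_distrib_left mult.assoc)
  ultimately show ?thesis by (simp add: harmonic_series_def sums_iff)
qed

text \<open>For fixed \<open>x\<close> the kernel is itself an admissible series, so it may be integrated term by term.\<close>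

lemma kernel_op_eq_harmonic_series:
  assumes f: "f \<in> \<N>" and x: "x \<in> sphere 0 1"
  shows "kernel_op \<phi> f x = harmonic_series (\<lambda>k l. c k * fcoef f k l) x"
proof -
  have "kernel_op \<phi> f x = (LINT z|sphere_measure. f z * harmonic_series (\<lambda>k l. c k * Y k l x) z)"
    unfolding kernel_op_def
    by (rule Bochner_Integration.integral_cong) (simp_all add: kernel_eq_harmonic_series[OF x])
  moreover have "(\<Sum>l=1..Z k. c k * Y k l x * fcoef f k l) = component (\<lambda>k l. c k * fcoef f k l) k x" for k
    by (simp add: component_def mult_ac)
  ultimately show ?thesis
    using integral_mult_harmonic_series[OF admissible_kernel[OF x] native_spaceD(3)[OF f]]
    by (simp add: harmonic_series_def sums_iff)
qed

lemma multiplier_bounds: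
  assumes "0 < lam"
  shows "\<bar>c k\<bar> \<le> cmax" "\<bar>1 / sqrt (c k + lam)\<bar> \<le> 1 / sqrt lam" "\<bar>sqrt (c k + lam)\<bar> \<le> sqrt (cmax + lam)"
  using c_pos[of k] c_le[of k] assms by (auto intro!: divide_left_mono mult_pos_pos)

lemma kernel_op_shift:
  assumes f: "f \<in> \<N>" and lam: "0 < lam" and l: "l \<in> {1..Z k}"
  shows "fcoef (\<lambda>z. kernel_op \<phi> f z + lam * f z) k l = (c k + lam) * fcoef f k l"
    and "(\<lambda>z. kernel_op \<phi> f z + lam * f z) \<in> borel_measurable sphere_measure"
proof -
  let ?K = "harmonic_series (\<lambda>k l. c k * fcoef f k l)"
  have a: "admissible (\<lambda>k l. c k * fcoef f k l)"
    by (rule admissible_mult[OF native_spaceD(4)[OF f] multiplier_bounds(1)[OF lam]])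
  have eq: "kernel_op \<phi> f x + lam * f x = 1 * ?K x + lam * f x" if "x \<in> sphere 0 1" for x
    by (simp add: kernel_op_eq_harmonic_series[OF f that])
  have "fcoef (\<lambda>z. kernel_op \<phi> f z + lam * f z) k l = fcoef (\<lambda>z. 1 * ?K z + lam * f z) k l"
    by (simp only: fourier_coeff_cong[OF eq])
  also have "\<dots> = 1 * fcoef ?K k l + lam * fcoef f k l"
    by (rule fourier_coeff_add[OF native_spaceD(3)[OF harmonic_series_in_native_space[OF a]] native_spaceD(3)[OF f] l])
  finally show "fcoef (\<lambda>z. kernel_op \<phi> f z + lam * f z) k l = (c k + lam) * fcoef f k l"
    by (simp only: fourier_coeff_harmonic_series[OF a l]) (simp add: algebra_simps)
  have "(\<lambda>z. 1 * ?K z + lam * f z) \<in> borel_measurable sphere_measure"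
    using harmonic_series_measurable native_spaceD(1)[OF f] by simp
  then show "(\<lambda>z. kernel_op \<phi> f z + lam * f z) \<in> borel_measurable sphere_measure"
    by (subst measurable_cong[of _ _ "\<lambda>z. 1 * ?K z + lam * f z"]) (simp_all add: eq)
qed

text \<open>The operator that acts on the harmonics of degree \<open>k\<close> as multiplication by \<open>m k\<close>.\<close>

definition multiplier :: "(nat \<Rightarrow> real) \<Rightarrow> ('a \<Rightarrow> real) \<Rightarrow> 'a \<Rightarrow> real" where
  "multiplier m f = harmonic_series (\<lambda>k l. m k * fcoef f k l)"

lemma multiplier_native_space:
  assumes f: "f \<in> \<N>" and m: "\<And>k. \<bar>m k\<bar> \<le> B"
  shows "multiplier m f \<in> \<N>"
    and "l \<in> {1..Z k} \<Longrightarrow> fcoef (multiplier m f) k l = m k * fcoef f k l"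
proof -
  have a: "admissible (\<lambda>k l. m k * fcoef f k l)"
    by (rule admissible_mult[OF native_spaceD(4)[OF f] m])
  show "multiplier m f \<in> \<N>"
    unfolding multiplier_def by (rule harmonic_series_in_native_space[OF a])
  show "l \<in> {1..Z k} \<Longrightarrow> fcoef (multiplier m f) k l = m k * fcoef f k l"
    unfolding multiplier_def by (rule fourier_coeff_harmonic_series[OF a])
qed

text \<open>On the Fourier coefficients \<open>L + lam I\<close> is multiplication by \<open>c k + lam\<close>. This shows that an inverse
  square root exists, so that the operator chosen in \<open>inverse_sqrt\<close> is one.\<close>

lemma is_inverse_sqrt_multiplier:
  assumes lam: "0 < lam"
  shows "is_inverse_sqrt Z Y c (\<lambda>g z. kernel_op \<phi> g z + lam * g z) (multiplier (\<lambda>k. 1 / sqrt (c k + lam)))"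
proof -
  let ?m = "\<lambda>k. 1 / sqrt (c k + lam)"
  let ?T = "multiplier ?m"
  let ?A = "\<lambda>g z. kernel_op \<phi> g z + lam * g z"
  note mb = multiplier_bounds(2)[OF lam]
  note T = multiplier_native_space[OF _ mb]
  have cl: "0 < c k + lam" for k using c_pos[of k] lam by simp
  show ?thesis unfolding is_inverse_sqrt_def Let_def
  proof (intro conjI ballI allI)
    fix f assume f: "f \<in> \<N>"
    show "?T f \<in> \<N>" by (rule T(1)[OF f])
    show "AE x in sphere_measure. ?T (?T (?A f)) x = f x"
    proof -
      have b: "\<bar>sqrt (c k + lam)\<bar> \<le> sqrt (cmax + lam)" for k by (rule multiplier_bounds(3)[OF lam])
      let ?R = "multiplier (\<lambda>k. sqrt (c k + lam)) f"
      note R = multiplier_native_space[OF f b]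
      have "?T (?A f) = ?R"
        unfolding multiplier_def
      proof (rule harmonic_series_cong)
        fix k l assume l: "l \<in> {1..Z k}"
        have "(c k + lam) / sqrt (c k + lam) = sqrt (c k + lam)" by (rule real_div_sqrt) (use cl[of k] in simp)
        then show "?m k * fcoef (?A f) k l = sqrt (c k + lam) * fcoef f k l"
          unfolding kernel_op_shift(1)[OF f lam l] by (metis mult.assoc times_divide_eq_left mult_1)
      qed
      then have "?T (?T (?A f)) = ?T ?R" by simp
      also have "\<dots> = harmonic_series (fcoef f)"
        unfolding multiplier_def[of ?m]
      proof (rule harmonic_series_cong)
        fix k l assume l: "l \<in> {1..Z k}"
        show "?m k * fcoef ?R k l = fcoef f k l"
          unfolding R(2)[OF l] using cl[of k] by simp
      qed
      finally have e: "?T (?T (?A f)) = harmonic_series (fcoef f)" .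
      show ?thesis unfolding e
        using native_space_eq_harmonic_series[OF f] by (rule AE_mp) (intro AE_I2 impI, simp)
    qed
    show "AE x in sphere_measure. ?A (?T (?T f)) x = f x"
    proof -
      let ?h = "?T (?T f)"
      have h: "?h \<in> \<N>" by (rule T(1)[OF T(1)[OF f]])
      have hc: "fcoef ?h k l = fcoef f k l / (c k + lam)" if l: "l \<in> {1..Z k}" for k l
        unfolding T(2)[OF T(1)[OF f] l] T(2)[OF f l] using cl[of k] by simp
      have hm: "?h = harmonic_series (fcoef ?h)"
      proof -
        have "?h = harmonic_series (\<lambda>k l. ?m k * fcoef (?T f) k l)" by (simp only: multiplier_def[of ?m "?T f"])
        also have "\<dots> = harmonic_series (fcoef ?h)"
          by (rule harmonic_series_cong) (simp only: T(2)[OF T(1)[OF f]])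
        finally show ?thesis .
      qed
      have "?A ?h x = harmonic_series (fcoef f) x" if x: "x \<in> sphere 0 1" for x
      proof -
        have "?A ?h x = harmonic_series (\<lambda>k l. c k * fcoef ?h k l) x + lam * harmonic_series (fcoef ?h) x"
          by (subst kernel_op_eq_harmonic_series[OF h x]) (simp only: hm[symmetric])
        also have "\<dots> = harmonic_series (\<lambda>k l. 1 * (c k * fcoef ?h k l) + lam * fcoef ?h k l) x"
          using harmonic_series_add[OF admissible_mult[OF native_spaceD(4)[OF h] multiplier_bounds(1)[OF lam]] native_spaceD(4)[OF h] x, where s = 1 and t = lam]
          by simp
        also have "\<dots> = harmonic_series (fcoef f) x"
        proof (rule fun_cong[OF harmonic_series_cong])
          fix k l assume l: "l \<in> {1..Z k}"
          have "1 * (c k * fcoef ?h k l) + lam * fcoef ?h k l = (c k + lam) * fcoef ?h k l"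
            by (simp only: distrib_right mult_1)
          also have "\<dots> = fcoef f k l" unfolding hc[OF l] using cl[of k] by simp
          finally show "1 * (c k * fcoef ?h k l) + lam * fcoef ?h k l = fcoef f k l" .
        qed
        finally show ?thesis .
      qed
      then show ?thesis
        using native_space_eq_harmonic_series[OF f] by (elim AE_mp) (intro AE_I2 impI, simp)
    qed
    show "0 \<le> native_inner Z Y c (?T f) f"
    proof -
      let ?t = "\<lambda>k. inverse (c k) * (\<Sum>l=1..Z k. fcoef (?T f) k l * fcoef f k l)"
      have t: "?t k = ?m k * (inverse (c k) * (\<Sum>l=1..Z k. (fcoef f k l)\<^sup>2))" for k
      proof -
        have "(\<Sum>l=1..Z k. fcoef (?T f) k l * fcoef f k l) = (\<Sum>l=1..Z k. ?m k * (fcoef f k l)\<^sup>2)"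
          by (intro sum.cong refl) (simp add: T(2)[OF f] power2_eq_square)
        then show ?thesis by (simp only: sum_distrib_left[symmetric] mult.left_commute)
      qed
      have nn: "0 \<le> inverse (c k) * (\<Sum>l=1..Z k. (fcoef f k l)\<^sup>2)" for k
        using c_pos[of k] by (intro mult_nonneg_nonneg sum_nonneg) auto
      have "summable (\<lambda>k. inverse (c k) * (\<Sum>l=1..Z k. (fcoef f k l)\<^sup>2))"
        using native_spaceD(4)[OF f] by (simp only: admissible_def)
      then have "summable ?t"
        unfolding t
      proof (rule summable_comparison_test'[OF summable_mult[of _ "1 / sqrt lam"], of _ 0])
        fix k
        show "norm (?m k * (inverse (c k) * (\<Sum>l=1..Z k. (fcoef f k l)\<^sup>2)))
            \<le> 1 / sqrt lam * (inverse (c k) * (\<Sum>l=1..Z k. (fcoef f k l)\<^sup>2))"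
          unfolding real_norm_def abs_mult[of "?m k"] abs_of_nonneg[OF nn] by (rule mult_right_mono[OF mb nn])
      qed
      moreover have "0 \<le> ?t k" for k unfolding t using nn[of k] cl[of k] by simp
      ultimately show ?thesis unfolding native_inner_def by (rule suminf_nonneg)
    qed
  next
    fix f g and s t :: real assume f: "f \<in> \<N>" and g: "g \<in> \<N>"
    show "native_inner Z Y c (?T f) g = native_inner Z Y c f (?T g)"
      unfolding native_inner_def
      by (intro suminf_cong arg_cong[where f = "(*) _"] sum.cong refl) (simp add: T(2)[OF f] T(2)[OF g])
    show "AE x in sphere_measure. ?T (\<lambda>z. s * f z + t * g z) x = s * ?T f x + t * ?T g x"
    proof (rule AE_I2)
      fix x :: 'a assume "x \<in> space sphere_measure"
      then have x: "x \<in> sphere 0 1" by simp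
      have "?T (\<lambda>z. s * f z + t * g z) = harmonic_series (\<lambda>k l. s * (?m k * fcoef f k l) + t * (?m k * fcoef g k l))"
        unfolding multiplier_def
      proof (rule harmonic_series_cong)
        fix k l assume l: "l \<in> {1..Z k}"
        show "?m k * fcoef (\<lambda>z. s * f z + t * g z) k l = s * (?m k * fcoef f k l) + t * (?m k * fcoef g k l)"
          unfolding fourier_coeff_add[OF native_spaceD(3)[OF f] native_spaceD(3)[OF g] l] by (simp only: distrib_left mult.left_commute)
      qed
      then show "?T (\<lambda>z. s * f z + t * g z) x = s * ?T f x + t * ?T g x"
        using harmonic_series_add[OF admissible_mult[OF native_spaceD(4)[OF f] mb] admissible_mult[OF native_spaceD(4)[OF g] mb] x, where s = s and t = t]
        by (simp only: multiplier_def)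
    qed
  qed
qed

text \<open>The value is the same for every inverse square root \<open>T\<close>: by symmetry the square of the norm is the inner
  product of \<open>g\<close> and \<open>T (T g)\<close>, and \<open>L + lam I\<close> maps \<open>T (T g)\<close> to \<open>g\<close>, which determines its coefficients.\<close>

lemma native_norm_inverse_sqrt:
  assumes T: "is_inverse_sqrt Z Y c (\<lambda>g z. kernel_op \<phi> g z + lam * g z) T" and lam: "0 < lam"
    and g: "g \<in> \<N>"
  shows "native_norm Z Y c (T g)
       = sqrt (\<Sum>k. inverse (c k) * (1 / (c k + lam)) * (\<Sum>l=1..Z k. (fcoef g k l)\<^sup>2))"
proof -
  let ?A = "\<lambda>g z. kernel_op \<phi> g z + lam * g z"
  have Tg: "T g \<in> \<N>" and TTg: "T (T g) \<in> \<N>" using T g by (auto simp: is_inverse_sqrt_def Let_def)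
  have sym: "native_inner Z Y c (T g) (T g) = native_inner Z Y c g (T (T g))"
    using T g Tg by (simp only: is_inverse_sqrt_def Let_def)
  have AE: "AE x in sphere_measure. ?A (T (T g)) x = g x"
    using T g by (simp only: is_inverse_sqrt_def Let_def)
  have TTg_coeff: "fcoef (T (T g)) k l = fcoef g k l / (c k + lam)" if l: "l \<in> {1..Z k}" for k l
  proof -
    have "(c k + lam) * fcoef (T (T g)) k l = fcoef (?A (T (T g))) k l"
      by (rule kernel_op_shift(1)[OF TTg lam l, symmetric])
    also have "\<dots> = fcoef g k l"
      by (rule fourier_coeff_cong_AE[OF AE kernel_op_shift(2)[OF TTg lam l] native_spaceD(1)[OF g] l])
    finally show ?thesis using c_pos[of k] lam by (simp add: field_simps)
  qed
  have "native_norm Z Y c (T g) = sqrt (native_inner Z Y c (T g) (T g))"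
    by (simp add: native_norm_def native_inner_def power2_eq_square)
  also have "native_inner Z Y c (T g) (T g)
      = (\<Sum>k. inverse (c k) * (1 / (c k + lam)) * (\<Sum>l=1..Z k. (fcoef g k l)\<^sup>2))"
  proof -
    have e: "inverse (c k) * (\<Sum>l=1..Z k. fcoef g k l * fcoef (T (T g)) k l)
        = inverse (c k) * (1 / (c k + lam)) * (\<Sum>l=1..Z k. (fcoef g k l)\<^sup>2)" for k
    proof -
      have "(\<Sum>l=1..Z k. fcoef g k l * fcoef (T (T g)) k l)
        = (\<Sum>l=1..Z k. 1 / (c k + lam) * (fcoef g k l)\<^sup>2)"
        by (intro sum.cong refl) (simp add: TTg_coeff power2_eq_square)
      then show ?thesis by (simp only: sum_distrib_left[symmetric] mult.assoc)
    qed
    show ?thesis unfolding sym unfolding native_inner_def e ..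
  qed
  finally show ?thesis .
qed

text \<open>The inner product in the native space of \<open>(L + lam I)\<^bsup>-1/2\<^esup> \<phi>\<^bsub>x\<^esub>\<close> and \<open>(L + lam I)\<^bsup>-1/2\<^esup> \<phi>\<^bsub>z\<^esub>\<close>.\<close>

definition gram :: "real \<Rightarrow> 'a \<Rightarrow> 'a \<Rightarrow> real" where
  "gram lam x z = (\<Sum>k. c k / (c k + lam) * (\<Sum>l=1..Z k. Y k l x * Y k l z))"

lemma summable_gram:
  assumes lam: "0 < lam" and x: "x \<in> sphere 0 1" and z: "z \<in> sphere 0 1"
  shows "summable (\<lambda>k. c k / (c k + lam) * (\<Sum>l=1..Z k. Y k l x * Y k l z))"
proof (rule summable_comparison_test'[OF summable_mult[OF summable_cZ, of "1 / lam"], of 0])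
  fix k
  have "(\<Sum>l=1..Z k. Y k l x * Y k l z)\<^sup>2 \<le> (\<Sum>l=1..Z k. (Y k l x)\<^sup>2) * (\<Sum>l=1..Z k. (Y k l z)\<^sup>2)"
    by (rule Cauchy_Schwarz_ineq_sum)
  also have "\<dots> = (real (Z k))\<^sup>2"
    unfolding addition_theorem_diagonal[OF onb x] addition_theorem_diagonal[OF onb z] by (simp add: power2_eq_square)
  finally have "\<bar>\<Sum>l=1..Z k. Y k l x * Y k l z\<bar> \<le> real (Z k)"
    by (simp only: abs_le_square_iff[symmetric] abs_of_nat)
  moreover have "c k / (c k + lam) \<le> c k / lam" "0 \<le> c k / (c k + lam)"
    using c_pos[of k] lam by (auto intro!: divide_left_mono)
  ultimately have "c k / (c k + lam) * \<bar>\<Sum>l=1..Z k. Y k l x * Y k l z\<bar> \<le> c k / lam * real (Z k)"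
    using c_pos[of k] lam by (intro mult_mono) auto
  then show "norm (c k / (c k + lam) * (\<Sum>l=1..Z k. Y k l x * Y k l z)) \<le> 1 / lam * (c k * real (Z k))"
    using c_pos[of k] lam by (simp add: abs_mult)
qed

lemma gram_sym: "gram lam x z = gram lam z x"
  by (simp add: gram_def mult.commute)

lemma gram_diagonal:
  assumes "x \<in> sphere 0 1"
  shows "gram lam x x = (\<Sum>k. c k / (c k + lam) * real (Z k))"
  unfolding gram_def power2_eq_square[symmetric] addition_theorem_diagonal[OF onb assms] ..

lemma gram_quadratic_form:
  assumes lam: "0 < lam" and I: "finite I" and x: "\<And>i. i \<in> I \<Longrightarrow> x i \<in> sphere 0 1"
  shows "(\<lambda>k. c k / (c k + lam) * (\<Sum>l=1..Z k. (\<Sum>i\<in>I. v i * Y k l (x i))\<^sup>2))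
      sums (\<Sum>i\<in>I. \<Sum>j\<in>I. v i * v j * gram lam (x i) (x j))"
proof -
  have "(\<lambda>k. \<Sum>i\<in>I. \<Sum>j\<in>I. v i * v j * (c k / (c k + lam) * (\<Sum>l=1..Z k. Y k l (x i) * Y k l (x j))))
      sums (\<Sum>i\<in>I. \<Sum>j\<in>I. v i * v j * gram lam (x i) (x j))"
    unfolding gram_def by (intro sums_sum sums_mult summable_sums summable_gram lam x)
  moreover have "(\<Sum>i\<in>I. \<Sum>j\<in>I. v i * v j * (c k / (c k + lam) * (\<Sum>l=1..Z k. Y k l (x i) * Y k l (x j))))
     = c k / (c k + lam) * (\<Sum>l=1..Z k. (\<Sum>i\<in>I. v i * Y k l (x i))\<^sup>2)" for k
  proof -
    have "(\<Sum>l=1..Z k. (\<Sum>i\<in>I. v i * Y k l (x i))\<^sup>2) = (\<Sum>l=1..Z k. \<Sum>i\<in>I. \<Sum>j\<in>I. v i * v j * (Y k l (x i) * Y k l (x j)))"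
      by (simp add: power2_eq_square sum_product mult_ac)
    also have "\<dots> = (\<Sum>i\<in>I. \<Sum>l=1..Z k. \<Sum>j\<in>I. v i * v j * (Y k l (x i) * Y k l (x j)))"
      by (rule sum.swap)
    also have "\<dots> = (\<Sum>i\<in>I. \<Sum>j\<in>I. \<Sum>l=1..Z k. v i * v j * (Y k l (x i) * Y k l (x j)))"
      by (intro sum.cong refl sum.swap)
    finally show ?thesis by (simp only: sum_distrib_left mult.left_commute mult.assoc)
  qed
  ultimately show ?thesis by simp
qed

text \<open>A combination of kernel functions is an admissible series, whose coefficients are those combinations of
  \<open>c k * Y k l (x i)\<close>. One factor \<open>c k\<close> of their squares cancels against the weight of the native norm.\<close>

lemma native_norm_kernel_combination:
  assumes lam: "0 < lam" and I: "finite I" and x: "\<And>i. i \<in> I \<Longrightarrow> x i \<in> sphere 0 1"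
  shows "native_norm Z Y c (inverse_sqrt Z Y c (\<lambda>g z. kernel_op \<phi> g z + lam * g z) (\<lambda>z. \<Sum>i\<in>I. v i * \<phi> (x i \<bullet> z)))
      = sqrt (\<Sum>i\<in>I. \<Sum>j\<in>I. v i * v j * gram lam (x i) (x j))"
proof -
  let ?A = "\<lambda>g z. kernel_op \<phi> g z + lam * g z"
  let ?g = "\<lambda>z. \<Sum>i\<in>I. v i * \<phi> (x i \<bullet> z)"
  define T where "T = inverse_sqrt Z Y c ?A"
  have T: "is_inverse_sqrt Z Y c ?A T"
    unfolding T_def inverse_sqrt_def by (rule someI[of "is_inverse_sqrt Z Y c ?A"], rule is_inverse_sqrt_multiplier[OF lam])
  define a where "a k l = c k * (\<Sum>i\<in>I. v i * Y k l (x i))" for k l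
  have ak: "a = (\<lambda>k l. \<Sum>i\<in>I. v i * (c k * Y k l (x i)))"
    by (simp add: a_def fun_eq_iff sum_distrib_left mult.left_commute)
  have sq: "inverse (c k) * (1 / (c k + lam)) * (\<Sum>l=1..Z k. (a k l)\<^sup>2)
      = c k / (c k + lam) * (\<Sum>l=1..Z k. (\<Sum>i\<in>I. v i * Y k l (x i))\<^sup>2)" for k
  proof -
    have "(\<Sum>l=1..Z k. (a k l)\<^sup>2) = (c k)\<^sup>2 * (\<Sum>l=1..Z k. (\<Sum>i\<in>I. v i * Y k l (x i))\<^sup>2)"
      unfolding a_def power_mult_distrib by (rule sum_distrib_left[symmetric])
    then show ?thesis using c_pos[of k] by (simp add: power2_eq_square)
  qed
  have "admissible a \<and> (\<forall>z\<in>sphere 0 1. harmonic_series a z = ?g z)"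
    using I x unfolding ak
  proof (induction I rule: finite_induct)
    case empty
    show ?case by (simp add: admissible_def harmonic_series_def component_def)
  next
    case (insert i I)
    let ?b = "\<lambda>k l. c k * Y k l (x i)" and ?a = "\<lambda>k l. \<Sum>i\<in>I. v i * (c k * Y k l (x i))"
    have b: "admissible ?b" by (rule admissible_kernel[OF insert.prems]) simp
    have IH: "admissible ?a" "\<And>z. z \<in> sphere 0 1 \<Longrightarrow> harmonic_series ?a z = (\<Sum>i\<in>I. v i * \<phi> (x i \<bullet> z))"
      using insert.IH insert.prems by auto
    have e: "(\<lambda>k l. \<Sum>i\<in>insert i I. v i * (c k * Y k l (x i))) = (\<lambda>k l. v i * ?b k l + 1 * ?a k l)"
      using insert.hyps by (simp add: fun_eq_iff)
    have "admissible (\<lambda>k l. v i * ?b k l + 1 * ?a k l)" by (rule admissible_add[OF b IH(1)])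
    moreover have "harmonic_series (\<lambda>k l. v i * ?b k l + 1 * ?a k l) z = (\<Sum>i\<in>insert i I. v i * \<phi> (x i \<bullet> z))"
      if z: "z \<in> sphere 0 1" for z
      using harmonic_series_add[OF b IH(1) z, where s = "v i" and t = 1] IH(2)[OF z] kernel_eq_harmonic_series[OF _ z, of "x i"]
        insert.hyps insert.prems by simp
    ultimately show ?case unfolding e by blast
  qed
  then have a: "admissible a" "\<And>z. z \<in> sphere 0 1 \<Longrightarrow> ?g z = harmonic_series a z" by auto
  have g: "?g \<in> \<N>" "fcoef ?g = fcoef (harmonic_series a)"
    by (rule native_space_cong[OF harmonic_series_in_native_space[OF a(1)] a(2)], assumption)+
  have gc: "(\<Sum>l=1..Z k. (fcoef ?g k l)\<^sup>2) = (\<Sum>l=1..Z k. (a k l)\<^sup>2)" for k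
    unfolding g(2) by (intro sum.cong refl) (simp only: fourier_coeff_harmonic_series[OF a(1)])
  show ?thesis
    unfolding T_def[symmetric] native_norm_inverse_sqrt[OF T lam g(1)] gc sq
    using gram_quadratic_form[OF lam I x, where v = v] by (simp add: sums_iff)
qed

end

section \<open>The bound for the sampling error\<close>

text \<open>Smaller exponents give larger native spaces because
  \<open>c k powr - \<beta> \<le> B powr (\<alpha> - \<beta>) * c k powr - \<alpha>\<close>.\<close>

lemma native_space_powr_mono:
  assumes f: "f \<in> native_space Z Y (\<lambda>k. c k powr \<alpha>)" and c: "\<And>k. 0 < c k" "\<And>k. c k \<le> B" and ab: "\<beta> \<le> \<alpha>"
  shows "f \<in> native_space Z Y (\<lambda>k. c k powr \<beta>)"
proof -
  define s where "s k = (\<Sum>l=1..Z k. (fourier_coeff Y f k l)\<^sup>2)" for k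
  have s0: "0 \<le> s k" for k by (simp add: s_def sum_nonneg)
  have "summable (\<lambda>k. inverse (c k powr \<alpha>) * s k)"
    using f by (simp add: native_space_def s_def)
  then have "summable (\<lambda>k. inverse (c k powr \<beta>) * s k)"
  proof (rule summable_comparison_test'[OF summable_mult[of _ "B powr (\<alpha> - \<beta>)"], of _ 0])
    fix k
    have "inverse (c k powr \<beta>) = c k powr (\<alpha> - \<beta>) * inverse (c k powr \<alpha>)"
      using c(1)[of k] by (simp add: powr_minus[symmetric] powr_add[symmetric])
    also have "\<dots> \<le> B powr (\<alpha> - \<beta>) * inverse (c k powr \<alpha>)"
      using c(1)[of k] c(2)[of k] ab by (intro mult_right_mono powr_mono2) auto
    finally have "inverse (c k powr \<beta>) * s k \<le> B powr (\<alpha> - \<beta>) * inverse (c k powr \<alpha>) * s k"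
      using s0[of k] by (rule mult_right_mono)
    then show "norm (inverse (c k powr \<beta>) * s k) \<le> B powr (\<alpha> - \<beta>) * (inverse (c k powr \<alpha>) * s k)"
      using s0[of k] by (simp add: mult.assoc)
  qed
  then show ?thesis using f by (simp add: native_space_def s_def)
qed

theorem proposition3p4:
  fixes d :: nat and \<gamma> M c\<^sub>0 c\<^sub>1 c\<^sub>2 :: real
  assumes "DIM('a::euclidean_space) = d + 1" and "1 \<le> d"
    and "\<gamma> > real d / 2" and "M > 0" and "0 < c\<^sub>0" and "0 < c\<^sub>1" and "0 < c\<^sub>2"
  shows "\<exists>C\<^sub>6 > 0.
    \<forall>(Z :: nat \<Rightarrow> nat) (Y :: nat \<Rightarrow> nat \<Rightarrow> 'a \<Rightarrow> real) (\<phi> :: real \<Rightarrow> real)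
      (\<phi>hat :: nat \<Rightarrow> real) (\<psi>hat :: nat \<Rightarrow> real) (varphihat :: nat \<Rightarrow> real) (\<alpha> :: real) (\<beta> :: real)
      (\<Lambda> :: 'a set) (x :: nat \<Rightarrow> 'a) (f :: 'a \<Rightarrow> real) (P :: 'w measure)
      (\<epsilon> :: nat \<Rightarrow> 'w \<Rightarrow> real) (y :: nat \<Rightarrow> 'w \<Rightarrow> real) (lam :: real) (w :: nat \<Rightarrow> real) (\<delta> :: real).
      harmonic_onb Z Y \<longrightarrow>
      spherical_basis_function Z Y \<phi>hat \<phi> \<longrightarrow>
      (\<forall>k\<ge>1. c\<^sub>1 * real k powr (- 2 * \<gamma>) \<le> \<phi>hat k \<and> \<phi>hat k \<le> c\<^sub>2 * real k powr (- 2 * \<gamma>)) \<longrightarrow>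
      \<phi>hat 0 \<le> c\<^sub>0 \<longrightarrow>
      (\<forall>k. \<psi>hat k = \<phi>hat k powr \<beta>) \<longrightarrow>
      (\<forall>k. varphihat k = \<phi>hat k powr \<alpha>) \<longrightarrow>
      0 \<le> \<beta> \<longrightarrow> \<beta> \<le> 1 \<longrightarrow> \<beta> \<le> \<alpha> \<longrightarrow>
      finite \<Lambda> \<longrightarrow> \<Lambda> \<noteq> {} \<longrightarrow> \<Lambda> \<subseteq> sphere 0 1 \<longrightarrow> bij_betw x {1..card \<Lambda>} \<Lambda> \<longrightarrow>
      f \<in> native_space Z Y varphihat \<longrightarrow>
      prob_space P \<longrightarrow>
      prob_space.indep_vars P (\<lambda>_. borel) \<epsilon> {1..card \<Lambda>} \<longrightarrow>
      (\<forall>i\<in>{1..card \<Lambda>}. sub_gaussian P (\<epsilon> i) \<and> sub_gaussian_norm P (\<epsilon> i) = M) \<longrightarrow>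
      (\<forall>i\<in>{1..card \<Lambda>}. \<forall>\<omega>\<in>space P. y i \<omega> = f (x i) + \<epsilon> i \<omega>) \<longrightarrow>
      0 < lam \<longrightarrow>
      (\<forall>i\<in>{1..card \<Lambda>}. 0 < w i) \<longrightarrow>
      0 < \<delta> \<longrightarrow> \<delta> < 1 \<longrightarrow>
      measure P {\<omega> \<in> space P.
          sampling_error Z Y \<phi>hat \<psi>hat \<phi> lam (card \<Lambda>) x w (\<lambda>i. y i \<omega>) f
            \<le> C\<^sub>6 * lam powr (- real d / (4 * \<gamma>))
               * sqrt ((\<Sum>i=1..card \<Lambda>. (w i)\<^sup>2) + (Max (w ` {1..card \<Lambda>}))\<^sup>2)
               * ln (6 / \<delta>)}
        \<ge> 1 - \<delta>"
proof -
  define \<theta> where "\<theta> = real d / (2 * \<gamma>)"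
  define D where "D = 2 * c\<^sub>0 powr \<theta> + (2 * 2 ^ d + 2 * 4 ^ d / (1 - 2 powr (real d - 2 * \<gamma>))) * c\<^sub>2 powr \<theta>"
  have "2 powr (real d - 2 * \<gamma>) < 1" using assms(3) by (simp add: powr_less_one)
  then have D: "D > 0" using assms(5,7) by (auto simp: D_def intro!: add_pos_nonneg mult_nonneg_nonneg)
  have \<gamma>0: "\<gamma> > 0" using assms(2,3) by (auto intro: order.strict_trans1[OF _ assms(3)])
  define C where "C = sqrt (10 * M\<^sup>2 * D)"
  have C: "C > 0" using D assms(4) by (simp add: C_def)
  show ?thesis
  proof (intro exI[of _ C] conjI allI impI, rule C)
    fix Z :: "nat \<Rightarrow> nat" and Y :: "nat \<Rightarrow> nat \<Rightarrow> 'a \<Rightarrow> real" and \<phi> :: "real \<Rightarrow> real"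
      and \<phi>hat \<psi>hat varphihat :: "nat \<Rightarrow> real" and \<alpha> \<beta> :: real and \<Lambda> :: "'a set" and x :: "nat \<Rightarrow> 'a"
      and f :: "'a \<Rightarrow> real" and P :: "'w measure" and \<epsilon> y :: "nat \<Rightarrow> 'w \<Rightarrow> real" and lam :: real
      and w :: "nat \<Rightarrow> real" and \<delta> :: real
    assume onb: "harmonic_onb Z Y" and sbf: "spherical_basis_function Z Y \<phi>hat \<phi>"
      and decay: "\<forall>k\<ge>1. c\<^sub>1 * real k powr (- 2 * \<gamma>) \<le> \<phi>hat k \<and> \<phi>hat k \<le> c\<^sub>2 * real k powr (- 2 * \<gamma>)"
      and hat0: "\<phi>hat 0 \<le> c\<^sub>0"
      and \<psi>: "\<forall>k. \<psi>hat k = \<phi>hat k powr \<beta>" and varphi: "\<forall>k. varphihat k = \<phi>hat k powr \<alpha>"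
      and \<beta>: "0 \<le> \<beta>" "\<beta> \<le> 1" "\<beta> \<le> \<alpha>"
      and \<Lambda>: "finite \<Lambda>" "\<Lambda> \<noteq> {}" "\<Lambda> \<subseteq> sphere 0 1" and x: "bij_betw x {1..card \<Lambda>} \<Lambda>"
      and f: "f \<in> native_space Z Y varphihat" and P: "prob_space P"
      and ind: "prob_space.indep_vars P (\<lambda>_. borel) \<epsilon> {1..card \<Lambda>}"
      and sg: "\<forall>i\<in>{1..card \<Lambda>}. sub_gaussian P (\<epsilon> i) \<and> sub_gaussian_norm P (\<epsilon> i) = M"
      and y: "\<forall>i\<in>{1..card \<Lambda>}. \<forall>\<omega>\<in>space P. y i \<omega> = f (x i) + \<epsilon> i \<omega>"
      and lam: "0 < lam" and w: "\<forall>i\<in>{1..card \<Lambda>}. 0 < w i" and \<delta>: "0 < \<delta>" "\<delta> < 1"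
    interpret P: prob_space P by (rule P)
    let ?I = "{1..card \<Lambda>}"
    have I: "finite ?I" "?I \<noteq> {}" using \<Lambda> card_gt_0_iff[of \<Lambda>] by (auto simp: Suc_le_eq)
    have xs: "x i \<in> sphere 0 1" if "i \<in> ?I" for i
      by (rule subsetD[OF \<Lambda>(3)], rule bij_betw_apply[OF x that])
    have hat_pos: "0 < \<phi>hat k" for k using sbf by (simp add: spherical_basis_function_def)
    have hat_le: "\<phi>hat k \<le> max c\<^sub>0 c\<^sub>2" for k
    proof (cases "k = 0")
      case False
      then have "real k powr (- 2 * \<gamma>) \<le> 1 powr (- 2 * \<gamma>)" using \<gamma>0 by (intro powr_mono2') auto
      then have "c\<^sub>2 * real k powr (- 2 * \<gamma>) \<le> c\<^sub>2 * 1" using assms(7) by (intro mult_left_mono) auto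
      moreover have "\<phi>hat k \<le> c\<^sub>2 * real k powr (- 2 * \<gamma>)" using decay False by simp
      ultimately show ?thesis by linarith
    qed (use hat0 in simp)
    interpret K: harmonic_kernel Z Y \<phi>hat \<phi> "max c\<^sub>0 c\<^sub>2"
      by unfold_locales (use onb sbf hat_le assms(1,2) in auto)
    have f\<psi>: "f \<in> native_space Z Y \<psi>hat"
    proof -
      have e: "\<psi>hat = (\<lambda>k. \<phi>hat k powr \<beta>)" "varphihat = (\<lambda>k. \<phi>hat k powr \<alpha>)"
        using \<psi> varphi by (auto simp: fun_eq_iff)
      show ?thesis
        unfolding e(1) by (rule native_space_powr_mono[OF f[unfolded e(2)] hat_pos hat_le \<beta>(3)])
    qed
    \<comment> \<open>The Gram matrix of the images of the weighted kernel functions: the error is the root of this form.\<close>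
    define Q where "Q i j = w i * w j * K.gram lam (x i) (x j)" for i j
    have Q_form: "quad_form Q J e = (\<Sum>i\<in>J. \<Sum>j\<in>J. (w i * e i) * (w j * e j) * K.gram lam (x i) (x j))" for J e
      unfolding quad_form_def Q_def by (intro sum.cong refl) simp
    have Q_sym: "Q i j = Q j i" for i j by (simp add: Q_def K.gram_sym[of lam "x i"])
    have Q_psd: "0 \<le> quad_form Q J e" if "J \<subseteq> ?I" for J e
    proof (rule sums_le)
      have J: "finite J" "\<And>i. i \<in> J \<Longrightarrow> x i \<in> sphere 0 1"
        by (rule finite_subset[OF that I(1)], rule xs[OF subsetD[OF that]])
      show "(\<lambda>k. \<phi>hat k / (\<phi>hat k + lam) * (\<Sum>l=1..Z k. (\<Sum>i\<in>J. w i * e i * Y k l (x i))\<^sup>2)) sums quad_form Q J e"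
        unfolding Q_form by (rule K.gram_quadratic_form[OF lam J])
      show "(\<lambda>_. 0) sums (0::real)" by simp
      show "0 \<le> \<phi>hat k / (\<phi>hat k + lam) * (\<Sum>l=1..Z k. (\<Sum>i\<in>J. w i * e i * Y k l (x i))\<^sup>2)" for k
        using hat_pos[of k] lam by (intro mult_nonneg_nonneg sum_nonneg) auto
    qed
    define S where "S = (\<Sum>i\<in>?I. (w i)\<^sup>2)"
    have S: "S > 0"
      unfolding S_def
    proof (rule sum_pos[OF I])
      fix i assume "i \<in> ?I"
      then have "0 < w i" using w by blast
      then show "0 < (w i)\<^sup>2" by simp
    qed
    define V where "V = D * lam powr (- \<theta>) * S"
    have V: "V > 0" using D S lam by (simp add: V_def)
    have trace: "(\<Sum>i\<in>?I. Q i i) \<le> V"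
    proof -
      have "K.gram lam (x i) (x i) \<le> D * lam powr (- \<theta>)" if "i \<in> ?I" for i
      proof -
        have "summable (\<lambda>k. \<phi>hat k / (\<phi>hat k + lam) * real (Z k))"
          using K.summable_gram[OF lam xs[OF that] xs[OF that]]
          unfolding power2_eq_square[symmetric] addition_theorem_diagonal[OF onb xs[OF that]] .
        moreover have "(\<Sum>k<n. \<phi>hat k / (\<phi>hat k + lam) * real (Z k)) \<le> D * lam powr (- \<theta>)" for n
          unfolding D_def \<theta>_def minus_divide_left
          by (rule effective_dimension_bound[where c = \<phi>hat, OF sum_harmonic_dimensions_le[OF onb assms(1,2)]
                assms(3,2,5,7) lam hat_pos hat0]) (use decay in simp)
        ultimately show ?thesis unfolding K.gram_diagonal[OF xs[OF that]] by (intro suminf_le_const) auto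
      qed
      then have "(\<Sum>i\<in>?I. Q i i) \<le> (\<Sum>i\<in>?I. (w i)\<^sup>2 * (D * lam powr (- \<theta>)))"
        unfolding Q_def power2_eq_square by (intro sum_mono mult_left_mono) auto
      also have "\<dots> = S * (D * lam powr (- \<theta>))" unfolding S_def by (rule sum_distrib_right[symmetric])
      finally show ?thesis by (simp only: V_def mult.commute[of S])
    qed
    \<comment> \<open>As \<open>exp (1 / 2) \<le> 3\<close>, the bound \<open>exp (1 / 2 - L) \<le> \<delta> / 2\<close> leaves room.\<close>
    define L where "L = ln (6 / \<delta>)"
    have L: "L \<ge> 1"
    proof -
      have "exp 1 \<le> (3::real)" by (rule exp_le)
      also have "\<dots> \<le> 6 / \<delta>" using \<delta> by (simp add: field_simps)
      finally show ?thesis using \<delta> by (simp add: L_def ln_ge_iff)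
    qed
    define q where "q \<omega> = quad_form Q ?I (\<lambda>i. \<epsilon> i \<omega>)" for \<omega>
    have q0: "0 \<le> q \<omega>" for \<omega> unfolding q_def by (rule Q_psd) simp
    have qm: "q \<in> borel_measurable P"
      unfolding q_def quad_form_def using sg
      by (intro borel_measurable_sum borel_measurable_times) (auto simp: sub_gaussian_def)
    have "measure P {\<omega> \<in> space P. q \<omega> > 10 * M\<^sup>2 * V * L} \<le> exp (1 / 2 - L)"
      unfolding q_def
      by (rule sub_gaussian_quad_form_tail[OF P ind I assms(4) _ _ Q_sym Q_psd trace V]) (use sg in auto)
    also have "\<dots> = exp (1 / 2) * (\<delta> / 6)" using \<delta> by (simp add: L_def exp_diff)
    also have "\<dots> \<le> 3 * (\<delta> / 6)"
    proof (rule mult_right_mono)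
      have "exp (1 / 2 :: real) \<le> exp 1" by simp
      then show "exp (1 / 2 :: real) \<le> 3" using exp_le by linarith
    qed (use \<delta> in simp)
    also have "\<dots> \<le> \<delta>" using \<delta> by simp
    finally have tail: "measure P {\<omega> \<in> space P. q \<omega> > 10 * M\<^sup>2 * V * L} \<le> \<delta>" .
    let ?err = "\<lambda>\<omega>. sampling_error Z Y \<phi>hat \<psi>hat \<phi> lam (card \<Lambda>) x w (\<lambda>i. y i \<omega>) f"
    let ?bound = "C * lam powr (- real d / (4 * \<gamma>)) * sqrt ((\<Sum>i=1..card \<Lambda>. (w i)\<^sup>2) + (Max (w ` {1..card \<Lambda>}))\<^sup>2) * ln (6 / \<delta>)"
    have err: "?err \<omega> = sqrt (q \<omega>)" if \<omega>: "\<omega> \<in> space P" for \<omega>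
    proof -
      have "(\<lambda>z. weighted_adjoint \<phi> (card \<Lambda>) x w (\<lambda>i. y i \<omega>) z - weighted_sampling_op Z Y \<psi>hat \<phi> (card \<Lambda>) x w f z)
          = (\<lambda>z. \<Sum>i\<in>?I. (w i * \<epsilon> i \<omega>) * \<phi> (x i \<bullet> z))"
      proof
        fix z
        have "weighted_adjoint \<phi> (card \<Lambda>) x w (\<lambda>i. y i \<omega>) z - weighted_sampling_op Z Y \<psi>hat \<phi> (card \<Lambda>) x w f z
            = (\<Sum>i\<in>?I. w i * y i \<omega> * \<phi> (x i \<bullet> z) - w i * f (x i) * \<phi> (x i \<bullet> z))"
          unfolding weighted_adjoint_def weighted_sampling_op_def restrict_apply' [OF f\<psi>] sum_subtractf ..
        also have "\<dots> = (\<Sum>i\<in>?I. (w i * \<epsilon> i \<omega>) * \<phi> (x i \<bullet> z))"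
        proof (rule sum.cong[OF refl])
          fix i assume "i \<in> ?I"
          then have "y i \<omega> = f (x i) + \<epsilon> i \<omega>" using y \<omega> by blast
          then show "w i * y i \<omega> * \<phi> (x i \<bullet> z) - w i * f (x i) * \<phi> (x i \<bullet> z) = (w i * \<epsilon> i \<omega>) * \<phi> (x i \<bullet> z)"
            by (simp add: algebra_simps)
        qed
        finally show "weighted_adjoint \<phi> (card \<Lambda>) x w (\<lambda>i. y i \<omega>) z - weighted_sampling_op Z Y \<psi>hat \<phi> (card \<Lambda>) x w f z
            = (\<Sum>i\<in>?I. (w i * \<epsilon> i \<omega>) * \<phi> (x i \<bullet> z))" .
      qed
      then show ?thesis
        unfolding sampling_error_def q_def Q_form
        by (simp only: K.native_norm_kernel_combination[OF lam I(1) xs])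
    qed
    have bound: "sqrt (10 * M\<^sup>2 * V * L) \<le> ?bound"
    proof -
      \<comment> \<open>The tail bound has \<open>sqrt L\<close>, which \<open>L \<ge> 1\<close> allows to replace by \<open>L\<close>.\<close>
      have "sqrt (10 * M\<^sup>2 * V * L) \<le> sqrt (10 * M\<^sup>2 * V * L\<^sup>2)"
        using L V by (intro real_sqrt_le_mono mult_left_mono) (auto simp: power2_eq_square)
      also have "\<dots> = C * sqrt (lam powr (- \<theta>)) * sqrt S * L"
        using L by (simp add: C_def V_def real_sqrt_mult mult_ac)
      also have "sqrt (lam powr (- \<theta>)) = lam powr (- real d / (4 * \<gamma>))"
        using lam by (simp add: powr_half_sqrt[symmetric] powr_powr \<theta>_def)
      also have "C * lam powr (- real d / (4 * \<gamma>)) * sqrt S * L \<le> ?bound"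
        unfolding L_def[symmetric] S_def using C L by (intro mult_right_mono mult_left_mono real_sqrt_le_mono) auto
      finally show ?thesis .
    qed
    have sub: "space P - {\<omega> \<in> space P. q \<omega> > 10 * M\<^sup>2 * V * L} \<subseteq> {\<omega> \<in> space P. ?err \<omega> \<le> ?bound}"
    proof safe
      fix \<omega> assume \<omega>: "\<omega> \<in> space P" and "\<not> 10 * M\<^sup>2 * V * L < q \<omega>"
      then have "sqrt (q \<omega>) \<le> sqrt (10 * M\<^sup>2 * V * L)" by (intro real_sqrt_le_mono) simp
      then show "?err \<omega> \<le> ?bound" using bound err[OF \<omega>] by linarith
    qed
    have meas: "{\<omega> \<in> space P. ?err \<omega> \<le> ?bound} \<in> sets P"
    proof -
      have "{\<omega> \<in> space P. ?err \<omega> \<le> ?bound} = {\<omega> \<in> space P. sqrt (q \<omega>) \<le> ?bound}" using err by auto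
      also have "\<dots> \<in> sets P" using qm by measurable
      finally show ?thesis .
    qed
    have "1 - \<delta> \<le> 1 - measure P {\<omega> \<in> space P. q \<omega> > 10 * M\<^sup>2 * V * L}" using tail by simp
    also have "\<dots> = measure P (space P - {\<omega> \<in> space P. q \<omega> > 10 * M\<^sup>2 * V * L})"
      by (rule P.prob_compl[symmetric]) (use qm in measurable)
    also have "\<dots> \<le> measure P {\<omega> \<in> space P. ?err \<omega> \<le> ?bound}"
      by (rule P.finite_measure_mono[OF sub meas])
    finally show "1 - \<delta> \<le> measure P {\<omega> \<in> space P. ?err \<omega> \<le> ?bound}" .
  qed
qed

end
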